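(* Let $u<1$ be a real number, let $W$ be a standard Brownian motion, and let $W_{(u)}(t)=W(t)-u\,t\,W(1)$, $0\le t\le1$. Let $\psi:[0,1]\to\mathbb{R}$ be positive and twice continuously differentiable on $[0,1]$, and let $\vartheta=\int_0^1\sqrt{\psi(t)}\,dt$. Then, as $\varepsilon\to0+$, $$ \mathsf{P}\{\|W_{(u)}\|_\psi\leq\varepsilon\}\sim \frac{4\,\psi^{1/8}(0)}{(1-u)\sqrt\pi\,\vartheta\,\psi^{1/8}(1)}\, \varepsilon\, \exp\left(-\frac{\vartheta^2}{8}\varepsilon^{-2}\right). $$
   Context: For a process $X(t)$, $0\le t\le 1$, and a non-negative weight $\psi$ on $[0,1]$, $\|X\|_\psi=\left(\int_0^1X^2(t)\psi(t)\,dt\right)^{1/2}$. The process $W_{(u)}$ is a centered Gaussian process with covariance $\min(s,t)-(2u-u^2)st$. The notation $f(\varepsilon)\sim g(\varepsilon)$ means $f(\varepsilon)/g(\varepsilon)\to1$. $\psi^{a}(t)$ means $(\psi(t))^{a}$. *)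

theory Defs
  imports "HOL-Probability.Probability" "HOL-Library.Landau_Symbols"
begin

text \<open>Only the time interval [0,1] is constrained; values of \<open>W\<close> outside it are irrelevant.\<close>

locale standard_brownian_motion = prob_space M
  for M :: "'a measure" and W :: "real \<Rightarrow> 'a \<Rightarrow> real" +
  assumes rv: "\<And>t. t \<in> {0..1} \<Longrightarrow> random_variable borel (W t)"
    and start_zero: "AE \<omega> in M. W 0 \<omega> = 0"
    and indep_increments:
      "\<And>(n::nat) t. mono_on {..n} t \<Longrightarrow> t ` {..n} \<subseteq> {0..1} \<Longrightarrow>
        indep_vars (\<lambda>_. borel) (\<lambda>i \<omega>. W (t (Suc i)) \<omega> - W (t i) \<omega>) {..<n}"
    and gaussian_increments:
      "\<And>s t. 0 \<le> s \<Longrightarrow> s < t \<Longrightarrow> t \<le> 1 \<Longrightarrow>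
        distributed M lborel (\<lambda>\<omega>. W t \<omega> - W s \<omega>) (normal_density 0 (sqrt (t - s)))"
    and continuous_paths: "AE \<omega> in M. continuous_on {0..1} (\<lambda>t. W t \<omega>)"

definition W_sub :: "real \<Rightarrow> (real \<Rightarrow> 'a \<Rightarrow> real) \<Rightarrow> real \<Rightarrow> 'a \<Rightarrow> real" where
  "W_sub u W t \<omega> = W t \<omega> - u * t * W 1 \<omega>"

definition weighted_norm :: "(real \<Rightarrow> real) \<Rightarrow> (real \<Rightarrow> real) \<Rightarrow> real" where
  "weighted_norm \<psi> x = sqrt (LBINT t:{0..1}. (x t)\<^sup>2 * \<psi> t)"

text \<open>For a process \<open>X\<close> whose paths are continuous only almost surely, the event below
  need not lie in \<open>sets M\<close>, where \<open>measure M\<close> would be 0 by convention; it does lie in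
  \<open>sets (completion M)\<close>, and the two measures agree on \<open>sets M\<close>.\<close>

definition small_ball_prob ::
  "'a measure \<Rightarrow> (real \<Rightarrow> real) \<Rightarrow> (real \<Rightarrow> 'a \<Rightarrow> real) \<Rightarrow> real \<Rightarrow> real" where
  "small_ball_prob M \<psi> X \<epsilon> =
     measure (completion M) {\<omega> \<in> space M. weighted_norm \<psi> (\<lambda>t. X t \<omega>) \<le> \<epsilon>}"

text \<open>Derivatives at the endpoints of \<open>S\<close> are one-sided.\<close>

definition twice_continuously_differentiable_on :: "(real \<Rightarrow> real) \<Rightarrow> real set \<Rightarrow> bool" where
  "twice_continuously_differentiable_on f S \<longleftrightarrow>
     (\<exists>f' f''. (\<forall>t\<in>S. (f has_real_derivative f' t) (at t within S)) \<and>
               (\<forall>t\<in>S. (f' has_real_derivative f'' t) (at t within S)) \<and>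
               continuous_on S f'')"

end

theory Submission
  imports Defs "HOL-Real_Asymp.Real_Asymp"
begin

text \<open>
  Write \<open>Z = W_sub u W\<close>, \<open>X\<close> for the integral of \<open>Z\<^sup>2 \<psi>\<close> and \<open>a = \<psi> powr (- 1 / 4)\<close>. Discrete Gaussian
  integrals along a grid telescope for every positive sequence \<open>f k\<close>; in the limit this is a
  Cameron--Martin formula for quadratic functionals whose potential is \<open>f'' / f\<close>. Applied to the
  Liouville--Green function \<open>f = a cosh (s x)\<close> with \<open>x' = sqrt \<psi>\<close>, where \<open>f'' / f = s\<^sup>2 \<psi> + a'' / a\<close>,
  it gives the Laplace transform of \<open>X\<close> under a measure weighted by the exponential of a
  multiple of \<open>Z(1)\<^sup>2\<close> and of the integral of \<open>(a'' / a) Z\<^sup>2\<close>: for a constant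
  \<open>B\<close> it is exactly \<open>B / sqrt (cosh (s \<theta>)) = B sqrt 2 exp (- s \<theta> / 2) (1 + O (exp (- 2 s \<theta>)))\<close>. Each exponential in
  its binomial series is the transform of a Levy distribution, so uniqueness of Laplace
  transforms yields the weighted small ball asymptotics, and only the first term matters.
  On the small ball the weight tends to 1: the integral term is \<open>O(X)\<close>, and \<open>Z(1)\<close> is small by an
  exponential Chebyshev bound, obtained from \<open>f = a cosh (s x + 1)\<close>.
\<close>

section \<open>Levy distributions and uniqueness of Laplace transforms\<close>

text \<open>The weight has to be the same for all \<open>s\<close>; otherwise the exact formula
  would not be the Laplace transform of a single measure. This fixes the normalisation of
  \<open>x\<close>: it vanishes at time 1, so \<open>cosh (s x)\<close> has slope 0 there and
  \<open>f' 1 / f 1\<close> reduces to \<open>a' 1 / a 1\<close>. The remaining part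
  \<open>1 / (1 - u)\<^sup>2 - 1\<close> of the coefficient of \<open>Z(1)\<^sup>2\<close> comes
  from the density between the laws of \<open>W\<close> and \<open>W_(u)\<close>, which depends on
  the end value only; apart from it, \<open>u\<close> enters through the factor
  \<open>1 / (1 - u)\<close>. That coefficient may be positive, so the discrete densities need not
  be bounded. Their limit is controlled for large \<open>s\<close> only, which is enough, since
  small balls are governed by large \<open>s\<close>. For the same reason the weight need not be
  bounded on a small ball: a small norm does not force \<open>Z(1)\<close> to be small. The shift in
  \<open>cosh (s x + 1)\<close> gives a slope of order \<open>s\<close> at time 1 without changing
  the exponential rate, and this makes large \<open>Z(1)\<close> too expensive.\<close>

definition std_normal_cdf :: "real \<Rightarrow> real" where
  "std_normal_cdf y = measure std_normal_distribution {..y}"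

lemma std_normal_cdf_eq_cdf: "std_normal_cdf = cdf std_normal_distribution"
  by (auto simp: std_normal_cdf_def cdf_def)

lemma real_distribution_std_normal: "real_distribution std_normal_distribution"
proof -
  interpret prob_space "std_normal_distribution"
    by (rule prob_space_normal_density) simp
  show ?thesis by unfold_locales auto
qed

lemma std_normal_cdf_at_top: "(std_normal_cdf \<longlongrightarrow> 1) at_top"
  unfolding std_normal_cdf_eq_cdf
  by (rule real_distribution.cdf_lim_at_top_prob[OF real_distribution_std_normal])

lemma std_normal_cdf_at_bot: "(std_normal_cdf \<longlongrightarrow> 0) at_bot"
  unfolding std_normal_cdf_eq_cdf
  using finite_borel_measure.cdf_lim_at_bot real_distribution.finite_borel_measure_M real_distribution_std_normal by blast

lemma measure_std_normal:
  assumes "A \<in> sets borel"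
  shows "measure std_normal_distribution A = (LBINT x:A. std_normal_density x)"
proof -
  have "emeasure std_normal_distribution A = (\<integral>\<^sup>+x. ennreal (indicator A x * std_normal_density x) \<partial>lborel)"
    using assms by (subst emeasure_density) (auto intro!: nn_integral_cong split: split_indicator)
  also have "\<dots> = ennreal (LBINT x:A. std_normal_density x)"
    unfolding set_lebesgue_integral_def real_scaleR_def
    using assms integrable_mult_indicator[of A lborel std_normal_density]
    by (intro nn_integral_eq_integral) auto
  finally show ?thesis
    unfolding measure_def by (simp add: set_lebesgue_integral_def integral_nonneg_AE)
qed

lemma DERIV_std_normal_cdf: "DERIV std_normal_cdf y :> std_normal_density y"
proof -
  interpret real_distribution "std_normal_distribution" by (rule real_distribution_std_normal)
  let ?a = "y - 1" and ?b = "y + 1"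
  have cont: "continuous_on {?a..?b} std_normal_density"
    unfolding std_normal_density_def by (intro continuous_intros) auto
  have eq: "std_normal_cdf x = std_normal_cdf ?a + integral {?a..x} std_normal_density" if "x \<in> {?a<..<?b}" for x
  proof -
    have "cdf std_normal_distribution x - cdf std_normal_distribution ?a
       = measure std_normal_distribution {?a<..x}"
      using that by (intro cdf_diff_eq) auto
    also have "\<dots> = (LBINT x:{?a<..x}. std_normal_density x)"
      by (intro measure_std_normal) auto
    also have "\<dots> = (LBINT x:{?a..x}. std_normal_density x)"
      unfolding set_lebesgue_integral_def
      by (intro integral_cong_AE) (use AE_lborel_singleton[of ?a] in \<open>auto split: split_indicator\<close>)
    also have "\<dots> = integral {?a..x} std_normal_density"
      using that by (intro set_borel_integral_eq_integral borel_integrable_atLeastAtMost'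
         continuous_on_subset[OF cont]) auto
    finally show ?thesis by (simp add: std_normal_cdf_eq_cdf)
  qed
  have "((\<lambda>x. integral {?a..x} std_normal_density) has_real_derivative std_normal_density y) (at y within {?a..?b})"
    by (rule integral_has_real_derivative[OF cont]) auto
  hence "((\<lambda>x. std_normal_cdf ?a + integral {?a..x} std_normal_density) has_real_derivative std_normal_density y) (at y)"
    by (subst (asm) at_within_interior) (auto intro!: derivative_eq_intros)
  then show ?thesis
    by (rule has_field_derivative_transform_within_open[where S="{?a<..<?b}"]) (use eq in auto)
qed

lemmas DERIV_std_normal_cdf' [derivative_intros] = DERIV_std_normal_cdf[THEN DERIV_chain2]

text \<open>The law of \<open>c\<^sup>2 / N\<^sup>2\<close> for a standard normal \<open>N\<close> is the Levy distribution,
  that is, the hitting time of level \<open>c\<close> by Brownian motion.\<close>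

lemma levy_laplace_half:
  assumes b: "b > 0"
  shows "has_bochner_integral lborel (\<lambda>x. indicator {0<..} x *\<^sub>R (std_normal_density x * exp (- (b\<^sup>2 / (2 * x\<^sup>2))))) (exp (-b) / 2)"
proof -
  \<comment> \<open>The normal density at \<open>x - b / x\<close> times \<open>exp (-b)\<close> and
    the one at \<open>x + b / x\<close> times \<open>exp b\<close> both equal the integrand. The
    inner derivatives \<open>1 + b / x\<^sup>2\<close> and \<open>1 - b / x\<^sup>2\<close> average
    to 1, so this is an explicit antiderivative.\<close>
  let ?F = "\<lambda>x. (exp (-b) * std_normal_cdf (x - b / x) + exp b * std_normal_cdf (x + b / x)) / 2"
  let ?f = "\<lambda>x. std_normal_density x * exp (- (b\<^sup>2 / (2 * x\<^sup>2)))"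
  have D: "DERIV ?F x :> ?f x" if x: "x > 0" for x :: real
  proof -
    have 1: "exp (-b) * std_normal_density (x - b / x) = ?f x"
      using x by (auto simp: std_normal_density_def mult_exp_exp field_simps power2_eq_square)
    have 2: "exp b * std_normal_density (x + b / x) = ?f x"
      using x by (auto simp: std_normal_density_def mult_exp_exp field_simps power2_eq_square)
    have "DERIV ?F x :> (exp (-b) * (std_normal_density (x - b / x) * (1 + b / x\<^sup>2))
        + exp b * (std_normal_density (x + b / x) * (1 - b / x\<^sup>2))) / 2"
      using x by (auto intro!: derivative_eq_intros simp: power2_eq_square)
    also have "(exp (-b) * (std_normal_density (x - b / x) * (1 + b / x\<^sup>2))
        + exp b * (std_normal_density (x + b / x) * (1 - b / x\<^sup>2))) / 2 = 
       ((exp (-b) * std_normal_density (x - b / x)) * (1 + b / x\<^sup>2) + (exp b * std_normal_density (x + b / x)) * (1 - b / x\<^sup>2)) / 2"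
      by simp
    also have "\<dots> = ?f x" unfolding 1 2 by (simp add: field_simps)
    finally show ?thesis .
  qed
  have L1: "((\<lambda>x. std_normal_cdf (x - b / x)) \<longlongrightarrow> 0) (at_right 0)"
    by (rule filterlim_compose[OF std_normal_cdf_at_bot]) (use b in real_asymp)
  have L2: "((\<lambda>x. std_normal_cdf (x + b / x)) \<longlongrightarrow> 1) (at_right 0)"
    by (rule filterlim_compose[OF std_normal_cdf_at_top]) (use b in real_asymp)
  have L3: "((\<lambda>x. std_normal_cdf (x - b / x)) \<longlongrightarrow> 1) at_top"
    by (rule filterlim_compose[OF std_normal_cdf_at_top]) (use b in real_asymp)
  have L4: "((\<lambda>x. std_normal_cdf (x + b / x)) \<longlongrightarrow> 1) at_top"
    by (rule filterlim_compose[OF std_normal_cdf_at_top]) (use b in real_asymp)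
  have ei: "einterval 0 \<infinity> = {0<..}" by (auto simp: einterval_def zero_ereal_def)
  have A: "((?F \<circ> real_of_ereal) \<longlongrightarrow> (exp (-b) * 0 + exp b * 1) / 2) (at_right (0::ereal))"
    unfolding zero_ereal_def ereal_tendsto_simps by (intro tendsto_intros L1 L2) auto
  have B: "((?F \<circ> real_of_ereal) \<longlongrightarrow> (exp (-b) * 1 + exp b * 1) / 2) (at_left (\<infinity>::ereal))"
    unfolding ereal_tendsto_simps by (intro tendsto_intros L3 L4) auto
  have C: "isCont ?f x" if "x > 0" for x
    using that unfolding std_normal_density_def by (intro continuous_intros) auto
  note FTC = interval_integral_FTC_nonneg[of 0 "\<infinity>" ?F ?f, OF _ _ _ _ A B]
  have "set_integrable lborel (einterval 0 \<infinity>) ?f"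
    by (rule FTC(1)) (use D C in auto)
  moreover have "(LBINT x=0..\<infinity>. ?f x) = (exp (-b) * 1 + exp b * 1) / 2 - (exp (-b) * 0 + exp b * 1) / 2"
    by (rule FTC(2)) (use D C in auto)
  ultimately show ?thesis
    unfolding interval_lebesgue_integral_def ei set_integrable_def set_lebesgue_integral_def
    by (auto simp: has_bochner_integral_iff field_simps)
qed

lemma levy_laplace:
  assumes "c > 0" "l > 0"
  shows "has_bochner_integral std_normal_distribution (\<lambda>x. exp (- l * (c\<^sup>2 / x\<^sup>2))) (exp (- c * sqrt (2 * l)))"
proof -
  define b where "b = c * sqrt (2 * l)"
  have b: "b > 0" "b\<^sup>2 = 2 * l * c\<^sup>2" using assms by (auto simp: b_def power_mult_distrib)
  have *: "l * c\<^sup>2 / x\<^sup>2 = b\<^sup>2 / (2 * x\<^sup>2)" for x by (simp add: b)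
  \<comment> \<open>The rule for even functions uses the closed half-line. The added point 0, where
    division by zero makes the exponential equal to 1, is a null set.\<close>
  have "has_bochner_integral lborel (\<lambda>x. indicator {0..} x *\<^sub>R (std_normal_density x * exp (- (b\<^sup>2 / (2 * x\<^sup>2))))) (exp (-b) / 2)"
    by (rule has_bochner_integralI_AE[OF levy_laplace_half[OF b(1)]])
       (use AE_lborel_singleton[of 0] in \<open>auto split: split_indicator simp: std_normal_density_def\<close>)
  hence "has_bochner_integral lborel (\<lambda>x. std_normal_density x * exp (- (b\<^sup>2 / (2 * x\<^sup>2)))) (2 *\<^sub>R (exp (-b) / 2))"
    by (rule has_bochner_integral_even_function) (auto simp: std_normal_density_def)
  then show ?thesis
    using assms by (subst has_bochner_integral_density) (auto simp: * b_def)
qed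

section \<open>Distribution function and tails of the Levy law\<close>

lemma std_normal_cdf_minus: "std_normal_cdf (- a) = 1 - std_normal_cdf a"
proof -
  \<comment> \<open>The density is even, so the sum of the two values is constant; the constant is
    read off at infinity.\<close>
  have "DERIV (\<lambda>a. std_normal_cdf (- a) + std_normal_cdf a) x :> 0" for x
    by (auto intro!: derivative_eq_intros simp: std_normal_density_def)
  hence const: "std_normal_cdf (- x) + std_normal_cdf x = std_normal_cdf (- a) + std_normal_cdf a" for x
    using DERIV_isconst_all by blast
  have "((\<lambda>x. std_normal_cdf (- x) + std_normal_cdf x) \<longlongrightarrow> 0 + 1) at_top"
    by (intro tendsto_add std_normal_cdf_at_top filterlim_compose[OF std_normal_cdf_at_bot]
          filterlim_uminus_at_bot_at_top)
  moreover have "(\<lambda>x. std_normal_cdf (- x) + std_normal_cdf x) = (\<lambda>_. std_normal_cdf (- a) + std_normal_cdf a)"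
    using const by blast
  ultimately have "std_normal_cdf (- a) + std_normal_cdf a = 0 + 1"
    by (metis tendsto_const_iff trivial_limit_at_top_linorder)
  then show ?thesis by simp
qed

lemma measure_levy_le:
  assumes c: "c > 0" and r: "r > 0"
  shows "measure std_normal_distribution {x. c\<^sup>2 / x\<^sup>2 \<le> r} = 2 * (1 - std_normal_cdf (c / sqrt r))"
proof -
  interpret real_distribution "std_normal_distribution" by (rule real_distribution_std_normal)
  define a where "a = c / sqrt r"
  have a: "a > 0" using assms by (simp add: a_def)
  have "c\<^sup>2 / x\<^sup>2 \<le> r \<longleftrightarrow> a \<le> \<bar>x\<bar>" if "x \<noteq> 0" for x
  proof -
    have "c\<^sup>2 / x\<^sup>2 \<le> r \<longleftrightarrow> a\<^sup>2 \<le> x\<^sup>2"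
      using that assms by (simp add: a_def power_divide divide_simps mult.commute)
    then show ?thesis using a by (metis abs_le_square_iff abs_of_pos)
  qed
  \<comment> \<open>The half-open pieces match the distribution function. The two sets differ at 0,
    where \<open>c\<^sup>2 / x\<^sup>2\<close> evaluates to 0, and at \<open>a\<close>; both points
    are null.\<close>
  hence "AE x in std_normal_distribution. x \<in> {x. c\<^sup>2 / x\<^sup>2 \<le> r} \<longleftrightarrow> x \<in> {..-a} \<union> {a<..}"
  proof (subst AE_density)
    show "AE x in lborel. 0 < ennreal (std_normal_density x) \<longrightarrow> x \<in> {x. c\<^sup>2 / x\<^sup>2 \<le> r} \<longleftrightarrow> x \<in> {..-a} \<union> {a<..}"
      using AE_lborel_singleton[of 0] AE_lborel_singleton[of a]
      by eventually_elim (use a \<open>\<And>x. x \<noteq> 0 \<Longrightarrow> (c\<^sup>2 / x\<^sup>2 \<le> r) = (a \<le> \<bar>x\<bar>)\<close> in auto)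
  qed simp
  hence "prob {x. c\<^sup>2 / x\<^sup>2 \<le> r} = prob ({..-a} \<union> {a<..})"
    by (intro measure_eq_AE) auto
  also have "\<dots> = prob {..-a} + prob (UNIV - {..a})"
    using a by (subst finite_measure_Union) (auto intro!: arg_cong[where f=prob])
  also have "prob (UNIV - {..a}) = 1 - prob {..a}"
    using prob_compl[of "{..a}"] by simp
  also have "prob {..-a} = 1 - prob {..a}"
    using std_normal_cdf_minus[of a] by (simp add: std_normal_cdf_def)
  finally show ?thesis by (simp add: std_normal_cdf_def a_def)
qed

text \<open>Mills ratio bounds. Both differences tend to 0 at infinity and decrease on the positive
  axis, hence are nonnegative. The two bounds agree up to a relative error
  \<open>1 / x\<^sup>2\<close>.\<close>

lemma std_normal_tail_bounds:
  assumes "x > 0"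
  shows "1 - std_normal_cdf x \<le> std_normal_density x / x"
    "(1 / x - 1 / x ^ 3) * std_normal_density x \<le> 1 - std_normal_cdf x"
proof -
  have d: "DERIV std_normal_density y :> - y * std_normal_density y" for y
  proof -
    have "DERIV (\<lambda>y. K * exp (- y\<^sup>2 / 2)) y :> - y * (K * exp (- y\<^sup>2 / 2))" for K :: real
      by (auto intro!: derivative_eq_intros)
    then show ?thesis unfolding std_normal_density_def .
  qed
  have lim: "(std_normal_density \<longlongrightarrow> 0) at_top"
    unfolding std_normal_density_def by real_asymp
  let ?D = "\<lambda>x. std_normal_density x / x - (1 - std_normal_cdf x)"
  let ?E = "\<lambda>x. (1 - std_normal_cdf x) - (1 / x - 1 / x ^ 3) * std_normal_density x"
  have D: "DERIV ?D y :> - std_normal_density y / y\<^sup>2" if "y > 0" for y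
    using that by (auto intro!: derivative_eq_intros d DERIV_std_normal_cdf simp: field_simps power2_eq_square)
  have E: "DERIV ?E y :> - 3 * std_normal_density y / y ^ 4" if "y > 0" for y
  proof -
    have "DERIV (\<lambda>x. 1 / x - 1 / x ^ 3) y :> 3 / y ^ 4 - 1 / y\<^sup>2"
      using that by (auto intro!: derivative_eq_intros simp: field_simps eval_nat_numeral)
    from DERIV_diff[OF DERIV_diff[OF DERIV_const[of 1] DERIV_std_normal_cdf] DERIV_mult[OF this d]]
    show ?thesis by (rule DERIV_cong) (use that in \<open>simp add: field_simps eval_nat_numeral\<close>)
  qed
  have "(?D \<longlongrightarrow> 0 * 0 - (1 - 1)) at_top"
    unfolding divide_inverse
    by (intro tendsto_intros lim std_normal_cdf_at_top tendsto_inverse_0_at_top filterlim_ident)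
  hence Dl: "(?D \<longlongrightarrow> 0) at_top" by simp
  have "(?E \<longlongrightarrow> (1 - 1) - 0 * 0) at_top"
    by (intro tendsto_diff tendsto_mult lim std_normal_cdf_at_top tendsto_const) real_asymp
  hence El: "(?E \<longlongrightarrow> 0) at_top" by simp
  have "?D x \<ge> 0"
  proof (rule tendsto_upperbound[OF Dl])
    show "\<forall>\<^sub>F y in at_top. ?D y \<le> ?D x"
      using eventually_ge_at_top[of x]
    proof eventually_elim
      fix y assume "x \<le> y"
      show "?D y \<le> ?D x"
      proof (rule DERIV_nonpos_imp_nonincreasing[OF \<open>x \<le> y\<close>])
        fix z assume "x \<le> z" "z \<le> y"
        with D[of z] assms show "\<exists>d. DERIV ?D z :> d \<and> d \<le> 0"
          by (intro exI conjI) auto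
      qed
    qed
  qed auto
  then show "1 - std_normal_cdf x \<le> std_normal_density x / x" by simp
  have "?E x \<ge> 0"
  proof (rule tendsto_upperbound[OF El])
    show "\<forall>\<^sub>F y in at_top. ?E y \<le> ?E x"
      using eventually_ge_at_top[of x]
    proof eventually_elim
      fix y assume "x \<le> y"
      show "?E y \<le> ?E x"
      proof (rule DERIV_nonpos_imp_nonincreasing[OF \<open>x \<le> y\<close>])
        fix z assume "x \<le> z" "z \<le> y"
        with E[of z] assms show "\<exists>d. DERIV ?E z :> d \<and> d \<le> 0"
          by (intro exI conjI) auto
      qed
    qed
  qed auto
  then show "(1 / x - 1 / x ^ 3) * std_normal_density x \<le> 1 - std_normal_cdf x" by simp
qed

lemma norm_integral_le_integral:
  fixes f :: "'a \<Rightarrow> 'b::{banach, second_countable_topology}"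
  assumes "integrable M f" "integrable M g" "\<And>x. norm (f x) \<le> g x"
  shows "norm (\<integral>x. f x \<partial>M) \<le> (\<integral>x. g x \<partial>M)"
  by (rule order_trans[OF integral_norm_bound integral_mono]) (use assms in auto)

text \<open>Markov's inequality for \<open>exp (- l * (c\<^sup>2 / x\<^sup>2))\<close> with
  \<open>l = d\<^sup>2 / (2 * r\<^sup>2)\<close>. The choice \<open>d = c\<close> is optimal, but a
  free \<open>d\<close> makes the exponent linear in \<open>c\<close>, so that the bounds can be
  summed over equidistant levels.\<close>

lemma levy_le_chernoff:
  assumes "c > 0" "r > 0" "d > 0"
  shows "measure std_normal_distribution {x. c\<^sup>2 / x\<^sup>2 \<le> r} \<le> exp (d\<^sup>2 / (2 * r) - c * d / r)"
proof -
  interpret real_distribution std_normal_distribution by (rule real_distribution_std_normal)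
  define l where "l = d\<^sup>2 / (2 * r\<^sup>2)"
  have l: "l > 0" using assms by (simp add: l_def)
  have sq: "sqrt (2 * l) = d / r"
    using assms by (simp add: l_def real_sqrt_divide)
  note L = levy_laplace[OF \<open>c > 0\<close> l]
  have "prob {x. c\<^sup>2 / x\<^sup>2 \<le> r} = (\<integral>x. indicator {x. c\<^sup>2 / x\<^sup>2 \<le> r} x \<partial>std_normal_distribution)"
    by simp
  also have "\<dots> \<le> (\<integral>x. exp (l * r) * exp (- l * (c\<^sup>2 / x\<^sup>2)) \<partial>std_normal_distribution)"
  proof (intro integral_mono)
    show "integrable std_normal_distribution (\<lambda>x. exp (l * r) * exp (- l * (c\<^sup>2 / x\<^sup>2)))"
      using L by (intro integrable_mult_right) (simp add: has_bochner_integral_iff)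
    show "indicator {x. c\<^sup>2 / x\<^sup>2 \<le> r} x \<le> exp (l * r) * exp (- l * (c\<^sup>2 / x\<^sup>2))" for x
    proof (cases "c\<^sup>2 / x\<^sup>2 \<le> r")
      case True
      hence "l * (c\<^sup>2 / x\<^sup>2) \<le> l * r" using l by (intro mult_left_mono) auto
      then show ?thesis by (simp add: mult_exp_exp True)
    qed simp
    show "integrable std_normal_distribution (indicat_real {x. c\<^sup>2 / x\<^sup>2 \<le> r})"
      by (rule integrable_real_indicator) (auto simp: emeasure_eq_measure)
  qed
  also have "\<dots> = exp (l * r) * exp (- c * sqrt (2 * l))"
    using L by (simp add: has_bochner_integral_iff)
  also have "\<dots> = exp (d\<^sup>2 / (2 * r) - c * d / r)"
    unfolding sq using assms by (simp add: l_def mult_exp_exp power2_eq_square field_simps)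
  finally show ?thesis .
qed

text \<open>Powers of \<open>exp (- X)\<close> shift \<open>m\<close>, so the transforms at the
  integers \<open>m \<ge> n0\<close> give the identity for every polynomial \<open>g\<close>. The
  variable \<open>exp (- X)\<close> stays in the unit interval, and Weierstrass approximation there
  extends the identity to continuous \<open>g\<close>. The coefficients \<open>b k\<close> may
  change sign; absolute summability at \<open>n0\<close> makes the approximation error uniform over
  the whole series. The factor \<open>exp (- n0 * X)\<close> keeps the weighted integrals
  finite.\<close>

lemma laplace_unique_series:
  fixes w X :: "'a \<Rightarrow> real" and b c :: "nat \<Rightarrow> real" and n0 :: nat and g :: "real \<Rightarrow> real"
  assumes [measurable]: "w \<in> borel_measurable M" "X \<in> borel_measurable M"
    and X: "\<And>\<omega>. X \<omega> \<ge> 0" and w: "\<And>\<omega>. w \<omega> \<ge> 0"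
    and c: "\<And>k. c k > 0" and n0: "n0 > 0"
    and L: "\<And>m. m \<ge> n0 \<Longrightarrow> has_bochner_integral M (\<lambda>\<omega>. w \<omega> * exp (- real m * X \<omega>)) (l m)"
    and S: "\<And>m. m \<ge> n0 \<Longrightarrow> (\<lambda>k. b k * exp (- c k * sqrt (2 * real m))) sums l m"
    and S0: "summable (\<lambda>k. \<bar>b k\<bar> * exp (- c k * sqrt (2 * real n0)))"
    and g: "continuous_on UNIV g"
  shows "(\<lambda>k. b k * (\<integral>x. exp (- real n0 * ((c k)\<^sup>2 / x\<^sup>2)) * g (exp (- ((c k)\<^sup>2 / x\<^sup>2))) \<partial>std_normal_distribution))
           sums (\<integral>\<omega>. w \<omega> * exp (- real n0 * X \<omega>) * g (exp (- X \<omega>)) \<partial>M)"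
proof -
  define T where "T k x = (c k)\<^sup>2 / x\<^sup>2" for k and x :: real
  have T0: "T k x \<ge> 0" for k x by (simp add: T_def)
  have [measurable]: "T k \<in> borel_measurable borel" for k unfolding T_def by measurable
  have LT: "has_bochner_integral std_normal_distribution (\<lambda>x. exp (- real m * T k x)) (exp (- c k * sqrt (2 * real m)))"
    if "m \<ge> n0" for m k
    using levy_laplace[of "c k" "real m"] c n0 that by (simp add: T_def)
  define A where "A h = (\<integral>\<omega>. w \<omega> * exp (- real n0 * X \<omega>) * h (exp (- X \<omega>)) \<partial>M)" for h :: "real \<Rightarrow> real"
  define Z where "Z h k = (\<integral>x. exp (- real n0 * T k x) * h (exp (- T k x)) \<partial>std_normal_distribution)" for h :: "real \<Rightarrow> real" and k
  define E where "E k = exp (- c k * sqrt (2 * real n0))" for k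
  have bounded: "\<exists>B. \<forall>x\<in>{0..1}. \<bar>h x\<bar> \<le> B" if "continuous_on UNIV h" for h :: "real \<Rightarrow> real"
  proof -
    have "compact (h ` {0..1})"
      by (intro compact_continuous_image continuous_on_subset[OF that]) auto
    then show ?thesis by (auto dest!: compact_imp_bounded simp: bounded_iff)
  qed
  have int: "integrable M (\<lambda>\<omega>. w \<omega> * exp (- real n0 * X \<omega>) * h (exp (- X \<omega>)))"
      "integrable std_normal_distribution (\<lambda>x. exp (- real n0 * T k x) * h (exp (- T k x)))"
    if h: "continuous_on UNIV h" for h :: "real \<Rightarrow> real" and k
  proof -
    have [measurable]: "h \<in> borel_measurable borel" by (rule borel_measurable_continuous_onI[OF h])
    obtain B where B: "\<And>x. x \<in> {0..1} \<Longrightarrow> \<bar>h x\<bar> \<le> B" using bounded[OF h] by blast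
    show "integrable M (\<lambda>\<omega>. w \<omega> * exp (- real n0 * X \<omega>) * h (exp (- X \<omega>)))"
    proof (rule Bochner_Integration.integrable_bound)
      show "integrable M (\<lambda>\<omega>. B * (w \<omega> * exp (- real n0 * X \<omega>)))"
        using L[of n0] by (intro integrable_mult_right) (simp add: has_bochner_integral_iff)
      show "AE \<omega> in M. norm (w \<omega> * exp (- real n0 * X \<omega>) * h (exp (- X \<omega>))) \<le> norm (B * (w \<omega> * exp (- real n0 * X \<omega>)))"
      proof (rule AE_I2)
        fix \<omega>
        have "\<bar>h (exp (- X \<omega>))\<bar> \<le> \<bar>B\<bar>" using B[of "exp (- X \<omega>)"] X[of \<omega>] by simp
        then show "norm (w \<omega> * exp (- real n0 * X \<omega>) * h (exp (- X \<omega>))) \<le> norm (B * (w \<omega> * exp (- real n0 * X \<omega>)))"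
          by (simp add: abs_mult mult.commute mult_right_mono)
      qed
    qed measurable
    show "integrable std_normal_distribution (\<lambda>x. exp (- real n0 * T k x) * h (exp (- T k x)))"
    proof (rule Bochner_Integration.integrable_bound)
      show "integrable std_normal_distribution (\<lambda>x. B * exp (- real n0 * T k x))"
        using LT[of n0 k] by (intro integrable_mult_right) (simp add: has_bochner_integral_iff)
      show "AE x in std_normal_distribution. norm (exp (- real n0 * T k x) * h (exp (- T k x))) \<le> norm (B * exp (- real n0 * T k x))"
      proof (rule AE_I2)
        fix x
        have "\<bar>h (exp (- T k x))\<bar> \<le> \<bar>B\<bar>" using B[of "exp (- T k x)"] T0[of k x] by simp
        then show "norm (exp (- real n0 * T k x) * h (exp (- T k x))) \<le> norm (B * exp (- real n0 * T k x))"
          by (simp add: abs_mult mult.commute mult_right_mono)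
      qed
    qed measurable
  qed
  have A_diff: "\<bar>A h - A p\<bar> \<le> e * l n0" and Z_diff: "\<bar>Z h k - Z p k\<bar> \<le> e * E k"
    if h: "continuous_on UNIV h" and p: "continuous_on UNIV p"
      and e: "\<And>x. x \<in> {0..1} \<Longrightarrow> \<bar>h x - p x\<bar> \<le> e" for h p e k
  proof -
    have "norm (A h - A p) = norm (\<integral>\<omega>. w \<omega> * exp (- real n0 * X \<omega>) * h (exp (- X \<omega>)) - w \<omega> * exp (- real n0 * X \<omega>) * p (exp (- X \<omega>)) \<partial>M)"
      unfolding A_def by (subst Bochner_Integration.integral_diff) (use int h p in auto)
    also have "\<dots> \<le> (\<integral>\<omega>. e * (w \<omega> * exp (- real n0 * X \<omega>)) \<partial>M)"
    proof (rule norm_integral_le_integral)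
      fix \<omega>
      have "w \<omega> * exp (- real n0 * X \<omega>) * \<bar>h (exp (- X \<omega>)) - p (exp (- X \<omega>))\<bar> \<le> w \<omega> * exp (- real n0 * X \<omega>) * e"
        using w X by (intro mult_left_mono e) auto
      moreover have "w \<omega> * exp (- real n0 * X \<omega>) * h (exp (- X \<omega>)) - w \<omega> * exp (- real n0 * X \<omega>) * p (exp (- X \<omega>))
         = w \<omega> * exp (- real n0 * X \<omega>) * (h (exp (- X \<omega>)) - p (exp (- X \<omega>)))"
        by (simp add: algebra_simps)
      ultimately show "norm (w \<omega> * exp (- real n0 * X \<omega>) * h (exp (- X \<omega>)) - w \<omega> * exp (- real n0 * X \<omega>) * p (exp (- X \<omega>)))
          \<le> e * (w \<omega> * exp (- real n0 * X \<omega>))"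
        using w[of \<omega>] by (simp add: abs_mult mult_ac)
    qed (use int h p L[of n0] in \<open>auto simp: has_bochner_integral_iff\<close>)
    also have "\<dots> = e * l n0" using L[of n0] by (simp add: has_bochner_integral_iff)
    finally show "\<bar>A h - A p\<bar> \<le> e * l n0" by simp
    have "norm (Z h k - Z p k) = norm (\<integral>x. exp (- real n0 * T k x) * h (exp (- T k x)) - exp (- real n0 * T k x) * p (exp (- T k x)) \<partial>std_normal_distribution)"
      unfolding Z_def by (subst Bochner_Integration.integral_diff) (use int h p in auto)
    also have "\<dots> \<le> (\<integral>x. e * exp (- real n0 * T k x) \<partial>std_normal_distribution)"
    proof (rule norm_integral_le_integral)
      fix x
      have "exp (- real n0 * T k x) * \<bar>h (exp (- T k x)) - p (exp (- T k x))\<bar> \<le> exp (- real n0 * T k x) * e"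
        using T0 by (intro mult_left_mono e) auto
      moreover have "exp (- real n0 * T k x) * h (exp (- T k x)) - exp (- real n0 * T k x) * p (exp (- T k x))
         = exp (- real n0 * T k x) * (h (exp (- T k x)) - p (exp (- T k x)))"
        by (simp add: algebra_simps)
      ultimately show "norm (exp (- real n0 * T k x) * h (exp (- T k x)) - exp (- real n0 * T k x) * p (exp (- T k x)))
          \<le> e * exp (- real n0 * T k x)"
        by (simp add: abs_mult mult_ac)
    qed (use int h p LT[of n0 k] in \<open>auto simp: has_bochner_integral_iff\<close>)
    also have "\<dots> = e * E k" using LT[of n0 k] by (simp add: has_bochner_integral_iff E_def)
    finally show "\<bar>Z h k - Z p k\<bar> \<le> e * E k" by simp
  qed
  have S0': "summable (\<lambda>k. \<bar>b k\<bar> * E k)" using S0 by (simp add: E_def)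
  have summ: "summable (\<lambda>k. b k * Z h k)" if h: "continuous_on UNIV h" for h
  proof -
    obtain B where B: "\<And>x. x \<in> {0..1} \<Longrightarrow> \<bar>h x\<bar> \<le> B" using bounded[OF h] by blast
    have "\<bar>Z h k - Z (\<lambda>_. 0) k\<bar> \<le> B * E k" for k by (rule Z_diff) (use h B in auto)
    hence Zb: "\<bar>Z h k\<bar> \<le> B * E k" for k by (simp add: Z_def)
    show ?thesis
    proof (rule summable_comparison_test'[of "\<lambda>k. B * (\<bar>b k\<bar> * E k)" 0])
      show "norm (b k * Z h k) \<le> B * (\<bar>b k\<bar> * E k)" for k
        using mult_left_mono[OF Zb[of k], of "\<bar>b k\<bar>"] by (simp add: abs_mult mult_ac)
    qed (intro summable_mult S0')
  qed
  have poly: "(\<lambda>k. b k * Z (\<lambda>x. \<Sum>i\<le>d. a i * x ^ i) k) sums A (\<lambda>x. \<Sum>i\<le>d. a i * x ^ i)" for a and d :: nat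
  proof -
    have ee: "exp (- real n0 * y) * exp (- y) ^ i = exp (- real (n0 + i) * y)" for y :: real and i
      by (simp add: exp_of_nat_mult[symmetric] mult_exp_exp algebra_simps)
    have "has_bochner_integral M (\<lambda>\<omega>. \<Sum>i\<le>d. a i * (w \<omega> * exp (- real (n0 + i) * X \<omega>))) (\<Sum>i\<le>d. a i * l (n0 + i))"
      by (intro has_bochner_integral_sum has_bochner_integral_mult_right L) simp
    also have "(\<lambda>\<omega>. \<Sum>i\<le>d. a i * (w \<omega> * exp (- real (n0 + i) * X \<omega>))) = (\<lambda>\<omega>. w \<omega> * exp (- real n0 * X \<omega>) * (\<Sum>i\<le>d. a i * exp (- X \<omega>) ^ i))"
      unfolding sum_distrib_left ee[symmetric] by (simp only: mult_ac)
    finally have 1: "A (\<lambda>x. \<Sum>i\<le>d. a i * x ^ i) = (\<Sum>i\<le>d. a i * l (n0 + i))"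
      by (simp add: A_def has_bochner_integral_iff)
    have 2: "Z (\<lambda>x. \<Sum>i\<le>d. a i * x ^ i) k = (\<Sum>i\<le>d. a i * exp (- c k * sqrt (2 * real (n0 + i))))" for k
    proof -
      have "has_bochner_integral std_normal_distribution (\<lambda>x. \<Sum>i\<le>d. a i * exp (- real (n0 + i) * T k x)) (\<Sum>i\<le>d. a i * exp (- c k * sqrt (2 * real (n0 + i))))"
        by (intro has_bochner_integral_sum has_bochner_integral_mult_right LT) simp
      also have "(\<lambda>x. \<Sum>i\<le>d. a i * exp (- real (n0 + i) * T k x)) = (\<lambda>x. exp (- real n0 * T k x) * (\<Sum>i\<le>d. a i * exp (- T k x) ^ i))"
        unfolding sum_distrib_left ee[symmetric] by (simp only: mult_ac)
      finally show ?thesis by (simp add: Z_def has_bochner_integral_iff)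
    qed
    have "(\<lambda>k. \<Sum>i\<le>d. a i * (b k * exp (- c k * sqrt (2 * real (n0 + i))))) sums (\<Sum>i\<le>d. a i * l (n0 + i))"
      by (intro sums_sum sums_mult S) simp
    then show ?thesis unfolding 1 2 by (simp add: sum_distrib_left mult_ac)
  qed
  have "\<bar>A g - (\<Sum>k. b k * Z g k)\<bar> \<le> e * (l n0 + (\<Sum>k. \<bar>b k\<bar> * E k))" if e: "e > 0" for e
  proof -
    obtain p where p: "real_polynomial_function p" "\<And>x. x \<in> {0..1} \<Longrightarrow> \<bar>g x - p x\<bar> < e"
      using Stone_Weierstrass_real_polynomial_function[of "{0..1::real}" g e] e g
      by (metis compact_Icc continuous_on_subset subset_UNIV)
    obtain a d where pe: "p = (\<lambda>x. \<Sum>i\<le>d. a i * x ^ i)"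
      using p(1) by (auto simp: real_polynomial_function_iff_sum)
    have pc: "continuous_on UNIV p" unfolding pe by (intro continuous_intros)
    have Ap: "A p = (\<Sum>k. b k * Z p k)" using poly[of a d] by (simp add: pe sums_iff)
    have dA: "\<bar>A g - A p\<bar> \<le> e * l n0" by (rule A_diff) (use g pc p(2) in \<open>auto intro: less_imp_le\<close>)
    have dZ: "\<bar>Z g k - Z p k\<bar> \<le> e * E k" for k by (rule Z_diff) (use g pc p(2) in \<open>auto intro: less_imp_le\<close>)
    have dZ': "\<bar>b k * Z g k - b k * Z p k\<bar> \<le> e * (\<bar>b k\<bar> * E k)" for k
      using mult_left_mono[OF dZ[of k], of "\<bar>b k\<bar>"] by (simp add: abs_mult[symmetric] algebra_simps)
    have "\<bar>(\<Sum>k. b k * Z g k) - (\<Sum>k. b k * Z p k)\<bar> = \<bar>\<Sum>k. b k * Z g k - b k * Z p k\<bar>"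
      by (subst suminf_diff) (use summ g pc in auto)
    also have "\<dots> \<le> (\<Sum>k. e * (\<bar>b k\<bar> * E k))"
      using norm_suminf_le[of "\<lambda>k. b k * Z g k - b k * Z p k" "\<lambda>k. e * (\<bar>b k\<bar> * E k)"] dZ' S0'
      by (auto intro: summable_mult)
    also have "\<dots> = e * (\<Sum>k. \<bar>b k\<bar> * E k)" by (rule suminf_mult) (rule S0')
    finally show ?thesis using dA Ap by (simp add: algebra_simps)
  qed
  note * = this
  have "\<bar>A g - (\<Sum>k. b k * Z g k)\<bar> \<le> 0"
  proof (rule tendsto_lowerbound)
    show "((\<lambda>e. e * (l n0 + (\<Sum>k. \<bar>b k\<bar> * E k))) \<longlongrightarrow> 0) (at_right 0)"
      by (auto intro!: tendsto_eq_intros)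
    show "\<forall>\<^sub>F e in at_right 0. \<bar>A g - (\<Sum>k. b k * Z g k)\<bar> \<le> e * (l n0 + (\<Sum>k. \<bar>b k\<bar> * E k))"
      using eventually_at_right_less[of 0] by eventually_elim (rule *)
  qed simp
  then show ?thesis using summ[OF g] unfolding A_def Z_def T_def by (simp add: sums_iff)
qed

section \<open>From the Laplace transform to small balls\<close>

text \<open>The ratio of consecutive coefficients is \<open>(1 / 2 + k) / (k + 1)\<close> in
  absolute value, which is at most 1.\<close>

lemma abs_gbinomial_minus_half_le: "\<bar>(- 1 / 2 :: real) gchoose k\<bar> \<le> 1"
proof (induction k)
  case (Suc k)
  let ?g = "\<lambda>k. (- 1 / 2 :: real) gchoose k"
  have "real (Suc k) * ?g (Suc k) = (- 1 / 2 - real k) * ?g k"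
    using gbinomial_mult_1[of "- 1 / 2 :: real" k] by (simp add: algebra_simps)
  from arg_cong[OF this, of abs] have "real (Suc k) * \<bar>?g (Suc k)\<bar> = (1 / 2 + real k) * \<bar>?g k\<bar>"
    unfolding abs_mult by simp
  also have "\<dots> \<le> real (Suc k) * 1"
    using Suc by (intro mult_mono) auto
  finally show ?case by (simp del: of_nat_Suc)
qed simp

text \<open>Writing \<open>cosh y = exp y / 2 * (1 + z)\<close> with
  \<open>z = exp (- 2 * y)\<close> reduces this to the binomial series, convergent because
  \<open>z < 1\<close>. The exponents \<open>1 / 2 + 2 * k\<close> determine the levels of the Levy
  laws.\<close>

lemma cosh_powr_minus_half_sums:
  fixes y :: real
  assumes "y > 0"
  shows "(\<lambda>k. sqrt 2 * ((- 1 / 2) gchoose k) * exp (- (1 / 2 + 2 * real k) * y)) sums cosh y powr (- 1 / 2)"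
proof -
  define z where "z = exp (- 2 * y)"
  have z: "0 < z" "z < 1" using assms by (auto simp: z_def)
  have "cosh y = exp y / 2 * (1 + z)"
    by (simp add: cosh_def z_def field_simps mult_exp_exp)
  hence "cosh y powr (- 1 / 2) = (exp y / 2) powr (- 1 / 2) * (1 + z) powr (- 1 / 2)"
    using z by (simp only:) (subst powr_mult, auto)
  also have "(exp y / 2) powr (- 1 / 2) = sqrt 2 * exp (- y / 2)"
  proof -
    have "(exp y / 2) powr (- 1 / 2) = exp y powr (- 1 / 2) / 2 powr (- (1 / 2))"
      by (simp add: powr_divide)
    also have "\<dots> = exp (- y / 2) * 2 powr (1 / 2)"
      by (simp add: exp_powr_real powr_minus_divide exp_minus field_simps)
    finally show ?thesis by (simp add: powr_half_sqrt)
  qed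
  finally have eq: "cosh y powr (- 1 / 2) = sqrt 2 * exp (- y / 2) * (1 + z) powr (- 1 / 2)" .
  have "(\<lambda>k. sqrt 2 * exp (- y / 2) * (((- 1 / 2) gchoose k) * z ^ k)) sums cosh y powr (- 1 / 2)"
    unfolding eq by (intro sums_mult gen_binomial_real) (use z in auto)
  also have "(\<lambda>k. sqrt 2 * exp (- y / 2) * (((- 1 / 2) gchoose k) * z ^ k)) =
      (\<lambda>k. sqrt 2 * ((- 1 / 2) gchoose k) * exp (- (1 / 2 + 2 * real k) * y))"
    by (simp add: z_def exp_of_nat_mult[symmetric] mult_exp_exp fun_eq_iff algebra_simps)
  finally show ?thesis .
qed

text \<open>This interface keeps all that is used of Brownian motion: \<open>X\<close> stands for
  the squared weighted norm, \<open>Y\<close> for \<open>Z(1)\<close>, \<open>Q\<close> for the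
  integral of \<open>(a'' / a) Z\<^sup>2\<close>, and the real number \<open>a\<close> for the
  coefficient of \<open>Z(1)\<^sup>2\<close> that does not depend on \<open>s\<close>. In
  \<open>laplace_tilted\<close> this coefficient grows linearly in \<open>s\<close>, yet the bound
  decays at the same exponential rate as in \<open>laplace\<close>; the gap makes large
  \<open>Y\<close> unlikely on small balls.\<close>

locale small_ball_laplace = prob_space M for M :: "'a measure" +
  fixes X Y Q :: "'a \<Rightarrow> real" and \<theta> a c B C D s0 :: real
  assumes X_meas [measurable]: "X \<in> borel_measurable M"
    and Y_meas [measurable]: "Y \<in> borel_measurable M"
    and Q_meas [measurable]: "Q \<in> borel_measurable M"
    and X_nonneg: "\<And>\<omega>. X \<omega> \<ge> 0"
    and Q_bound: "AE \<omega> in M. \<bar>Q \<omega>\<bar> \<le> C * X \<omega>"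
    and pos: "C \<ge> 0" "\<theta> > 0" "c > 0" "B > 0" "D \<ge> 0" "s0 > 0"
    and laplace: "\<And>s. s \<ge> s0 \<Longrightarrow>
      (\<integral>\<^sup>+\<omega>. ennreal (exp (a / 2 * (Y \<omega>)\<^sup>2 - Q \<omega> / 2 - s\<^sup>2 / 2 * X \<omega>)) \<partial>M)
        = ennreal (B * cosh (s * \<theta>) powr (- 1 / 2))"
    and laplace_tilted: "\<And>s. s \<ge> s0 \<Longrightarrow>
      (\<integral>\<^sup>+\<omega>. ennreal (exp ((a + c * s) / 2 * (Y \<omega>)\<^sup>2 - Q \<omega> / 2 - s\<^sup>2 / 2 * X \<omega>)) \<partial>M)
        \<le> ennreal (D * exp (- s * \<theta> / 2))"
begin

section \<open>The weighted small ball as a series of Levy distribution functions\<close>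

definition weight :: "'a \<Rightarrow> real" where
  "weight \<omega> = exp (a / 2 * (Y \<omega>)\<^sup>2 - Q \<omega> / 2)"

lemma weight_meas [measurable]: "weight \<in> borel_measurable M"
  unfolding weight_def by measurable

lemma weight_pos [simp]: "weight \<omega> > 0" "weight \<omega> \<ge> 0"
  by (auto simp: weight_def)

definition weighted_ball :: "real \<Rightarrow> real" where
  "weighted_ball r = (\<integral>\<omega>. weight \<omega> * indicator {\<omega>. X \<omega> \<le> r} \<omega> \<partial>M)"

text \<open>At \<open>s = sqrt (2 * l)\<close> the term of index \<open>k\<close> in the series for
  \<open>cosh (s * \<theta>) powr (- 1 / 2)\<close> is a multiple of
  \<open>exp (- level k * sqrt (2 * l))\<close>, the transform at \<open>l\<close> of
  \<open>(level k)\<^sup>2 / N\<^sup>2\<close> with \<open>N\<close> standard normal.\<close>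

definition level :: "nat \<Rightarrow> real" where "level k = \<theta> * (1 / 2 + 2 * real k)"

definition levy_ball :: "nat \<Rightarrow> real \<Rightarrow> real" where
  "levy_ball k r = measure std_normal_distribution {x. (level k)\<^sup>2 / x\<^sup>2 \<le> r}"

lemma level_pos: "level k > 0"
  using pos by (simp add: level_def add_pos_nonneg)

lemma laplace_weight:
  assumes "s \<ge> s0"
  shows "has_bochner_integral M (\<lambda>\<omega>. weight \<omega> * exp (- (s\<^sup>2 / 2) * X \<omega>)) (B * cosh (s * \<theta>) powr (- 1 / 2))"
proof (rule has_bochner_integral_nn_integral)
  have "weight \<omega> * exp (- (s\<^sup>2 / 2) * X \<omega>) = exp (a / 2 * (Y \<omega>)\<^sup>2 - Q \<omega> / 2 - s\<^sup>2 / 2 * X \<omega>)" for \<omega>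
    by (simp add: weight_def mult_exp_exp)
  then show "(\<integral>\<^sup>+\<omega>. ennreal (weight \<omega> * exp (- (s\<^sup>2 / 2) * X \<omega>)) \<partial>M) = ennreal (B * cosh (s * \<theta>) powr (- 1 / 2))"
    using laplace[OF assms] by simp
qed (use pos in auto)

text \<open>The weight alone may fail to be integrable. On the ball the indicator is at most
  \<open>exp (s0\<^sup>2 / 2 * (r - X \<omega>))\<close>, which leads back to the transform at
  \<open>s0\<close>.\<close>

lemma integrable_weight_indicator [simp]: "integrable M (\<lambda>\<omega>. weight \<omega> * indicator {\<omega>. X \<omega> \<le> r} \<omega>)"
proof (rule Bochner_Integration.integrable_bound)
  show "integrable M (\<lambda>\<omega>. exp (s0\<^sup>2 / 2 * r) * (weight \<omega> * exp (- (s0\<^sup>2 / 2) * X \<omega>)))"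
    using laplace_weight[of s0] by (intro integrable_mult_right) (simp add: has_bochner_integral_iff)
  show "AE \<omega> in M. norm (weight \<omega> * indicator {\<omega>. X \<omega> \<le> r} \<omega>)
      \<le> norm (exp (s0\<^sup>2 / 2 * r) * (weight \<omega> * exp (- (s0\<^sup>2 / 2) * X \<omega>)))"
  proof (rule AE_I2)
    fix \<omega>
    have "indicator {\<omega>. X \<omega> \<le> r} \<omega> \<le> exp (s0\<^sup>2 / 2 * r) * exp (- (s0\<^sup>2 / 2) * X \<omega>)"
      by (auto simp: mult_exp_exp mult_left_mono split: split_indicator)
    from mult_left_mono[OF this, of "weight \<omega>"]
    show "norm (weight \<omega> * indicator {\<omega>. X \<omega> \<le> r} \<omega>)
      \<le> norm (exp (s0\<^sup>2 / 2 * r) * (weight \<omega> * exp (- (s0\<^sup>2 / 2) * X \<omega>)))"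
      by (simp add: abs_mult mult_ac)
  qed
qed measurable

text \<open>The substitution \<open>s = sqrt (2 * m)\<close> turns \<open>s\<^sup>2 / 2\<close> into
  the integer \<open>m\<close>, and the condition on \<open>n0\<close> keeps all these
  \<open>s\<close> above \<open>s0\<close>.\<close>

lemma weighted_expectation_series:
  assumes g: "continuous_on UNIV g" and n0: "n0 > 0" "s0\<^sup>2 \<le> 2 * real n0"
  shows "(\<lambda>k. B * sqrt 2 * ((- 1 / 2) gchoose k) *
             (\<integral>x. exp (- real n0 * ((level k)\<^sup>2 / x\<^sup>2)) * g (exp (- ((level k)\<^sup>2 / x\<^sup>2))) \<partial>std_normal_distribution))
           sums (\<integral>\<omega>. weight \<omega> * exp (- real n0 * X \<omega>) * g (exp (- X \<omega>)) \<partial>M)"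
proof (rule laplace_unique_series[where l = "\<lambda>m. B * cosh (sqrt (2 * real m) * \<theta>) powr (- 1 / 2)"])
  have s: "sqrt (2 * real m) \<ge> s0" "sqrt (2 * real m) > 0" if "m \<ge> n0" for m
  proof -
    have "s0\<^sup>2 \<le> 2 * real m" using n0 that by linarith
    then show "sqrt (2 * real m) \<ge> s0" using pos by (simp add: real_le_rsqrt)
  qed (use n0 that in auto)
  show "has_bochner_integral M (\<lambda>\<omega>. weight \<omega> * exp (- real m * X \<omega>)) (B * cosh (sqrt (2 * real m) * \<theta>) powr (- 1 / 2))"
    if "m \<ge> n0" for m
    using laplace_weight[OF s(1)[OF that]] by simp
  show "(\<lambda>k. B * sqrt 2 * ((- 1 / 2) gchoose k) * exp (- level k * sqrt (2 * real m)))
         sums (B * cosh (sqrt (2 * real m) * \<theta>) powr (- 1 / 2))" if "m \<ge> n0" for m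
  proof -
    have "- level k * sqrt (2 * real m) = - (1 / 2 + 2 * real k) * (sqrt (2 * real m) * \<theta>)" for k
      by (simp add: level_def algebra_simps)
    then show ?thesis
      using sums_mult[OF cosh_powr_minus_half_sums[of "sqrt (2 * real m) * \<theta>"], of B] s(2)[OF that] pos
      by (simp add: mult.assoc)
  qed
  let ?s = "sqrt (2 * real n0)"
  show "summable (\<lambda>k. \<bar>B * sqrt 2 * ((- 1 / 2) gchoose k)\<bar> * exp (- level k * ?s))"
  \<comment> \<open>The levels have constant spacing \<open>2 * \<theta>\<close> and the binomial
    coefficients are at most 1 in absolute value, so a geometric series dominates.\<close>
  proof (rule summable_comparison_test'[of "\<lambda>k. B * sqrt 2 * exp (- \<theta> * ?s / 2) * exp (- 2 * \<theta> * ?s) ^ k" 0])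
    show "summable (\<lambda>k. B * sqrt 2 * exp (- \<theta> * ?s / 2) * exp (- 2 * \<theta> * ?s) ^ k)"
      using pos n0 by (intro summable_mult summable_geometric) auto
    fix k :: nat
    have e: "exp (- level k * ?s) = exp (- \<theta> * ?s / 2) * exp (- 2 * \<theta> * ?s) ^ k"
      by (simp add: level_def exp_of_nat_mult[symmetric] mult_exp_exp algebra_simps)
    have "\<bar>(- 1 / 2 :: real) gchoose k\<bar> * (B * sqrt 2 * exp (- level k * ?s)) \<le> 1 * (B * sqrt 2 * exp (- level k * ?s))"
      using pos by (intro mult_right_mono abs_gbinomial_minus_half_le) auto
    moreover have "norm (\<bar>B * sqrt 2 * ((- 1 / 2) gchoose k)\<bar> * exp (- level k * ?s))
        = \<bar>(- 1 / 2 :: real) gchoose k\<bar> * (B * sqrt 2 * exp (- level k * ?s))"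
      using pos by (simp add: abs_mult)
    moreover have "B * sqrt 2 * exp (- \<theta> * ?s / 2) * exp (- 2 * \<theta> * ?s) ^ k = B * sqrt 2 * exp (- level k * ?s)"
      unfolding e by (simp only: mult.assoc)
    ultimately show "norm (\<bar>B * sqrt 2 * ((- 1 / 2) gchoose k)\<bar> * exp (- level k * ?s))
        \<le> B * sqrt 2 * exp (- \<theta> * ?s / 2) * exp (- 2 * \<theta> * ?s) ^ k"
      by (simp only: mult_1)
  qed
qed (use X_nonneg level_pos n0 g in auto)

text \<open>The Chernoff parameter is \<open>d = level 0\<close> for every \<open>k\<close>: it is
  optimal for the leading level, and \<open>level k * level 0\<close> is affine in \<open>k\<close>,
  which produces the geometric factor.\<close>

lemma levy_ball_le:
  assumes "r > 0"
  shows "levy_ball k r \<le> exp (- \<theta>\<^sup>2 / (8 * r)) * exp (- \<theta>\<^sup>2 / r) ^ k"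
proof -
  have "levy_ball k r \<le> exp ((level 0)\<^sup>2 / (2 * r) - level k * level 0 / r)"
    unfolding levy_ball_def by (rule levy_le_chernoff) (use level_pos assms in auto)
  also have "\<dots> = exp (- \<theta>\<^sup>2 / (8 * r)) * exp (- \<theta>\<^sup>2 / r) ^ k"
    using assms by (simp add: level_def exp_of_nat_mult[symmetric] mult_exp_exp field_simps power2_eq_square)
  finally show ?thesis .
qed

text \<open>The geometric sum of the Chernoff bounds over all \<open>k \<ge> 1\<close>. Compared
  with the leading term it carries the extra factor
  \<open>exp (- \<theta>\<^sup>2 / r)\<close>.\<close>

definition levy_tail :: "real \<Rightarrow> real" where
  "levy_tail r = B * sqrt 2 * exp (- \<theta>\<^sup>2 / (8 * r)) * exp (- \<theta>\<^sup>2 / r) / (1 - exp (- \<theta>\<^sup>2 / r))"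

text \<open>Apply the series to a continuous ramp between the indicators of \<open>{..r}\<close> and \<open>{..r'}\<close>.\<close>

lemma weighted_ball_bounds:
  assumes r: "0 < r" "r < r'"
  shows "weighted_ball r \<le> B * sqrt 2 * levy_ball 0 r' + levy_tail r'"
    and "B * sqrt 2 * levy_ball 0 r - levy_tail r' \<le> weighted_ball r'"
proof -
  obtain m :: nat where m: "s0\<^sup>2 \<le> real m" using real_arch_simple by blast
  define n0 where "n0 = Suc m"
  have n0: "n0 > 0" "s0\<^sup>2 \<le> 2 * real n0" using m by (auto simp: n0_def)
  define ramp where "ramp x = max 0 (min 1 ((r' - x) / (r' - r)))" for x
  \<comment> \<open>In the variable \<open>y = exp (- x)\<close> this is
    \<open>exp (n0 * x) * ramp x\<close>, whose first factor cancels \<open>exp (- n0 * X)\<close>.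
    Cutting \<open>y\<close> off at \<open>exp (- r')\<close> keeps the logarithm continuous on the
    whole line and changes no value that is used, since \<open>ramp\<close> vanishes from
    \<open>r'\<close> on.\<close>
  define g where "g y = exp (real n0 * - ln (max y (exp (- r')))) * ramp (- ln (max y (exp (- r'))))" for y
  have ramp: "indicator {..r} x \<le> ramp x" "ramp x \<le> indicator {..r'} x" for x
    using r by (auto simp: ramp_def field_simps split: split_indicator)
  have ramp01: "0 \<le> ramp x" "ramp x \<le> 1" for x by (auto simp: ramp_def)
  have ramp_meas [measurable]: "ramp \<in> borel_measurable borel"
    unfolding ramp_def by measurable
  have g_exp: "exp (- real n0 * x) * g (exp (- x)) = ramp x" for x
  proof (cases "x \<le> r'")
    case True
    then show ?thesis by (simp add: g_def max_def mult_exp_exp flip: mult.assoc)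
  next
    case False
    hence "ramp x = 0" "ramp r' = 0" using r by (auto simp: ramp_def field_simps)
    with False show ?thesis by (simp add: g_def max_def)
  qed
  have g: "continuous_on UNIV g"
  proof -
    have l: "continuous_on UNIV (\<lambda>y. ln (max y (exp (- r'))))"
      by (intro continuous_intros) (metis exp_gt_zero less_max_iff_disj less_irrefl)
    show ?thesis
      unfolding g_def ramp_def by (intro continuous_intros l) (use r in auto)
  qed
  define I where "I k = (\<integral>x. ramp ((level k)\<^sup>2 / x\<^sup>2) \<partial>std_normal_distribution)" for k
  define J where "J = (\<integral>\<omega>. weight \<omega> * ramp (X \<omega>) \<partial>M)"
  have sums: "(\<lambda>k. B * sqrt 2 * ((- 1 / 2) gchoose k) * I k) sums J"
    using weighted_expectation_series[OF g n0] unfolding mult.assoc g_exp I_def J_def .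
  interpret N: real_distribution std_normal_distribution by (rule real_distribution_std_normal)
  have int_ramp: "integrable std_normal_distribution (\<lambda>x. ramp ((level k)\<^sup>2 / x\<^sup>2))" for k
    by (rule N.integrable_const_bound[of _ 1]) (use ramp01 in auto)
  have int_ind: "integrable std_normal_distribution (\<lambda>x. indicator {x. (level k)\<^sup>2 / x\<^sup>2 \<le> t} x :: real)" for k t
    by (rule N.integrable_const_bound[of _ 1]) auto
  have lb: "levy_ball k t = (\<integral>x. indicator {x. (level k)\<^sup>2 / x\<^sup>2 \<le> t} x \<partial>std_normal_distribution)" for k t
    by (simp add: levy_ball_def)
  have I_le: "I k \<le> levy_ball k r'" for k
    unfolding I_def lb by (intro integral_mono int_ramp int_ind) (use ramp(2) in \<open>auto simp: indicator_def\<close>)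
  have I_ge: "levy_ball k r \<le> I k" for k
    unfolding I_def lb by (intro integral_mono int_ramp int_ind) (use ramp(1) in \<open>auto simp: indicator_def\<close>)
  have I_nonneg: "0 \<le> I k" for k
    unfolding I_def using ramp01 by (intro Bochner_Integration.integral_nonneg) auto
  have int_wr: "integrable M (\<lambda>\<omega>. weight \<omega> * ramp (X \<omega>))"
  proof (rule Bochner_Integration.integrable_bound)
    show "integrable M (\<lambda>\<omega>. weight \<omega> * indicator {\<omega>. X \<omega> \<le> r'} \<omega>)" by simp
    show "AE \<omega> in M. norm (weight \<omega> * ramp (X \<omega>)) \<le> norm (weight \<omega> * indicator {\<omega>. X \<omega> \<le> r'} \<omega>)"
      using ramp(2) ramp01 by (intro AE_I2) (auto simp: abs_mult indicator_def intro!: mult_left_mono)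
  qed measurable
  have J_ge: "weighted_ball r \<le> J"
    unfolding weighted_ball_def J_def using ramp(1)
    by (intro integral_mono int_wr integrable_weight_indicator mult_left_mono) (auto simp: indicator_def)
  have J_le: "J \<le> weighted_ball r'"
    unfolding weighted_ball_def J_def using ramp(2)
    by (intro integral_mono int_wr integrable_weight_indicator mult_left_mono) (auto simp: indicator_def)
  define q where "q = exp (- \<theta>\<^sup>2 / r')"
  have q: "0 < q" "q < 1" using pos r by (auto simp: q_def)
  define K where "K = B * sqrt 2 * exp (- \<theta>\<^sup>2 / (8 * r'))"
  \<comment> \<open>The term \<open>k = 0\<close> has binomial coefficient 1 and carries the
    asymptotics; the later ones change sign and are estimated in absolute value.\<close>
  have tail: "(\<lambda>k. B * sqrt 2 * ((- 1 / 2) gchoose Suc k) * I (Suc k)) sums (J - B * sqrt 2 * I 0)"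
    using sums by (subst sums_Suc_iff[of "\<lambda>k. B * sqrt 2 * ((- 1 / 2) gchoose k) * I k"]) simp
  have bound: "norm (B * sqrt 2 * ((- 1 / 2) gchoose Suc k) * I (Suc k)) \<le> K * q ^ Suc k" for k
  proof -
    have "norm (B * sqrt 2 * ((- 1 / 2) gchoose Suc k) * I (Suc k)) = B * sqrt 2 * (\<bar>(- 1 / 2) gchoose Suc k\<bar> * I (Suc k))"
      using pos I_nonneg by (simp add: abs_mult)
    also have "\<dots> \<le> B * sqrt 2 * (1 * (exp (- \<theta>\<^sup>2 / (8 * r')) * exp (- \<theta>\<^sup>2 / r') ^ Suc k))"
      using pos r I_nonneg by (intro mult_left_mono mult_mono abs_gbinomial_minus_half_le
           order_trans[OF I_le levy_ball_le]) auto
    finally show ?thesis by (simp add: K_def q_def)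
  qed
  have geo: "(\<lambda>k. K * q ^ Suc k) sums (K * (q * (1 / (1 - q))))"
    unfolding power_Suc using q by (intro sums_mult geometric_sums) auto
  have "\<bar>J - B * sqrt 2 * I 0\<bar> \<le> K * (q * (1 / (1 - q)))"
    using norm_sums_le[OF tail geo bound] by simp
  also have "\<dots> = levy_tail r'" by (simp add: levy_tail_def K_def q_def)
  finally have J: "\<bar>J - B * sqrt 2 * I 0\<bar> \<le> levy_tail r'" .
  have "B * sqrt 2 * I 0 \<le> B * sqrt 2 * levy_ball 0 r'" "B * sqrt 2 * levy_ball 0 r \<le> B * sqrt 2 * I 0"
    using pos I_le I_ge by (auto intro!: mult_left_mono)
  then show "weighted_ball r \<le> B * sqrt 2 * levy_ball 0 r' + levy_tail r'"
    "B * sqrt 2 * levy_ball 0 r - levy_tail r' \<le> weighted_ball r'"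
    using J J_ge J_le by linarith+
qed

text \<open>This is \<open>B * sqrt 2 * levy_ball 0 r\<close> with the Gaussian tail at
  \<open>x = \<theta> / (2 * sqrt r)\<close> replaced by the density divided by \<open>x\<close>. At
  \<open>r = \<epsilon>\<^sup>2\<close> it becomes the claimed right-hand side once \<open>B\<close>
  is inserted.\<close>

definition rate :: "real \<Rightarrow> real" where
  "rate r = 4 * B / (sqrt pi * \<theta>) * sqrt r * exp (- \<theta>\<^sup>2 / (8 * r))"

lemma rate_pos: "r > 0 \<Longrightarrow> rate r > 0"
  using pos by (simp add: rate_def)

lemma levy_ball_0:
  assumes "r > 0"
  shows "B * sqrt 2 * levy_ball 0 r \<le> rate r"
    "rate r * (1 - 4 * r / \<theta>\<^sup>2) \<le> B * sqrt 2 * levy_ball 0 r"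
proof -
  define x where "x = \<theta> / (2 * sqrt r)"
  have x: "x > 0" using pos assms by (simp add: x_def)
  have eq: "levy_ball 0 r = 2 * (1 - std_normal_cdf x)"
    unfolding levy_ball_def using measure_levy_le[of "level 0" r] level_pos[of 0] assms
    by (simp add: level_def x_def)
  have x2: "x\<^sup>2 = \<theta>\<^sup>2 / (4 * r)" using assms by (simp add: x_def power_divide power_mult_distrib)
  have "B * sqrt 2 * (2 * (std_normal_density x / x)) = B * sqrt 2 * 2 * (1 / sqrt (2 * pi)) * exp (- x\<^sup>2 / 2) / x"
    by (simp add: std_normal_density_def)
  also have "\<dots> = rate r"
    unfolding x2 using assms pos by (simp add: rate_def x_def real_sqrt_mult field_simps)
  finally have r: "B * sqrt 2 * (2 * (std_normal_density x / x)) = rate r" .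
  have "B * sqrt 2 * levy_ball 0 r \<le> B * sqrt 2 * (2 * (std_normal_density x / x))"
    unfolding eq using std_normal_tail_bounds(1)[OF x] pos by (intro mult_left_mono) auto
  then show "B * sqrt 2 * levy_ball 0 r \<le> rate r" unfolding r .
  have "(1 / x - 1 / x ^ 3) * std_normal_density x = std_normal_density x / x * (1 - 4 * r / \<theta>\<^sup>2)"
  proof -
    have "4 * r / \<theta>\<^sup>2 = 1 / x\<^sup>2" unfolding x2 by simp
    then show ?thesis using x assms by (simp add: diff_divide_distrib right_diff_distrib left_diff_distrib eval_nat_numeral)
  qed
  hence "B * sqrt 2 * (2 * (std_normal_density x / x)) * (1 - 4 * r / \<theta>\<^sup>2) = B * sqrt 2 * (2 * ((1 / x - 1 / x ^ 3) * std_normal_density x))"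
    by simp
  also have "\<dots> \<le> B * sqrt 2 * levy_ball 0 r"
    unfolding eq using std_normal_tail_bounds(2)[OF x] pos by (intro mult_left_mono) auto
  finally show "rate r * (1 - 4 * r / \<theta>\<^sup>2) \<le> B * sqrt 2 * levy_ball 0 r" unfolding r .
qed

lemma weighted_ball_asymp: "((\<lambda>r. weighted_ball r / rate r) \<longlongrightarrow> 1) (at_right 0)"
proof (rule tendsto_sandwich)
  \<comment> \<open>The ramp must have width \<open>o(r\<^sup>2)\<close>: moving \<open>r\<close> by
    \<open>w\<close> multiplies \<open>exp (- \<theta>\<^sup>2 / (8 * r))\<close> by about
    \<open>exp (\<theta>\<^sup>2 * w / (8 * r\<^sup>2))\<close>. For \<open>w = r ^ 3\<close> this
    tends to 1, whereas \<open>w = r\<^sup>2\<close> would leave a constant factor.\<close>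
  let ?u = "\<lambda>r. (rate (r + r ^ 3) + levy_tail (r + r ^ 3)) / rate r"
  let ?l = "\<lambda>r. (rate (r - r ^ 3) * (1 - 4 * (r - r ^ 3) / \<theta>\<^sup>2) - levy_tail r) / rate r"
  have "\<forall>\<^sub>F r in at_right (0::real). 0 < r \<and> r < 1"
    using eventually_at_right_real[of 0 "1::real"] by (rule eventually_mono) auto
  then show "\<forall>\<^sub>F r in at_right 0. weighted_ball r / rate r \<le> ?u r"
  proof eventually_elim
    fix r :: real assume r: "0 < r \<and> r < 1"
    hence "r + r ^ 3 > 0" by (simp add: add_pos_pos)
    then show "weighted_ball r / rate r \<le> ?u r"
      using r weighted_ball_bounds(1)[of r "r + r ^ 3"] levy_ball_0(1)[of "r + r ^ 3"] rate_pos[of r]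
      by (intro divide_right_mono) auto
  qed
  have "\<forall>\<^sub>F r in at_right (0::real). 0 < r \<and> r < 1"
    using eventually_at_right_real[of 0 "1::real"] by (rule eventually_mono) auto
  then show "\<forall>\<^sub>F r in at_right 0. ?l r \<le> weighted_ball r / rate r"
  proof eventually_elim
    fix r :: real assume r: "0 < r \<and> r < 1"
    hence "r ^ 3 < r ^ 1" by (intro power_strict_decreasing) auto
    hence "r - r ^ 3 > 0" by simp
    then show "?l r \<le> weighted_ball r / rate r"
      using r weighted_ball_bounds(2)[of "r - r ^ 3" r] levy_ball_0(2)[of "r - r ^ 3"] rate_pos[of r]
      by (intro divide_right_mono) auto
  qed
  show "(?u \<longlongrightarrow> 1) (at_right 0)"
    unfolding rate_def levy_tail_def using pos by real_asymp
  show "(?l \<longlongrightarrow> 1) (at_right 0)"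
    unfolding rate_def levy_tail_def using pos by real_asymp
qed

section \<open>Removing the weight\<close>

definition tilted_tail :: "real \<Rightarrow> real" where
  "tilted_tail r = exp (- (c * \<theta> / (2 * r) - \<bar>a\<bar>) / 2 * sqrt r) * D * exp (- \<theta>\<^sup>2 / (8 * r))"

text \<open>Exponential Chebyshev bound at \<open>s = \<theta> / (2 * r)\<close>, the minimiser of
  \<open>s\<^sup>2 / 2 * r - s * \<theta> / 2\<close>, so that the rate
  \<open>exp (- \<theta>\<^sup>2 / (8 * r))\<close> of the main term is preserved. Beyond the
  threshold \<open>sqrt r\<close> the excess \<open>c * s - \<bar>a\<bar>\<close> in the coefficient
  of \<open>Y\<^sup>2\<close> gains a factor whose exponent is of order \<open>- 1 / sqrt r\<close>,
  while the threshold itself still tends to 0. The factor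
  \<open>exp (\<bar>a\<bar> / 2 * (Y \<omega>)\<^sup>2)\<close> is included so that \<open>f\<close>
  also controls the unweighted probability.\<close>

lemma weighted_off_center:
  assumes r: "0 < r" "s0 \<le> \<theta> / (2 * r)" "\<bar>a\<bar> \<le> c * (\<theta> / (2 * r))"
  defines "f \<equiv> \<lambda>\<omega>. weight \<omega> * exp (\<bar>a\<bar> / 2 * (Y \<omega>)\<^sup>2) * indicator {\<omega>. X \<omega> \<le> r \<and> (Y \<omega>)\<^sup>2 > sqrt r} \<omega>"
  shows "integrable M f" "(\<integral>\<omega>. f \<omega> \<partial>M) \<le> tilted_tail r"
proof -
  define s where "s = \<theta> / (2 * r)"
  define K where "K = exp (- (c * s - \<bar>a\<bar>) / 2 * sqrt r) * exp (s\<^sup>2 / 2 * r)"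
  let ?g = "\<lambda>\<omega>. exp ((a + c * s) / 2 * (Y \<omega>)\<^sup>2 - Q \<omega> / 2 - s\<^sup>2 / 2 * X \<omega>)"
  have f_meas: "f \<in> borel_measurable M" unfolding f_def by measurable
  have le: "f \<omega> \<le> K * ?g \<omega>" for \<omega>
  proof (cases "X \<omega> \<le> r \<and> (Y \<omega>)\<^sup>2 > sqrt r")
    case True
    have "(c * s - \<bar>a\<bar>) / 2 * sqrt r \<le> (c * s - \<bar>a\<bar>) / 2 * (Y \<omega>)\<^sup>2"
      using True r by (intro mult_left_mono) (auto simp: s_def)
    moreover have "s\<^sup>2 / 2 * X \<omega> \<le> s\<^sup>2 / 2 * r" using True by (intro mult_left_mono) auto
    ultimately show ?thesis
      using True unfolding f_def weight_def K_def by (simp add: mult_exp_exp algebra_simps add_divide_distrib diff_divide_distrib)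
  next
    case False
    then show ?thesis by (simp add: f_def K_def)
  qed
  have "(\<integral>\<^sup>+\<omega>. ennreal (f \<omega>) \<partial>M) \<le> (\<integral>\<^sup>+\<omega>. ennreal K * ennreal (?g \<omega>) \<partial>M)"
    using le by (intro nn_integral_mono) (auto simp: K_def ennreal_mult[symmetric] intro!: ennreal_leI)
  also have "\<dots> = ennreal K * (\<integral>\<^sup>+\<omega>. ennreal (?g \<omega>) \<partial>M)"
    by (rule nn_integral_cmult) measurable
  also have "\<dots> \<le> ennreal K * ennreal (D * exp (- s * \<theta> / 2))"
    using laplace_tilted[of s] r by (intro mult_left_mono) (auto simp: s_def)
  also have "\<dots> = ennreal (K * (D * exp (- s * \<theta> / 2)))"
    by (rule ennreal_mult'[symmetric]) (simp add: K_def)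
  also have "K * (D * exp (- s * \<theta> / 2)) = tilted_tail r"
  proof -
    have "s\<^sup>2 / 2 * r + - s * \<theta> / 2 = - \<theta>\<^sup>2 / (8 * r)"
      using r by (simp add: s_def field_simps power2_eq_square)
    hence "exp (s\<^sup>2 / 2 * r) * exp (- s * \<theta> / 2) = exp (- \<theta>\<^sup>2 / (8 * r))"
      by (simp only: mult_exp_exp)
    then show ?thesis by (simp add: K_def tilted_tail_def s_def mult_ac)
  qed
  finally have nn: "(\<integral>\<^sup>+\<omega>. ennreal (f \<omega>) \<partial>M) \<le> ennreal (tilted_tail r)" .
  have D: "tilted_tail r \<ge> 0" using pos by (simp add: tilted_tail_def)
  show int: "integrable M f"
  proof (rule integrableI_nonneg[OF f_meas])
    show "(\<integral>\<^sup>+\<omega>. ennreal (f \<omega>) \<partial>M) < \<infinity>"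
      using le_less_trans[OF nn ennreal_less_top] by simp
  qed (simp add: f_def)
  show "(\<integral>\<omega>. f \<omega> \<partial>M) \<le> tilted_tail r"
    using nn D by (subst integral_eq_nn_integral[OF f_meas]) (auto simp: f_def enn2real_leI)
qed

text \<open>On the part of the ball where \<open>Y\<^sup>2 \<le> sqrt r\<close>, the weight lies
  between \<open>1 / (E * K)\<close> and \<open>E * K\<close>. On the rest the off-center function
  \<open>f\<close> dominates the weight, because its extra factor is at least 1, and also
  \<open>1 / K\<close>, because \<open>a + \<bar>a\<bar> \<ge> 0\<close>.\<close>

lemma prob_ball_bounds:
  assumes r: "0 < r" "s0 \<le> \<theta> / (2 * r)" "\<bar>a\<bar> \<le> c * (\<theta> / (2 * r))"
  defines "K \<equiv> exp (C * r / 2)" and "E \<equiv> exp (\<bar>a\<bar> / 2 * sqrt r)"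
  shows "prob {\<omega> \<in> space M. X \<omega> \<le> r} \<le> K * (E * weighted_ball r + tilted_tail r)"
    "weighted_ball r \<le> E * K * prob {\<omega> \<in> space M. X \<omega> \<le> r} + tilted_tail r"
proof -
  define f where "f = (\<lambda>\<omega>. weight \<omega> * exp (\<bar>a\<bar> / 2 * (Y \<omega>)\<^sup>2) * indicator {\<omega>. X \<omega> \<le> r \<and> (Y \<omega>)\<^sup>2 > sqrt r} \<omega>)"
  note off = weighted_off_center[OF r, folded f_def]
  have K: "K \<ge> 1" "E \<ge> 1" using pos r by (auto simp: K_def E_def)
  let ?w = "\<lambda>\<omega>. weight \<omega> * indicator {\<omega>. X \<omega> \<le> r} \<omega>"
  let ?i = "\<lambda>\<omega>. indicator {\<omega>. X \<omega> \<le> r} \<omega> :: real"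
  have wi: "integrable M ?w" by simp
  have ii: "integrable M ?i" by (rule integrable_const_bound[of _ 1]) auto
  have pr: "prob {\<omega> \<in> space M. X \<omega> \<le> r} = (\<integral>\<omega>. ?i \<omega> \<partial>M)"
  proof -
    have "prob {\<omega> \<in> space M. X \<omega> \<le> r} = (\<integral>\<omega>. indicator {\<omega> \<in> space M. X \<omega> \<le> r} \<omega> \<partial>M)" by simp
    also have "\<dots> = (\<integral>\<omega>. ?i \<omega> \<partial>M)" by (intro Bochner_Integration.integral_cong) (auto simp: indicator_def)
    finally show ?thesis .
  qed
  have key: "AE \<omega> in M. ?i \<omega> \<le> K * (E * ?w \<omega> + f \<omega>) \<and> ?w \<omega> \<le> E * K * ?i \<omega> + f \<omega>"
    using Q_bound
  proof eventually_elim
    fix \<omega> assume Q: "\<bar>Q \<omega>\<bar> \<le> C * X \<omega>"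
    show "?i \<omega> \<le> K * (E * ?w \<omega> + f \<omega>) \<and> ?w \<omega> \<le> E * K * ?i \<omega> + f \<omega>"
    proof (cases "X \<omega> \<le> r")
      case True
      have "C * X \<omega> \<le> C * r" using True pos by (intro mult_left_mono) auto
      hence q: "\<bar>Q \<omega>\<bar> \<le> C * r" using Q by linarith
      show ?thesis
      proof (cases "(Y \<omega>)\<^sup>2 > sqrt r")
        case out: True
        have f: "f \<omega> = weight \<omega> * exp (\<bar>a\<bar> / 2 * (Y \<omega>)\<^sup>2)" using True out by (simp add: f_def)
        have "- (a / 2 * (Y \<omega>)\<^sup>2) \<le> \<bar>a\<bar> / 2 * (Y \<omega>)\<^sup>2"
          unfolding mult_minus_left[symmetric] by (intro mult_right_mono) auto
        hence "exp 0 \<le> K * f \<omega>"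
          unfolding f K_def weight_def mult_exp_exp using q by (subst exp_le_cancel_iff) auto
        moreover have "weight \<omega> * 1 \<le> f \<omega>" unfolding f by (intro mult_left_mono) auto
        moreover have "0 \<le> K * (E * weight \<omega>)" "0 \<le> E * K" using K by auto
        ultimately show ?thesis using True by (auto simp: distrib_left intro: add_increasing)
      next
        case inn: False
        have f: "f \<omega> = 0" using inn by (simp add: f_def)
        have aY: "\<bar>a / 2 * (Y \<omega>)\<^sup>2\<bar> \<le> \<bar>a\<bar> / 2 * sqrt r"
          using inn unfolding abs_mult by (intro mult_mono) auto
        hence "exp 0 \<le> K * (E * weight \<omega>)"
          unfolding E_def K_def weight_def mult_exp_exp using q by (subst exp_le_cancel_iff) linarith
        moreover have "weight \<omega> \<le> E * K"
          unfolding E_def K_def weight_def mult_exp_exp using q aY by (subst exp_le_cancel_iff) linarith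
        ultimately show ?thesis using True f by auto
      qed
    qed (simp add: f_def)
  qed
  have "prob {\<omega> \<in> space M. X \<omega> \<le> r} \<le> (\<integral>\<omega>. K * (E * ?w \<omega> + f \<omega>) \<partial>M)"
    unfolding pr using key wi off(1) by (intro integral_mono_AE ii) auto
  also have "\<dots> = K * (E * weighted_ball r + (\<integral>\<omega>. f \<omega> \<partial>M))"
    using wi off(1) by (simp add: weighted_ball_def)
  also have "\<dots> \<le> K * (E * weighted_ball r + tilted_tail r)"
    using K off(2) by (intro mult_left_mono) auto
  finally show "prob {\<omega> \<in> space M. X \<omega> \<le> r} \<le> K * (E * weighted_ball r + tilted_tail r)" .
  have "weighted_ball r \<le> (\<integral>\<omega>. E * K * ?i \<omega> + f \<omega> \<partial>M)"
    unfolding weighted_ball_def using key wi ii off(1) by (intro integral_mono_AE) auto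
  also have "\<dots> = E * K * (\<integral>\<omega>. ?i \<omega> \<partial>M) + (\<integral>\<omega>. f \<omega> \<partial>M)"
    using ii off(1) by (subst Bochner_Integration.integral_add) auto
  also have "\<dots> \<le> E * K * prob {\<omega> \<in> space M. X \<omega> \<le> r} + tilted_tail r"
    using off(2) by (simp add: pr)
  finally show "weighted_ball r \<le> E * K * prob {\<omega> \<in> space M. X \<omega> \<le> r} + tilted_tail r" .
qed

theorem small_ball_asymp: "((\<lambda>r. prob {\<omega> \<in> space M. X \<omega> \<le> r} / rate r) \<longlongrightarrow> 1) (at_right 0)"
proof (rule tendsto_sandwich)
  let ?K = "\<lambda>r. exp (C * r / 2)" and ?E = "\<lambda>r. exp (\<bar>a\<bar> / 2 * sqrt r)"
  let ?P = "\<lambda>r. prob {\<omega> \<in> space M. X \<omega> \<le> r}"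
  let ?u = "\<lambda>r. ?K r * (?E r * (weighted_ball r / rate r) + tilted_tail r / rate r)"
  let ?l = "\<lambda>r. (weighted_ball r / rate r - tilted_tail r / rate r) / (?E r * ?K r)"
  have t: "((\<lambda>r. tilted_tail r / rate r) \<longlongrightarrow> 0) (at_right 0)"
  proof -
    \<comment> \<open>The factors \<open>exp (- \<theta>\<^sup>2 / (8 * r))\<close> cancel in the
      quotient; the remaining exponential decays fast enough to absorb
      \<open>1 / sqrt r\<close>.\<close>
    have "((\<lambda>r. exp (- (c * \<theta> / (2 * r) - \<bar>a\<bar>) / 2 * sqrt r) / sqrt r * (D / (4 * B / (sqrt pi * \<theta>)))) \<longlongrightarrow> 0 * (D / (4 * B / (sqrt pi * \<theta>)))) (at_right 0)"
    proof (intro tendsto_mult tendsto_const)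
      show "((\<lambda>r. exp (- (c * \<theta> / (2 * r) - \<bar>a\<bar>) / 2 * sqrt r) / sqrt r) \<longlongrightarrow> 0) (at_right 0)"
        using pos by real_asymp
    qed
    then show ?thesis by (simp add: tilted_tail_def rate_def divide_simps mult_ac)
  qed
  have K: "(?K \<longlongrightarrow> 1) (at_right 0)" by real_asymp
  have E: "(?E \<longlongrightarrow> 1) (at_right 0)" by real_asymp
  have s: "\<forall>\<^sub>F r in at_right 0. s0 \<le> \<theta> / (2 * r)" using pos by real_asymp
  have a: "\<forall>\<^sub>F r in at_right 0. \<bar>a\<bar> \<le> c * (\<theta> / (2 * r))" using pos by real_asymp
  show "\<forall>\<^sub>F r in at_right 0. ?P r / rate r \<le> ?u r"
    using s a eventually_at_right_less[of 0]
  proof eventually_elim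
    case (elim r)
    have "?P r / rate r \<le> ?K r * (?E r * weighted_ball r + tilted_tail r) / rate r"
      using prob_ball_bounds(1)[of r] elim rate_pos[of r] by (intro divide_right_mono) auto
    then show ?case by (simp add: add_divide_distrib[symmetric])
  qed
  show "\<forall>\<^sub>F r in at_right 0. ?l r \<le> ?P r / rate r"
    using s a eventually_at_right_less[of 0]
  proof eventually_elim
    case (elim r)
    have "weighted_ball r / rate r \<le> (?E r * ?K r * ?P r + tilted_tail r) / rate r"
      using prob_ball_bounds(2)[of r] elim rate_pos[of r] by (intro divide_right_mono) auto
    hence "weighted_ball r / rate r - tilted_tail r / rate r \<le> ?P r / rate r * (?E r * ?K r)"
      by (simp add: add_divide_distrib mult_ac)
    then show ?case by (subst pos_divide_le_eq) auto
  qed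
  have "(?u \<longlongrightarrow> 1 * (1 * 1 + 0)) (at_right 0)"
    by (intro tendsto_intros K E weighted_ball_asymp t)
  then show "(?u \<longlongrightarrow> 1) (at_right 0)" by simp
  have "(?l \<longlongrightarrow> (1 - 0) / (1 * 1)) (at_right 0)"
    by (intro tendsto_intros K E weighted_ball_asymp t) auto
  then show "(?l \<longlongrightarrow> 1) (at_right 0)" by simp
qed

end

section \<open>Gaussian increments\<close>

definition gauss :: "real \<Rightarrow> real measure" where
  "gauss d = density lborel (\<lambda>x. ennreal (normal_density 0 (sqrt d) x))"

lemma sets_gauss [measurable_cong, simp]: "sets (gauss d) = sets borel"
  by (simp add: gauss_def)

lemma space_gauss [simp]: "space (gauss d) = UNIV"
  by (simp add: gauss_def)

lemma prob_space_gauss: "d > 0 \<Longrightarrow> prob_space (gauss d)"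
  unfolding gauss_def by (rule prob_space_normal_density) simp

text \<open>Completing the square: the tilted density is a multiple of a Gaussian one with mean
  \<open>m\<close> and variance \<open>d / \<rho>\<close>. Positivity of \<open>\<rho>\<close> keeps
  \<open>(1 - \<rho>) / (2 * d)\<close> below the critical value \<open>1 / (2 * d)\<close>. The
  passage from \<open>1 - \<rho>\<close> to \<open>1 / \<rho> - 1\<close> is what lets successive
  integrations telescope.\<close>

lemma nn_integral_gauss_square:
  assumes d: "d > 0" and \<rho>: "\<rho> > 0"
  shows "(\<integral>\<^sup>+y. ennreal (exp ((1 - \<rho>) / (2 * d) * (S + y)\<^sup>2)) \<partial>gauss d)
       = ennreal (sqrt (1 / \<rho>) * exp ((1 / \<rho> - 1) / (2 * d) * S\<^sup>2))"
proof -
  define m where "m = (1 - \<rho>) * S / \<rho>"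
  define K where "K = sqrt (1 / \<rho>) * exp ((1 / \<rho> - 1) / (2 * d) * S\<^sup>2)"
  have s: "sqrt (d / \<rho>) > 0" using d \<rho> by simp
  have eq: "normal_density 0 (sqrt d) y * exp ((1 - \<rho>) / (2 * d) * (S + y)\<^sup>2) = K * normal_density m (sqrt (d / \<rho>)) y" for y
  proof -
    have "- y\<^sup>2 / (2 * d) + (1 - \<rho>) / (2 * d) * (S + y)\<^sup>2 = (1 / \<rho> - 1) / (2 * d) * S\<^sup>2 + - (y - m)\<^sup>2 / (2 * (d / \<rho>))"
      using d \<rho> by (simp add: m_def field_simps power2_eq_square)
    hence "exp (- y\<^sup>2 / (2 * d)) * exp ((1 - \<rho>) / (2 * d) * (S + y)\<^sup>2) = exp ((1 / \<rho> - 1) / (2 * d) * S\<^sup>2) * exp (- (y - m)\<^sup>2 / (2 * (d / \<rho>)))"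
      by (simp only: mult_exp_exp)
    moreover have "1 / sqrt (2 * pi * d) = sqrt (1 / \<rho>) * (1 / sqrt (2 * pi * (d / \<rho>)))"
      using d \<rho> by (simp add: real_sqrt_divide real_sqrt_mult)
    ultimately show ?thesis
      using d \<rho> by (simp add: normal_density_def K_def mult_ac)
  qed
  have "(\<integral>\<^sup>+y. ennreal (exp ((1 - \<rho>) / (2 * d) * (S + y)\<^sup>2)) \<partial>gauss d)
      = (\<integral>\<^sup>+y. ennreal (normal_density 0 (sqrt d) y * exp ((1 - \<rho>) / (2 * d) * (S + y)\<^sup>2)) \<partial>lborel)"
    unfolding gauss_def by (subst nn_integral_density) (auto simp: ennreal_mult')
  also have "\<dots> = (\<integral>\<^sup>+y. ennreal (K * normal_density m (sqrt (d / \<rho>)) y) \<partial>lborel)"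
    unfolding eq ..
  also have "\<dots> = ennreal K"
    using s \<rho> by (subst nn_integral_eq_integral) (auto simp: K_def)
  finally show ?thesis unfolding K_def .
qed

definition psum :: "nat \<Rightarrow> (nat \<Rightarrow> real) \<Rightarrow> real" where
  "psum k x = (\<Sum>i<k. x i)"

lemma psum_borel_measurable:
  assumes "k \<le> n" "sets M = sets borel"
  shows "psum k \<in> borel_measurable (Pi\<^sub>M {..<n} (\<lambda>_. M))"
proof -
  have "(\<lambda>x. x i) \<in> borel_measurable (Pi\<^sub>M {..<n} (\<lambda>_. M))" if "i < k" for i
    using measurable_component_singleton[of i "{..<n}" "\<lambda>_. M"] that assms
    by (simp cong: measurable_cong_sets)
  then show ?thesis unfolding psum_def[abs_def] by (intro borel_measurable_sum) auto
qed

lemma psum_measurable [measurable]: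
  assumes "k \<le> n"
  shows "psum k \<in> borel_measurable (Pi\<^sub>M {..<n} (\<lambda>_. gauss d))"
    "psum k \<in> borel_measurable (Pi\<^sub>M {..<n} (\<lambda>_. lborel))"
    "psum k \<in> borel_measurable (Pi\<^sub>M {..<n} (\<lambda>_. borel))"
  by (rule psum_borel_measurable[OF assms]; simp)+

text \<open>The boundary coefficient is half a backward difference quotient for
  \<open>f' / f\<close>, and the sum is half a Riemann sum with second difference quotients for
  \<open>f'' / f\<close>. Natural subtraction reads \<open>f (0 - 1)\<close> as \<open>f 0\<close>:
  this makes \<open>quad\<close> vanish for \<open>n = 0\<close>, and at \<open>k = 0\<close> it
  only affects the coefficient of \<open>S 0\<close>, which is 0 for the paths considered.\<close>

definition quad :: "(nat \<Rightarrow> real) \<Rightarrow> real \<Rightarrow> nat \<Rightarrow> (nat \<Rightarrow> real) \<Rightarrow> real" where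
  "quad f d n S = (1 - f (n - 1) / f n) / (2 * d) * (S n)\<^sup>2
     - (\<Sum>k<n. (f (k + 1) - 2 * f k + f (k - 1)) / (2 * d * f k) * (S k)\<^sup>2)"

text \<open>A discrete Cameron--Martin formula: with these coefficients the Gaussian integrals
  over the increments telescope, for any positive sequence \<open>f\<close>.\<close>

lemma nn_integral_exp_quad:
  assumes d: "d > 0" and f: "\<And>k. f k > 0"
  shows "(\<integral>\<^sup>+x. ennreal (exp (quad f d n (\<lambda>k. psum k x))) \<partial>Pi\<^sub>M {..<n} (\<lambda>_. gauss d)) = ennreal (sqrt (f n / f 0))"
proof (induction n)
  case 0
  show ?case using f[of 0] by (simp add: quad_def psum_def PiM_empty nn_integral_count_space_finite)
next
  case (Suc n)
  interpret G: prob_space "gauss d" by (rule prob_space_gauss[OF d])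
  interpret P: product_sigma_finite "\<lambda>_::nat. gauss d" by standard
  define \<rho> where "\<rho> = f n / f (Suc n)"
  have \<rho>: "\<rho> > 0" using f by (simp add: \<rho>_def)
  have meas: "(\<lambda>x. ennreal (exp (quad f d m (\<lambda>k. psum k x)))) \<in> borel_measurable (Pi\<^sub>M {..<m} (\<lambda>_. gauss d))" for m
    unfolding quad_def by measurable
  have upd: "psum k (x(n := y)) = psum k x" if "k \<le> n" for k x y
    using that unfolding psum_def by (intro sum.cong) auto
  have upd': "psum (Suc n) (x(n := y)) = psum n x + y" for x y
    using upd[of n x y] by (simp add: psum_def)
  define R where "R x = (\<Sum>k<Suc n. (f (k + 1) - 2 * f k + f (k - 1)) / (2 * d * f k) * (psum k x)\<^sup>2)" for x
  have step: "quad f d (Suc n) (\<lambda>k. psum k (x(n := y))) = - R x + (1 - \<rho>) / (2 * d) * (psum n x + y)\<^sup>2" for x y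
  proof -
    have "(\<Sum>k<Suc n. (f (k + 1) - 2 * f k + f (k - 1)) / (2 * d * f k) * (psum k (x(n := y)))\<^sup>2) = R x"
      unfolding R_def by (intro sum.cong) (auto simp: upd)
    then show ?thesis by (simp add: quad_def upd' \<rho>_def del: sum.lessThan_Suc)
  qed
  \<comment> \<open>Integrating out the last increment leaves the forward slope
    \<open>1 / \<rho> - 1 = (f (n + 1) - f n) / f n\<close>. Subtracting the second difference at
    \<open>n\<close> turns it into the backward slope, the boundary coefficient of
    \<open>quad\<close> at \<open>n\<close>.\<close>
  have fold: "- R x + (1 / \<rho> - 1) / (2 * d) * (psum n x)\<^sup>2 = quad f d n (\<lambda>k. psum k x)" for x
  proof -
    have "(1 / \<rho> - 1) / (2 * d) - (f (n + 1) - 2 * f n + f (n - 1)) / (2 * d * f n) = (1 - f (n - 1) / f n) / (2 * d)"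
      using d f[of n] f[of "Suc n"] by (simp add: \<rho>_def field_simps)
    then show ?thesis by (simp add: R_def quad_def algebra_simps)
  qed
  have "(\<integral>\<^sup>+x. ennreal (exp (quad f d (Suc n) (\<lambda>k. psum k x))) \<partial>Pi\<^sub>M {..<Suc n} (\<lambda>_. gauss d))
     = (\<integral>\<^sup>+x. \<integral>\<^sup>+y. ennreal (exp (quad f d (Suc n) (\<lambda>k. psum k (x(n := y))))) \<partial>gauss d \<partial>Pi\<^sub>M {..<n} (\<lambda>_. gauss d))"
    using meas[of "Suc n"] unfolding lessThan_Suc by (intro P.product_nn_integral_insert) auto
  also have "\<dots> = (\<integral>\<^sup>+x. ennreal (sqrt (1 / \<rho>)) * ennreal (exp (quad f d n (\<lambda>k. psum k x))) \<partial>Pi\<^sub>M {..<n} (\<lambda>_. gauss d))"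
  proof (rule nn_integral_cong)
    fix x
    have "(\<integral>\<^sup>+y. ennreal (exp (quad f d (Suc n) (\<lambda>k. psum k (x(n := y))))) \<partial>gauss d)
        = (\<integral>\<^sup>+y. ennreal (exp (- R x)) * ennreal (exp ((1 - \<rho>) / (2 * d) * (psum n x + y)\<^sup>2)) \<partial>gauss d)"
      unfolding step exp_add by (simp add: ennreal_mult')
    also have "\<dots> = ennreal (exp (- R x)) * (\<integral>\<^sup>+y. ennreal (exp ((1 - \<rho>) / (2 * d) * (psum n x + y)\<^sup>2)) \<partial>gauss d)"
      by (rule nn_integral_cmult) simp
    also have "\<dots> = ennreal (exp (- R x) * (sqrt (1 / \<rho>) * exp ((1 / \<rho> - 1) / (2 * d) * (psum n x)\<^sup>2)))"
      unfolding nn_integral_gauss_square[OF d \<rho>] by (rule ennreal_mult'[symmetric]) simp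
    also have "exp (- R x) * (sqrt (1 / \<rho>) * exp ((1 / \<rho> - 1) / (2 * d) * (psum n x)\<^sup>2)) = sqrt (1 / \<rho>) * exp (quad f d n (\<lambda>k. psum k x))"
      unfolding fold[symmetric] exp_add by (simp only: mult_ac)
    also have "ennreal \<dots> = ennreal (sqrt (1 / \<rho>)) * ennreal (exp (quad f d n (\<lambda>k. psum k x)))"
      using \<rho> by (intro ennreal_mult') simp
    finally show "(\<integral>\<^sup>+y. ennreal (exp (quad f d (Suc n) (\<lambda>k. psum k (x(n := y))))) \<partial>gauss d)
        = ennreal (sqrt (1 / \<rho>)) * ennreal (exp (quad f d n (\<lambda>k. psum k x)))" .
  qed
  also have "\<dots> = ennreal (sqrt (1 / \<rho>)) * ennreal (sqrt (f n / f 0))"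
    unfolding Suc.IH[symmetric] by (rule nn_integral_cmult) (rule meas)
  also have "\<dots> = ennreal (sqrt (f (Suc n) / f 0))"
    using \<rho> f[of n] f[of 0] f[of "Suc n"]
    by (subst ennreal_mult'[symmetric]) (auto simp: \<rho>_def real_sqrt_mult[symmetric])
  finally show ?case .
qed

section \<open>Change of variables from the increments of \<open>W\<close> to those of
  \<open>W_(u)\<close>\<close>

lemma PiM_gauss_density:
  assumes "finite I" "d > 0"
  shows "density (Pi\<^sub>M I (\<lambda>_. lborel)) (\<lambda>x. \<Prod>i\<in>I. ennreal (normal_density 0 (sqrt d) (x i))) = Pi\<^sub>M I (\<lambda>_. gauss d)"
proof -
  interpret G: prob_space "gauss d" by (rule prob_space_gauss) fact
  interpret P: product_sigma_finite "\<lambda>_. gauss d" by standard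
  interpret L: product_sigma_finite "\<lambda>_. lborel :: real measure" by standard
  show ?thesis
  proof (rule P.PiM_eqI[OF \<open>finite I\<close>])
    show "sets (density (Pi\<^sub>M I (\<lambda>_. lborel)) (\<lambda>x. \<Prod>i\<in>I. ennreal (normal_density 0 (sqrt d) (x i)))) = sets (Pi\<^sub>M I (\<lambda>_. gauss d))"
      by (simp cong: sets_PiM_cong)
    fix A assume A: "\<And>i. i \<in> I \<Longrightarrow> A i \<in> sets (gauss d)"
    let ?p = "\<lambda>x. ennreal (normal_density 0 (sqrt d) x)"
    have "emeasure (density (Pi\<^sub>M I (\<lambda>_. lborel)) (\<lambda>x. \<Prod>i\<in>I. ?p (x i))) (Pi\<^sub>E I A)
        = (\<integral>\<^sup>+x. (\<Prod>i\<in>I. ?p (x i)) * indicator (Pi\<^sub>E I A) x \<partial>Pi\<^sub>M I (\<lambda>_. lborel))"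
      using A assms by (intro emeasure_density) (auto intro!: sets_PiM_I_finite)
    also have "\<dots> = (\<integral>\<^sup>+x. (\<Prod>i\<in>I. ?p (x i) * indicator (A i) (x i)) \<partial>Pi\<^sub>M I (\<lambda>_. lborel))"
    proof (rule nn_integral_cong)
      fix x :: "'a \<Rightarrow> real" assume "x \<in> space (Pi\<^sub>M I (\<lambda>_. lborel))"
      hence "x \<in> extensional I" by (simp add: space_PiM PiE_def)
      show "(\<Prod>i\<in>I. ?p (x i)) * indicator (Pi\<^sub>E I A) x = (\<Prod>i\<in>I. ?p (x i) * indicator (A i) (x i))"
      proof (cases "x \<in> Pi\<^sub>E I A")
        case True
        then show ?thesis by (auto intro!: prod.cong simp: PiE_mem)
      next
        case False
        then obtain i where "i \<in> I" "x i \<notin> A i" using \<open>x \<in> extensional I\<close> by (auto simp: PiE_def)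
        then show ?thesis using False assms by (auto intro!: prod_zero[symmetric] bexI[of _ i])
      qed
    qed
    also have "\<dots> = (\<Prod>i\<in>I. \<integral>\<^sup>+x. ?p x * indicator (A i) x \<partial>lborel)"
      using A assms by (intro L.product_nn_integral_prod) auto
    also have "\<dots> = (\<Prod>i\<in>I. emeasure (gauss d) (A i))"
      using A unfolding gauss_def by (intro prod.cong refl emeasure_density[symmetric]) auto
    finally show "emeasure (density (Pi\<^sub>M I (\<lambda>_. lborel)) (\<lambda>x. \<Prod>i\<in>I. ?p (x i))) (Pi\<^sub>E I A) = (\<Prod>i\<in>I. emeasure (gauss d) (A i))" .
  qed
qed

text \<open>By Fubini this is a one-dimensional affine substitution in coordinate \<open>j\<close>;
  \<open>hj\<close> makes the shift constant in the inner integral.\<close>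

lemma nn_integral_PiM_lborel_update:
  assumes I: "finite I" "j \<in> I" and m: "m \<noteq> (0::real)"
    and F[measurable]: "F \<in> borel_measurable (Pi\<^sub>M I (\<lambda>_. lborel))"
    and h[measurable]: "h \<in> borel_measurable (Pi\<^sub>M I (\<lambda>_. lborel))"
    and hj: "\<And>x y. h (x(j := y)) = h x"
  shows "(\<integral>\<^sup>+x. F x \<partial>Pi\<^sub>M I (\<lambda>_. lborel)) = ennreal \<bar>m\<bar> * (\<integral>\<^sup>+x. F (x(j := m * x j + h x)) \<partial>Pi\<^sub>M I (\<lambda>_. lborel))"
proof -
  interpret L: product_sigma_finite "\<lambda>_. lborel :: real measure" by standard
  define J where "J = I - {j}"
  have IJ: "I = insert j J" "finite J" "j \<notin> J" using I by (auto simp: J_def)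
  have G: "(\<lambda>x. F (x(j := m * x j + h x))) \<in> borel_measurable (Pi\<^sub>M I (\<lambda>_. lborel))"
  proof (rule measurable_compose[OF measurable_fun_upd F])
    show "I = I \<union> {j}" using I by auto
    show "(\<lambda>x. m * x j + h x) \<in> measurable (Pi\<^sub>M I (\<lambda>_. lborel)) lborel"
      using I(2) by measurable
  qed simp
  have "(\<integral>\<^sup>+x. F x \<partial>Pi\<^sub>M I (\<lambda>_. lborel)) = (\<integral>\<^sup>+x. \<integral>\<^sup>+y. F (x(j := y)) \<partial>lborel \<partial>Pi\<^sub>M J (\<lambda>_. lborel))"
    unfolding IJ(1) using F IJ by (intro L.product_nn_integral_insert) auto
  also have "\<dots> = (\<integral>\<^sup>+x. \<integral>\<^sup>+y. ennreal \<bar>m\<bar> * F ((x(j := y))(j := m * (x(j := y)) j + h (x(j := y)))) \<partial>lborel \<partial>Pi\<^sub>M J (\<lambda>_. lborel))"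
  proof (rule nn_integral_cong)
    fix x :: "'a \<Rightarrow> real" assume x: "x \<in> space (Pi\<^sub>M J (\<lambda>_. lborel))"
    have "(\<lambda>v. x(j := v)) \<in> measurable lborel (Pi\<^sub>M (insert j J) (\<lambda>_. lborel))"
      by (rule measurable_component_update) (use x IJ in auto)
    hence Fx [measurable]: "(\<lambda>y. F (x(j := y))) \<in> borel_measurable borel"
      using measurable_compose[OF _ F[unfolded IJ(1)]] by simp
    have Fx' [measurable]: "(\<lambda>y. F (x(j := h x + m * y))) \<in> borel_measurable borel"
      by (rule measurable_compose[OF _ Fx]) simp
    have "(\<integral>\<^sup>+y. F (x(j := y)) \<partial>lborel) = ennreal \<bar>m\<bar> * (\<integral>\<^sup>+y. F (x(j := h x + m * y)) \<partial>lborel)"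
      by (rule nn_integral_real_affine[OF Fx m])
    also have "\<dots> = (\<integral>\<^sup>+y. ennreal \<bar>m\<bar> * F (x(j := h x + m * y)) \<partial>lborel)"
      by (rule nn_integral_cmult[symmetric]) simp
    finally show "(\<integral>\<^sup>+y. F (x(j := y)) \<partial>lborel) = (\<integral>\<^sup>+y. ennreal \<bar>m\<bar> * F ((x(j := y))(j := m * (x(j := y)) j + h (x(j := y)))) \<partial>lborel)"
      by (simp add: hj add.commute)
  qed
  also have "\<dots> = (\<integral>\<^sup>+x. ennreal \<bar>m\<bar> * F (x(j := m * x j + h x)) \<partial>Pi\<^sub>M I (\<lambda>_. lborel))"
    unfolding IJ(1) using G IJ by (intro L.product_nn_integral_insert[symmetric]) auto
  also have "\<dots> = ennreal \<bar>m\<bar> * (\<integral>\<^sup>+x. F (x(j := m * x j + h x)) \<partial>Pi\<^sub>M I (\<lambda>_. lborel))"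
    by (rule nn_integral_cmult[OF G])
  finally show ?thesis .
qed

text \<open>The effect on grid increments of passing from \<open>W t\<close> to
  \<open>W t - u * t * W 1\<close>. The restriction to \<open>{..<n}\<close> keeps the result in the
  extensional product space.\<close>

definition subtract_mean :: "nat \<Rightarrow> real \<Rightarrow> (nat \<Rightarrow> real) \<Rightarrow> nat \<Rightarrow> real" where
  "subtract_mean n u x = (\<lambda>i\<in>{..<n}. x i - u / n * psum n x)"

lemma psum_subtract_mean:
  assumes "k \<le> n"
  shows "psum k (subtract_mean n u x) = psum k x - u * (k / n) * psum n x"
proof -
  have "psum k (subtract_mean n u x) = (\<Sum>i<k. x i - u / n * psum n x)"
    using assms unfolding psum_def subtract_mean_def by (intro sum.cong) auto
  also have "\<dots> = psum k x - u * (k / n) * psum n x"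
    by (simp add: sum_subtractf psum_def)
  finally show ?thesis .
qed

lemma subtract_mean_measurable [measurable]:
  "subtract_mean n u \<in> measurable (Pi\<^sub>M {..<n} (\<lambda>_. lborel)) (Pi\<^sub>M {..<n} (\<lambda>_. lborel))"
  unfolding subtract_mean_def by measurable

text \<open>The linear map \<open>subtract_mean\<close> has determinant \<open>1 - u\<close>; it factors into updates of
  single coordinates.\<close>

lemma nn_integral_subtract_mean:
  assumes u: "u < 1" and n: "n > 0"
    and F[measurable]: "F \<in> borel_measurable (Pi\<^sub>M {..<n} (\<lambda>_. lborel))"
  shows "(\<integral>\<^sup>+x. F x \<partial>Pi\<^sub>M {..<n} (\<lambda>_. lborel))
    = ennreal (1 - u) * (\<integral>\<^sup>+x. F (subtract_mean n u x) \<partial>Pi\<^sub>M {..<n} (\<lambda>_. lborel))"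
proof -
  obtain m where m: "n = Suc m" using n by (cases n) auto
  define v where "v = u / n"
  let ?P = "Pi\<^sub>M {..<n} (\<lambda>_. lborel :: real measure)"
  \<comment> \<open>\<open>A1\<close> stores the total in the last coordinate, \<open>A2 m\<close>
    subtracts \<open>v\<close> times the total from the others, \<open>A3\<close> scales the total
    by \<open>1 - u\<close>, and \<open>A4\<close> recovers the last coordinate as total minus rest.
    Only \<open>A3\<close> can change the volume; \<open>A2\<close> is built one coordinate at a
    time by \<open>U\<close>.\<close>
  define A1 where "A1 = (\<lambda>x :: nat \<Rightarrow> real. x(m := 1 * x m + psum m x))"
  define A2 where "A2 k = (\<lambda>(x :: nat \<Rightarrow> real) i. if i < k then x i - v * x m else x i)" for k
  define A3 where "A3 = (\<lambda>x :: nat \<Rightarrow> real. x(m := (1 - u) * x m + 0))"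
  define A4 where "A4 = (\<lambda>x :: nat \<Rightarrow> real. x(m := 1 * x m + (- psum m x)))"
  have mn: "m \<in> {..<n}" "m \<le> n" by (auto simp: m)
  have psum_upd: "psum m (x(m := y)) = psum m x" for x y
    unfolding psum_def by (intro sum.cong) auto
  have upd_meas: "(\<lambda>x. x(j := g x)) \<in> measurable ?P ?P"
    if "j < n" "g \<in> borel_measurable ?P" for j g
    by (rule measurable_fun_upd[of _ "{..<n}"]) (use that in auto)
  have psm: "psum m \<in> borel_measurable ?P" using psum_measurable(2)[OF mn(2)] .
  have xm [measurable]: "(\<lambda>x. x m) \<in> borel_measurable ?P"
    using measurable_component_singleton[OF mn(1), of "\<lambda>_. lborel :: real measure"] by simp
  have M1: "A1 \<in> measurable ?P ?P" and M3: "A3 \<in> measurable ?P ?P" and M4: "A4 \<in> measurable ?P ?P"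
    unfolding A1_def A3_def A4_def using psm xm mn by (intro upd_meas; simp)+
  define U where "U k = (\<lambda>x :: nat \<Rightarrow> real. x(k := 1 * x k + (- v * x m)))" for k
  have A2_Suc: "A2 (Suc k) x = U k (A2 k x)" if "k < m" for k x
    using that by (auto simp: A2_def U_def fun_eq_iff)
  have U_meas: "U k \<in> measurable ?P ?P" if "k < m" for k
  proof -
    have "(\<lambda>x. x k) \<in> borel_measurable ?P"
      using measurable_component_singleton[of k "{..<n}" "\<lambda>_. lborel :: real measure"] that m by simp
    then show ?thesis unfolding U_def by (intro upd_meas) (use that m xm in auto)
  qed
  have M2: "A2 k \<in> measurable ?P ?P" if "k \<le> m" for k
    using that
  proof (induction k)
    case 0
    then show ?case by (simp add: A2_def)
  next
    case (Suc k)
    have "(\<lambda>x. U k (A2 k x)) \<in> measurable ?P ?P"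
      by (rule measurable_compose[OF Suc.IH U_meas]) (use Suc in auto)
    also have "(\<lambda>x. U k (A2 k x)) = A2 (Suc k)" using Suc A2_Suc by auto
    finally show ?case .
  qed
  have I2: "(\<integral>\<^sup>+x. G (A2 k x) \<partial>?P) = (\<integral>\<^sup>+x. G x \<partial>?P)"
    if "k \<le> m" "G \<in> borel_measurable ?P" for k G
    using that
  proof (induction k arbitrary: G)
    case 0
    then show ?case by (simp add: A2_def)
  next
    case (Suc k)
    hence km: "k < m" by simp
    have G: "(\<lambda>x. G (U k x)) \<in> borel_measurable ?P"
      by (rule measurable_compose[OF U_meas[OF km] Suc.prems(2)])
    have "(\<integral>\<^sup>+x. G (A2 (Suc k) x) \<partial>?P) = (\<integral>\<^sup>+x. G (U k (A2 k x)) \<partial>?P)"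
      by (simp only: A2_Suc[OF km])
    also have "\<dots> = (\<integral>\<^sup>+x. G (U k x) \<partial>?P)"
      using Suc.IH[OF _ G] km by simp
    also have "\<dots> = (\<integral>\<^sup>+x. G x \<partial>?P)"
      using nn_integral_PiM_lborel_update[of "{..<n}" k 1 G "\<lambda>x. - v * x m"] Suc.prems xm m
      by (simp add: U_def)
    finally show ?case .
  qed
  have comp: "A4 (A3 (A2 m (A1 x))) = subtract_mean n u x" if "x \<in> space ?P" for x
  proof
    fix i
    have ext: "x i = undefined" if "i \<ge> n"
      using that \<open>x \<in> space ?P\<close> by (auto simp: space_PiM PiE_def extensional_def)
    have S: "psum n x = x m + psum m x" by (simp add: m psum_def)
    have y: "A2 m (A1 x) i = x i - v * psum n x" if "i < m" for i
      using that by (simp add: A2_def A1_def S)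
    have "psum m (A2 m (A1 x)) = (\<Sum>i<m. x i - v * psum n x)"
      unfolding psum_def[of m "A2 m (A1 x)"] by (intro sum.cong) (auto simp: y)
    hence p: "psum m (A2 m (A1 x)) = psum m x - m * v * psum n x"
      by (simp add: sum_subtractf psum_def)
    have nv: "u = (m + 1) * v" using n by (simp add: v_def m field_simps)
    show "A4 (A3 (A2 m (A1 x))) i = subtract_mean n u x i"
    proof (cases "i = m")
      case True
      have "A4 (A3 (A2 m (A1 x))) m = (1 - u) * psum n x - (psum m x - m * v * psum n x)"
        by (simp add: A4_def A3_def psum_upd p) (simp add: A2_def A1_def S)
      also have "\<dots> = x m - v * psum n x"
        unfolding nv using S by (simp add: algebra_simps)
      finally show ?thesis using True by (simp add: subtract_mean_def m v_def)
    next
      case False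
      then show ?thesis using y ext
        by (cases "i < m") (auto simp: A4_def A3_def A2_def A1_def subtract_mean_def m v_def S)
    qed
  qed
  have G4: "(\<lambda>x. F (A4 x)) \<in> borel_measurable ?P" by (rule measurable_compose[OF M4 F])
  have G3: "(\<lambda>x. F (A4 (A3 x))) \<in> borel_measurable ?P" by (rule measurable_compose[OF M3 G4])
  have G2: "(\<lambda>x. F (A4 (A3 (A2 m x)))) \<in> borel_measurable ?P" by (rule measurable_compose[OF M2 G3]) simp
  have "(\<integral>\<^sup>+x. F x \<partial>?P) = (\<integral>\<^sup>+x. F (A4 x) \<partial>?P)"
    unfolding A4_def using nn_integral_PiM_lborel_update[of "{..<n}" m 1 F "\<lambda>x. - psum m x"] mn psm
    by (simp add: psum_upd)
  also have "\<dots> = ennreal \<bar>1 - u\<bar> * (\<integral>\<^sup>+x. F (A4 (A3 x)) \<partial>?P)"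
    unfolding A3_def using u mn G4 by (intro nn_integral_PiM_lborel_update) auto
  also have "(\<integral>\<^sup>+x. F (A4 (A3 x)) \<partial>?P) = (\<integral>\<^sup>+x. F (A4 (A3 (A2 m x))) \<partial>?P)"
    by (rule I2[symmetric]) (use G3 in auto)
  also have "\<dots> = (\<integral>\<^sup>+x. F (A4 (A3 (A2 m (A1 x)))) \<partial>?P)"
    unfolding A1_def using nn_integral_PiM_lborel_update[of "{..<n}" m 1 "\<lambda>x. F (A4 (A3 (A2 m x)))" "psum m"] mn psm G2
    by (simp add: psum_upd)
  also have "\<dots> = (\<integral>\<^sup>+x. F (subtract_mean n u x) \<partial>?P)"
    by (intro nn_integral_cong) (simp add: comp)
  finally show ?thesis using u by simp
qed

text \<open>With \<open>S\<close> the total, the map changes the sum of squares by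
  \<open>- (2 * u - u\<^sup>2) * S\<^sup>2 / n\<close> and multiplies the total by
  \<open>1 - u\<close>. The ratio of Gaussian densities is thus a function of the new total alone,
  with coefficient \<open>1 / (1 - u)\<^sup>2 - 1\<close> over twice the time span
  \<open>n * d\<close>; the prefactor \<open>1 - u\<close> is the determinant.\<close>

lemma nn_integral_gauss_subtract_mean:
  assumes u: "u < 1" and n: "n > 0" and d: "d > 0"
    and F[measurable]: "F \<in> borel_measurable (Pi\<^sub>M {..<n} (\<lambda>_. lborel))"
  shows "(\<integral>\<^sup>+x. ennreal ((1 - u) * exp ((1 / (1 - u)\<^sup>2 - 1) / (2 * (n * d)) * (psum n (subtract_mean n u x))\<^sup>2))
              * F (subtract_mean n u x) \<partial>Pi\<^sub>M {..<n} (\<lambda>_. gauss d))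
    = (\<integral>\<^sup>+x. F x \<partial>Pi\<^sub>M {..<n} (\<lambda>_. gauss d))"
proof -
  let ?P = "Pi\<^sub>M {..<n} (\<lambda>_. lborel :: real measure)"
  let ?p = "\<lambda>x. \<Prod>i<n. ennreal (normal_density 0 (sqrt d) (x i))"
  let ?L = "subtract_mean n u"
  let ?E = "\<lambda>x. (1 - u) * exp ((1 / (1 - u)\<^sup>2 - 1) / (2 * (n * d)) * (psum n (?L x))\<^sup>2)"
  have p_meas [measurable]: "?p \<in> borel_measurable ?P" by measurable
  have psum_L [measurable]: "(\<lambda>x. psum n (?L x)) \<in> borel_measurable ?P"
    by (rule measurable_compose[OF subtract_mean_measurable psum_measurable(2)]) simp
  have FL [measurable]: "(\<lambda>x. F (?L x)) \<in> borel_measurable ?P"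
    by (rule measurable_compose[OF subtract_mean_measurable F])
  have pL [measurable]: "(\<lambda>x. ?p (?L x)) \<in> borel_measurable ?P"
    by (rule measurable_compose[OF subtract_mean_measurable p_meas])
  define c where "c = 1 / sqrt (2 * pi * d)"
  have p: "?p x = ennreal (c ^ n * exp (- (\<Sum>i<n. (x i)\<^sup>2) / (2 * d)))" for x
  proof -
    have "?p x = ennreal (\<Prod>i<n. normal_density 0 (sqrt d) (x i))" by (rule prod_ennreal) simp
    also have "(\<Prod>i<n. normal_density 0 (sqrt d) (x i)) = (\<Prod>i<n. c * exp (- (x i)\<^sup>2 / (2 * d)))"
      using d by (simp add: normal_density_def c_def)
    also have "\<dots> = c ^ n * exp (- (\<Sum>i<n. (x i)\<^sup>2) / (2 * d))"
      by (simp add: prod.distrib exp_sum[symmetric] sum_negf[symmetric] sum_divide_distrib)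
    finally show ?thesis .
  qed
  have key: "?p x * (ennreal (?E x) * F (?L x)) = ennreal (1 - u) * (?p (?L x) * F (?L x))" for x
  proof -
    define S where "S = psum n x"
    have S: "psum n (?L x) = (1 - u) * S"
      using psum_subtract_mean[of n n u x] n by (simp add: S_def algebra_simps)
    have "(\<Sum>i<n. (?L x i)\<^sup>2) = (\<Sum>i<n. (x i)\<^sup>2 - 2 * (u / n * S) * x i + (u / n * S)\<^sup>2)"
      by (intro sum.cong refl) (simp add: subtract_mean_def S_def power2_diff)
    also have "\<dots> = (\<Sum>i<n. (x i)\<^sup>2) - 2 * (u / n * S) * S + n * (u / n * S)\<^sup>2"
    proof -
      have "(\<Sum>i<n. (x i)\<^sup>2 - 2 * K * x i + K\<^sup>2) = (\<Sum>i<n. (x i)\<^sup>2) - 2 * K * S + n * K\<^sup>2" for K :: real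
        by (simp add: sum.distrib sum_subtractf sum_distrib_left S_def psum_def)
      then show ?thesis .
    qed
    also have "\<dots> = (\<Sum>i<n. (x i)\<^sup>2) - (2 * u - u\<^sup>2) * S\<^sup>2 / n"
      using n by (simp add: field_simps power2_eq_square)
    finally have sq: "(\<Sum>i<n. (?L x i)\<^sup>2) = (\<Sum>i<n. (x i)\<^sup>2) - (2 * u - u\<^sup>2) * S\<^sup>2 / n" .
    have "(1 / a\<^sup>2 - 1) * (a * S)\<^sup>2 = (1 - a\<^sup>2) * S\<^sup>2" if "a \<noteq> 0" for a
      using that by (simp add: field_simps)
    from this[of "1 - u"] have "(1 / (1 - u)\<^sup>2 - 1) * ((1 - u) * S)\<^sup>2 = (1 - (1 - u)\<^sup>2) * S\<^sup>2"
      using u by simp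
    also have "\<dots> = (2 * u - u\<^sup>2) * S\<^sup>2" by (simp add: power2_eq_square algebra_simps)
    finally have k1: "(1 / (1 - u)\<^sup>2 - 1) / (2 * (n * d)) * ((1 - u) * S)\<^sup>2 = (2 * u - u\<^sup>2) * S\<^sup>2 / (2 * (n * d))"
      by (metis times_divide_eq_left)
    have "- (\<Sum>i<n. (x i)\<^sup>2) / (2 * d) + (1 / (1 - u)\<^sup>2 - 1) / (2 * (n * d)) * (psum n (?L x))\<^sup>2
        = - (\<Sum>i<n. (?L x i)\<^sup>2) / (2 * d)"
      unfolding S k1 sq using n d by (simp add: field_simps)
    hence "exp (- (\<Sum>i<n. (x i)\<^sup>2) / (2 * d)) * exp ((1 / (1 - u)\<^sup>2 - 1) / (2 * (n * d)) * (psum n (?L x))\<^sup>2)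
        = exp (- (\<Sum>i<n. (?L x i)\<^sup>2) / (2 * d))"
      by (simp only: mult_exp_exp)
    hence "?p x * ennreal (?E x) = ennreal (1 - u) * ?p (?L x)"
      unfolding p using u d by (subst (1 2) ennreal_mult'[symmetric]) (auto simp: c_def mult_ac)
    then show ?thesis by (metis mult.assoc)
  qed
  have "(\<integral>\<^sup>+x. ennreal (?E x) * F (?L x) \<partial>Pi\<^sub>M {..<n} (\<lambda>_. gauss d))
      = (\<integral>\<^sup>+x. ?p x * (ennreal (?E x) * F (?L x)) \<partial>?P)"
    unfolding PiM_gauss_density[OF finite_lessThan d, symmetric] by (rule nn_integral_density) measurable
  also have "\<dots> = ennreal (1 - u) * (\<integral>\<^sup>+x. ?p (?L x) * F (?L x) \<partial>?P)"
    unfolding key by (rule nn_integral_cmult) measurable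
  also have "\<dots> = (\<integral>\<^sup>+x. ?p x * F x \<partial>?P)"
    by (rule nn_integral_subtract_mean[OF u n, symmetric]) measurable
  also have "\<dots> = (\<integral>\<^sup>+x. F x \<partial>Pi\<^sub>M {..<n} (\<lambda>_. gauss d))"
    unfolding PiM_gauss_density[OF finite_lessThan d, symmetric] by (rule nn_integral_density[symmetric]) measurable
  finally show ?thesis .
qed

section \<open>Brownian motion on an equidistant grid\<close>

context standard_brownian_motion
begin

lemma distr_increments:
  assumes n: "n > 0"
  shows "distr M (Pi\<^sub>M {..<n} (\<lambda>_. borel)) (\<lambda>\<omega>. \<lambda>i\<in>{..<n}. W (Suc i / n) \<omega> - W (i / n) \<omega>)
     = Pi\<^sub>M {..<n} (\<lambda>_. gauss (1 / n))"
proof -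
  let ?D = "\<lambda>i \<omega>. W (Suc i / n) \<omega> - W (i / n) \<omega>"
  have t: "real i / n \<in> {0..1}" if "i \<le> n" for i using that n by auto
  have rvD: "random_variable borel (?D i)" if "i < n" for i
    using that by (intro borel_measurable_diff rv t) auto
  have "indep_vars (\<lambda>_. borel) (\<lambda>i \<omega>. W (real (Suc i) / n) \<omega> - W (real i / n) \<omega>) {..<n}"
    by (rule indep_increments) (use n in \<open>auto simp: mono_on_def divide_right_mono\<close>)
  hence "distr M (Pi\<^sub>M {..<n} (\<lambda>_. borel)) (\<lambda>\<omega>. \<lambda>i\<in>{..<n}. ?D i \<omega>) = Pi\<^sub>M {..<n} (\<lambda>i. distr M borel (?D i))"
    using n rvD by (subst (asm) indep_vars_iff_distr_eq_PiM') auto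
  also have "\<dots> = Pi\<^sub>M {..<n} (\<lambda>_. gauss (1 / n))"
  proof (rule PiM_cong[OF refl])
    fix i assume i: "i \<in> {..<n}"
    have "distributed M lborel (?D i) (normal_density 0 (sqrt (Suc i / n - i / n)))"
      by (rule gaussian_increments) (use i n in \<open>auto simp: divide_strict_right_mono\<close>)
    hence "distr M lborel (?D i) = gauss (1 / n)"
      by (simp add: distributed_def gauss_def diff_divide_distrib[symmetric])
    then show "distr M borel (?D i) = gauss (1 / n)"
      by (metis distr_cong sets_lborel)
  qed
  finally show ?thesis .
qed

lemma W_sub_measurable:
  assumes "t \<in> {0..1}"
  shows "W_sub u W t \<in> borel_measurable M"
proof -
  have [measurable]: "W t \<in> borel_measurable M" "W 1 \<in> borel_measurable M" using assms rv by auto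
  show ?thesis unfolding W_sub_def[abs_def] by measurable
qed

text \<open>The endpoint factor is the density that undoes the passage from \<open>W\<close> to
  \<open>W_sub u W\<close>; what remains is the telescoping formula for independent Gaussian
  increments.\<close>

lemma nn_integral_exp_quad_W_sub:
  assumes u: "u < 1" and n: "n > 0" and f: "\<And>k. f k > 0"
  shows "(\<integral>\<^sup>+\<omega>. ennreal ((1 - u) * exp ((1 / (1 - u)\<^sup>2 - 1) / 2 * (W_sub u W 1 \<omega>)\<^sup>2
            + quad f (1 / n) n (\<lambda>k. W_sub u W (k / n) \<omega>))) \<partial>M) = ennreal (sqrt (f n / f 0))"
proof -
  let ?D = "\<lambda>\<omega>. \<lambda>i\<in>{..<n}. W (Suc i / n) \<omega> - W (i / n) \<omega>"
  let ?L = "subtract_mean n u" and ?d = "1 / real n"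
  let ?B = "Pi\<^sub>M {..<n} (\<lambda>_. borel :: real measure)"
  let ?\<kappa> = "1 / (1 - u)\<^sup>2 - 1"
  define F where "F x = ennreal (exp (quad f ?d n (\<lambda>k. psum k x)))" for x
  define G where "G x = ennreal ((1 - u) * exp (?\<kappa> / (2 * (n * ?d)) * (psum n (?L x))\<^sup>2)) * F (?L x)" for x
  have Fm: "F \<in> borel_measurable (Pi\<^sub>M {..<n} (\<lambda>_. lborel))"
    unfolding F_def quad_def by measurable
  have FL: "(\<lambda>x. F (?L x)) \<in> borel_measurable (Pi\<^sub>M {..<n} (\<lambda>_. lborel))"
    by (rule measurable_compose[OF subtract_mean_measurable Fm])
  have psum_L: "(\<lambda>x. psum n (?L x)) \<in> borel_measurable (Pi\<^sub>M {..<n} (\<lambda>_. lborel))"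
    by (rule measurable_compose[OF subtract_mean_measurable psum_measurable(2)]) simp
  have "G \<in> borel_measurable (Pi\<^sub>M {..<n} (\<lambda>_. lborel))"
    unfolding G_def using FL psum_L by measurable
  also have "borel_measurable (Pi\<^sub>M {..<n} (\<lambda>_. lborel)) = borel_measurable ?B"
    by (rule measurable_cong_sets) (auto intro!: sets_PiM_cong)
  finally have Gm: "G \<in> borel_measurable ?B" .
  have Dm: "?D \<in> measurable M ?B"
    using n by (intro measurable_restrict borel_measurable_diff rv) (auto simp: divide_simps)
  have Z1: "AE \<omega> in M. ennreal ((1 - u) * exp (?\<kappa> / 2 * (W_sub u W 1 \<omega>)\<^sup>2
            + quad f ?d n (\<lambda>k. W_sub u W (k / n) \<omega>))) = G (?D \<omega>)"
    using start_zero
  proof eventually_elim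
    fix \<omega> assume W0: "W 0 \<omega> = 0"
    have ps: "psum k (?D \<omega>) = W (k / n) \<omega>" if "k \<le> n" for k
    proof -
      have "psum k (?D \<omega>) = (\<Sum>i<k. W (Suc i / n) \<omega> - W (i / n) \<omega>)"
        unfolding psum_def using that by (intro sum.cong) auto
      also have "\<dots> = W (k / n) \<omega> - W (0 / n) \<omega>"
        using sum_lessThan_telescope[of "\<lambda>i. W (i / n) \<omega>" k] by simp
      finally show ?thesis using W0 by simp
    qed
    have pL: "psum k (?L (?D \<omega>)) = W_sub u W (k / n) \<omega>" if "k \<le> n" for k
      unfolding psum_subtract_mean[OF that] ps[OF that] ps[OF order_refl] W_sub_def using n by simp
    have q: "quad f ?d n (\<lambda>k. psum k (?L (?D \<omega>))) = quad f ?d n (\<lambda>k. W_sub u W (k / n) \<omega>)"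
      unfolding quad_def using pL by (intro arg_cong2[where f="(-)"] sum.cong) auto
    have "psum n (?L (?D \<omega>)) = W_sub u W 1 \<omega>" using pL[of n] n by simp
    then show "ennreal ((1 - u) * exp (?\<kappa> / 2 * (W_sub u W 1 \<omega>)\<^sup>2
            + quad f ?d n (\<lambda>k. W_sub u W (k / n) \<omega>))) = G (?D \<omega>)"
      unfolding G_def F_def q using u n
      by (subst ennreal_mult'[symmetric]) (auto simp: exp_add mult_ac)
  qed
  have "(\<integral>\<^sup>+\<omega>. ennreal ((1 - u) * exp (?\<kappa> / 2 * (W_sub u W 1 \<omega>)\<^sup>2
            + quad f ?d n (\<lambda>k. W_sub u W (k / n) \<omega>))) \<partial>M) = (\<integral>\<^sup>+\<omega>. G (?D \<omega>) \<partial>M)"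
    by (rule nn_integral_cong_AE[OF Z1])
  also have "\<dots> = (\<integral>\<^sup>+x. G x \<partial>distr M ?B ?D)"
    by (rule nn_integral_distr[OF Dm, symmetric]) (simp add: Gm)
  also have "\<dots> = (\<integral>\<^sup>+x. G x \<partial>Pi\<^sub>M {..<n} (\<lambda>_. gauss ?d))"
    unfolding distr_increments[OF n] ..
  also have "\<dots> = (\<integral>\<^sup>+x. F x \<partial>Pi\<^sub>M {..<n} (\<lambda>_. gauss ?d))"
    unfolding G_def by (rule nn_integral_gauss_subtract_mean[OF u n _ Fm]) (use n in auto)
  also have "\<dots> = ennreal (sqrt (f n / f 0))"
    unfolding F_def by (rule nn_integral_exp_quad) (use n f in auto)
  finally show ?thesis .
qed

end

section \<open>The Cameron--Martin formula\<close>

text \<open>An array uniformly close to the samples \<open>h (k / n)\<close> is allowed because the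
  coefficients to be summed are difference quotients that depend on \<open>n\<close> themselves. The
  sum is compared with the increments of an antiderivative by the mean value theorem.\<close>

lemma riemann_sum_array_tendsto:
  fixes h :: "real \<Rightarrow> real" and b :: "nat \<Rightarrow> nat \<Rightarrow> real"
  assumes h: "continuous_on {0..1} h"
    and b: "\<And>\<epsilon>. \<epsilon> > 0 \<Longrightarrow> \<forall>\<^sub>F n in sequentially. \<forall>k<n. \<bar>b n k - h (k / n)\<bar> \<le> \<epsilon>"
  shows "(\<lambda>n. (\<Sum>k<n. b n k) / n) \<longlonglongrightarrow> integral {0..1} h"
proof (rule metric_LIMSEQ_I)
  fix r :: real assume r: "r > 0"
  define \<epsilon> where "\<epsilon> = r / 4"
  have \<epsilon>: "\<epsilon> > 0" using r by (simp add: \<epsilon>_def)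
  have "uniformly_continuous_on {0..1} h"
    by (rule compact_uniformly_continuous[OF h]) simp
  then obtain \<delta> where \<delta>: "\<delta> > 0" "\<And>x y. x \<in> {0..1} \<Longrightarrow> y \<in> {0..1} \<Longrightarrow> \<bar>y - x\<bar> < \<delta> \<Longrightarrow> \<bar>h y - h x\<bar> < \<epsilon>"
    using \<epsilon> unfolding uniformly_continuous_on_def dist_real_def by metis
  have "\<forall>\<^sub>F n in sequentially. 1 / real n < \<delta>"
    using \<delta>(1) by real_asymp
  with b[OF \<epsilon>] eventually_gt_at_top[of 0]
  have "\<forall>\<^sub>F n in sequentially. dist ((\<Sum>k<n. b n k) / n) (integral {0..1} h) < r"
  proof eventually_elim
    fix n :: nat assume bn: "\<forall>k<n. \<bar>b n k - h (k / n)\<bar> \<le> \<epsilon>" and n: "0 < n" and n\<delta>: "1 / real n < \<delta>"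
    define H where "H t = integral {0..t} h" for t
    have H: "(H has_real_derivative h t) (at t within {0..1})" if "t \<in> {0..1}" for t
      unfolding H_def by (rule integral_has_real_derivative[OF h that])
    have bound: "\<bar>b n k / n - (H (Suc k / n) - H (k / n))\<bar> \<le> 2 * \<epsilon> / n" if "k < n" for k
    proof -
      have lt: "real k / n < Suc k / n" using n by (simp add: divide_strict_right_mono)
      have sub: "{real k / n..Suc k / n} \<subseteq> {0..1}" using that n by (auto simp: divide_simps)
      have "\<exists>x\<in>{real k / n<..<Suc k / n}. H (Suc k / n) - H (k / n) = (\<lambda>y. y * h x) (Suc k / n - k / n)"
      proof (rule mvt_simple[OF lt])
        fix x assume "real k / n \<le> x" "x \<le> Suc k / n"
        hence "(H has_real_derivative h x) (at x within {real k / n..Suc k / n})"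
          by (intro DERIV_subset[OF H sub] subsetD[OF sub]) auto
        then show "(H has_derivative (\<lambda>y. y * h x)) (at x within {real k / n..Suc k / n})"
          unfolding has_field_derivative_def by (simp add: mult_commute_abs)
      qed
      then obtain x where x: "x \<in> {real k / n<..<Suc k / n}" "H (Suc k / n) - H (k / n) = h x / n"
        by (auto simp: diff_divide_distrib[symmetric])
      have "\<bar>x - k / n\<bar> < 1 / n" using x(1) by (auto simp: add_divide_distrib)
      hence "\<bar>h x - h (k / n)\<bar> < \<epsilon>"
        using x(1) sub n\<delta> lt by (intro \<delta>(2)) (auto simp: subset_iff)
      hence "\<bar>b n k - h x\<bar> \<le> 2 * \<epsilon>" using bn that by (smt (verit))
      hence "\<bar>b n k - h x\<bar> / n \<le> 2 * \<epsilon> / n" by (rule divide_right_mono) simp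
      then show ?thesis unfolding x(2) by (simp add: diff_divide_distrib[symmetric])
    qed
    have "(\<Sum>k<n. H (Suc k / n) - H (k / n)) = H (n / n) - H (0 / n)"
      using sum_lessThan_telescope[of "\<lambda>k. H (k / n)" n] by simp
    also have "\<dots> = integral {0..1} h" using n by (simp add: H_def)
    finally have tel: "(\<Sum>k<n. H (Suc k / n) - H (k / n)) = integral {0..1} h" .
    have "\<bar>(\<Sum>k<n. b n k) / n - integral {0..1} h\<bar> = \<bar>\<Sum>k<n. b n k / n - (H (Suc k / n) - H (k / n))\<bar>"
      unfolding tel[symmetric] by (simp only: sum_divide_distrib sum_subtractf)
    also have "\<dots> \<le> (\<Sum>k<n. \<bar>b n k / n - (H (Suc k / n) - H (k / n))\<bar>)" by (rule sum_abs)
    also have "\<dots> \<le> (\<Sum>k<n. 2 * \<epsilon> / n)" by (intro sum_mono bound) simp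
    also have "\<dots> = 2 * \<epsilon>" using n by simp
    also have "\<dots> < r" using r by (simp add: \<epsilon>_def)
    finally show "dist ((\<Sum>k<n. b n k) / n) (integral {0..1} h) < r" by (simp add: dist_real_def)
  qed
  then show "\<exists>N. \<forall>n\<ge>N. dist ((\<Sum>k<n. b n k) / n) (integral {0..1} h) < r"
    by (simp add: eventually_sequentially)
qed

section \<open>Difference quotients of a positive function of class C2\<close>

locale positive_C2 =
  fixes f f' f'' :: "real \<Rightarrow> real"
  assumes deriv1: "\<And>t. t \<in> {0..1} \<Longrightarrow> (f has_real_derivative f' t) (at t within {0..1})"
    and deriv2: "\<And>t. t \<in> {0..1} \<Longrightarrow> (f' has_real_derivative f'' t) (at t within {0..1})"
    and cont2: "continuous_on {0..1} f''"
    and f_pos: "\<And>t. t \<in> {0..1} \<Longrightarrow> f t > 0"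
begin

lemma cont0: "continuous_on {0..1} f"
  by (rule DERIV_continuous_on[OF deriv1])

definition potential :: "real \<Rightarrow> real" where "potential t = f'' t / f t"

text \<open>At \<open>k = 0\<close> natural subtraction yields \<open>f (1 / n) - f 0\<close> in
  place of a second difference, so this value may grow like \<open>n\<close>. It only meets the
  square of a path that starts at 0.\<close>

definition discrete_potential :: "nat \<Rightarrow> nat \<Rightarrow> real" where
  "discrete_potential n k = (f ((k + 1) / n) - 2 * f (k / n) + f ((k - 1 :: nat) / n)) * (real n)\<^sup>2 / f (k / n)"

definition discrete_slope :: "nat \<Rightarrow> real" where
  "discrete_slope n = n * (1 - f ((n - 1 :: nat) / n) / f 1)"

lemma cont_potential: "continuous_on {0..1} potential"
  unfolding potential_def by (intro continuous_on_divide cont2 cont0) (use f_pos in force)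

lemma discrete_slope_tendsto: "discrete_slope \<longlonglongrightarrow> f' 1 / f 1"
proof -
  have "((\<lambda>y. (f y - f 1) / (y - 1)) \<longlongrightarrow> f' 1) (at 1 within {0..1})"
    using deriv1[of 1] by (simp add: has_field_derivative_iff)
  moreover have "filterlim (\<lambda>n. real (n - 1) / n) (at 1 within {0..1}) sequentially"
    unfolding filterlim_at
  proof
    show "(\<lambda>n. real (n - 1) / n) \<longlonglongrightarrow> 1"
    proof (rule Lim_transform_eventually)
      show "(\<lambda>n. 1 - 1 / real n) \<longlonglongrightarrow> 1" by real_asymp
      show "\<forall>\<^sub>F n in sequentially. 1 - 1 / real n = real (n - 1) / n"
        using eventually_gt_at_top[of 0] by eventually_elim (auto simp: of_nat_diff field_simps)
    qed
    show "\<forall>\<^sub>F n in sequentially. real (n - 1) / n \<in> {0..1} \<and> real (n - 1) / n \<noteq> 1"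
      using eventually_gt_at_top[of 0] by eventually_elim (auto simp: divide_simps)
  qed
  ultimately have "(\<lambda>n. (f (real (n - 1) / n) - f 1) / (real (n - 1) / n - 1)) \<longlonglongrightarrow> f' 1"
    by (rule filterlim_compose)
  hence "(\<lambda>n. (f (real (n - 1) / n) - f 1) / (real (n - 1) / n - 1) / f 1) \<longlonglongrightarrow> f' 1 / f 1"
    by (rule tendsto_divide) (use f_pos[of 1] in auto)
  then show ?thesis
  proof (rule Lim_transform_eventually)
    show "\<forall>\<^sub>F n in sequentially. (f (real (n - 1) / n) - f 1) / (real (n - 1) / n - 1) / f 1 = discrete_slope n"
      using eventually_gt_at_top[of 0]
    proof eventually_elim
      fix n :: nat assume n: "0 < n"
      have e: "real (n - 1) / n - 1 = - 1 / n" using n by (simp add: of_nat_diff field_simps)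
      show "(f (real (n - 1) / n) - f 1) / (real (n - 1) / n - 1) / f 1 = discrete_slope n"
        unfolding e discrete_slope_def using n f_pos[of 1] by (simp add: field_simps)
    qed
  qed
qed

text \<open>Two mean value theorems: one for \<open>f (x + h) - f x\<close> as a function of
  \<open>x\<close> on \<open>{t - h..t}\<close>, then one for \<open>f'\<close>.\<close>

lemma second_difference:
  assumes h: "h > 0" and t: "0 \<le> t - h" "t + h \<le> 1"
  shows "\<exists>x\<in>{t - h<..<t + h}. f (t + h) - 2 * f t + f (t - h) = h\<^sup>2 * f'' x"
proof -
  have mvt: "\<exists>x\<in>{a<..<b}. g b - g a = (b - a) * g' x"
    if ab: "a < b" "0 \<le> a" "b \<le> 1" and g: "\<And>s. s \<in> {a..b} \<Longrightarrow> (g has_real_derivative g' s) (at s within {a..b})"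
    for a b :: real and g g'
  proof -
    have "\<exists>x\<in>{a<..<b}. g b - g a = (\<lambda>y. y * g' x) (b - a)"
    proof (rule mvt_simple[OF ab(1)])
      fix x assume "a \<le> x" "x \<le> b"
      with g[of x] show "(g has_derivative (\<lambda>y. y * g' x)) (at x within {a..b})"
        unfolding has_field_derivative_def by (simp add: mult_commute_abs)
    qed
    then show ?thesis by simp
  qed
  have "\<exists>x\<in>{t - h<..<t}. (f (t + h) - f t) - (f ((t - h) + h) - f (t - h)) = (t - (t - h)) * (f' (x + h) - f' x)"
  proof (rule mvt[of "t - h" t "\<lambda>x. f (x + h) - f x" "\<lambda>x. f' (x + h) - f' x"])
    fix s assume s: "s \<in> {t - h..t}"
    have "(f has_real_derivative f' (s + h)) (at (s + h) within (\<lambda>x. x + h) ` {t - h..t})"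
      using s h t by (intro DERIV_subset[OF deriv1]) auto
    moreover have "((\<lambda>x. x + h) has_real_derivative 1) (at s within {t - h..t})"
      by (auto intro!: derivative_eq_intros)
    ultimately have "((\<lambda>x. f (x + h)) has_real_derivative f' (s + h)) (at s within {t - h..t})"
      using DERIV_image_chain[of f "f' (s + h)" "\<lambda>x. x + h" s "{t - h..t}" 1] by (simp add: o_def)
    moreover have "(f has_real_derivative f' s) (at s within {t - h..t})"
      using s h t by (intro DERIV_subset[OF deriv1]) auto
    ultimately show "((\<lambda>x. f (x + h) - f x) has_real_derivative f' (s + h) - f' s) (at s within {t - h..t})"
      by (rule DERIV_diff)
  qed (use h t in auto)
  then obtain x where x: "x \<in> {t - h<..<t}" "f (t + h) - 2 * f t + f (t - h) = h * (f' (x + h) - f' x)" by auto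
  have "\<exists>y\<in>{x<..<x + h}. f' (x + h) - f' x = (x + h - x) * f'' y"
    using x(1) h t by (intro mvt[of x "x + h" f' f'']) (auto intro!: DERIV_subset[OF deriv2])
  then obtain y where y: "y \<in> {x<..<x + h}" "f' (x + h) - f' x = h * f'' y" by auto
  show ?thesis using x y by (intro bexI[of _ y]) (auto simp: power2_eq_square)
qed

text \<open>The intermediate point of \<open>second_difference\<close> is within
  \<open>1 / n\<close> of \<open>k / n\<close>, so uniform continuity of \<open>f''\<close> and a
  positive lower bound \<open>m\<close> of \<open>f\<close> give an estimate independent of
  \<open>k\<close>. Index 0 is left out because it has no left neighbour in the grid.\<close>

lemma discrete_potential_uniform:
  assumes \<epsilon>: "\<epsilon> > 0"
  shows "\<forall>\<^sub>F n in sequentially. \<forall>k. 0 < k \<and> k < n \<longrightarrow> \<bar>discrete_potential n k - potential (k / n)\<bar> \<le> \<epsilon>"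
proof -
  obtain m where m: "m > 0" "\<And>t. t \<in> {0..1} \<Longrightarrow> f t \<ge> m"
  proof -
    obtain x where "x \<in> {0..1}" "\<And>y. y \<in> {0..1} \<Longrightarrow> f x \<le> f y"
      using continuous_attains_inf[of "{0..1::real}" f] cont0 by auto
    then show ?thesis using f_pos that by blast
  qed
  have "uniformly_continuous_on {0..1} f''"
    by (rule compact_uniformly_continuous[OF cont2]) simp
  then obtain \<delta> where \<delta>: "\<delta> > 0" "\<And>x y. x \<in> {0..1} \<Longrightarrow> y \<in> {0..1} \<Longrightarrow> \<bar>y - x\<bar> < \<delta> \<Longrightarrow> \<bar>f'' y - f'' x\<bar> < \<epsilon> * m"
    using \<epsilon> m(1) unfolding uniformly_continuous_on_def dist_real_def by (metis mult_pos_pos)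
  have "\<forall>\<^sub>F n in sequentially. 1 / real n < \<delta>"
    using \<delta>(1) by real_asymp
  then show ?thesis
  proof eventually_elim
    fix n :: nat assume n\<delta>: "1 / real n < \<delta>"
    show "\<forall>k. 0 < k \<and> k < n \<longrightarrow> \<bar>discrete_potential n k - potential (k / n)\<bar> \<le> \<epsilon>"
    proof (intro allI impI)
      fix k assume k: "0 < k \<and> k < n"
      hence n: "n > 0" by simp
      have km: "real (k - 1) / n = k / n - 1 / n" using k by (simp add: of_nat_diff field_simps)
      have kp: "(real k + 1) / n = k / n + 1 / n" by (simp add: add_divide_distrib)
      have kn: "real k / n \<in> {0..1}" using k by auto
      have lo: "0 \<le> real k / n - 1 / n" unfolding km[symmetric] by simp
      have hi: "real k / n + 1 / n \<le> 1" unfolding kp[symmetric] using k by auto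
      from second_difference[OF _ lo hi] n obtain x where
        x: "x \<in> {real k / n - 1 / n<..<real k / n + 1 / n}"
          "f (real k / n + 1 / n) - 2 * f (k / n) + f (real k / n - 1 / n) = (1 / n)\<^sup>2 * f'' x" by auto
      have "discrete_potential n k = f'' x / f (k / n)"
        unfolding discrete_potential_def km of_nat_add of_nat_1 kp x(2) using n by (simp add: power_divide)
      hence "\<bar>discrete_potential n k - potential (k / n)\<bar> = \<bar>f'' x - f'' (k / n)\<bar> / f (k / n)"
        using f_pos[OF kn] by (simp add: potential_def diff_divide_distrib[symmetric])
      also have "\<dots> \<le> (\<epsilon> * m) / m"
      proof (rule frac_le)
        show "\<bar>f'' x - f'' (k / n)\<bar> \<le> \<epsilon> * m"
          using x(1) lo hi n\<delta> kn by (intro less_imp_le \<delta>(2)) auto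
      qed (use m kn \<epsilon> in auto)
      finally show "\<bar>discrete_potential n k - potential (k / n)\<bar> \<le> \<epsilon>" using m(1) by simp
    qed
  qed
qed

lemma quad_eq:
  assumes n: "n > 0"
  shows "quad (\<lambda>k. f (k / n)) (1 / n) n (\<lambda>k. z (k / n))
     = discrete_slope n / 2 * (z 1)\<^sup>2 - (\<Sum>k<n. discrete_potential n k * (z (k / n))\<^sup>2) / n / 2"
proof -
  have "(\<Sum>k<n. (f (real (k + 1) / n) - 2 * f (k / n) + f (real (k - 1) / n)) / (2 * (1 / n) * f (k / n)) * (z (k / n))\<^sup>2)
      = (\<Sum>k<n. discrete_potential n k * (z (k / n))\<^sup>2 / n / 2)"
  proof (rule sum.cong)
    have e: "A / (2 * (1 / real n) * F) * y = A * (real n)\<^sup>2 / F * y / n / 2" for A F y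
      using n by (simp add: power2_eq_square)
    fix k
    show "(f (real (k + 1) / n) - 2 * f (k / n) + f (real (k - 1) / n)) / (2 * (1 / n) * f (k / n)) * (z (k / n))\<^sup>2
        = discrete_potential n k * (z (k / n))\<^sup>2 / n / 2"
      unfolding discrete_potential_def e by (simp add: add.commute)
  qed simp
  also have "\<dots> = (\<Sum>k<n. discrete_potential n k * (z (k / n))\<^sup>2) / n / 2"
    by (simp only: sum_divide_distrib)
  finally show ?thesis
    using n by (simp add: quad_def discrete_slope_def)
qed

lemma quad_tendsto:
  assumes z: "continuous_on {0..1} z" "z 0 = 0"
  shows "(\<lambda>n. quad (\<lambda>k. f (k / n)) (1 / n) n (\<lambda>k. z (k / n)))
      \<longlonglongrightarrow> f' 1 / f 1 / 2 * (z 1)\<^sup>2 - integral {0..1} (\<lambda>t. potential t * (z t)\<^sup>2) / 2"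
proof -
  obtain B where B: "B > 0" "\<And>t. t \<in> {0..1} \<Longrightarrow> (z t)\<^sup>2 \<le> B"
  proof -
    have "compact ((\<lambda>t. (z t)\<^sup>2) ` {0..1})"
      by (intro compact_continuous_image continuous_intros z) auto
    hence "bounded ((\<lambda>t. (z t)\<^sup>2) ` {0..1})" by (rule compact_imp_bounded)
    then obtain B where "B > 0" "\<forall>x\<in>(\<lambda>t. (z t)\<^sup>2) ` {0..1}. norm x \<le> B"
      unfolding bounded_pos by blast
    then show ?thesis by (intro that[of B]) auto
  qed
  have "(\<lambda>n. (\<Sum>k<n. discrete_potential n k * (z (k / n))\<^sup>2) / n) \<longlonglongrightarrow> integral {0..1} (\<lambda>t. potential t * (z t)\<^sup>2)"
  proof (rule riemann_sum_array_tendsto)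
    show "continuous_on {0..1} (\<lambda>t. potential t * (z t)\<^sup>2)"
      by (intro continuous_intros cont_potential z)
    fix \<epsilon> :: real assume "\<epsilon> > 0"
    hence "\<epsilon> / B > 0" using B by simp
    from discrete_potential_uniform[OF this]
    show "\<forall>\<^sub>F n in sequentially. \<forall>k<n. \<bar>discrete_potential n k * (z (k / n))\<^sup>2 - potential (k / n) * (z (k / n))\<^sup>2\<bar> \<le> \<epsilon>"
    proof eventually_elim
      fix n :: nat
      assume n: "\<forall>k. 0 < k \<and> k < n \<longrightarrow> \<bar>discrete_potential n k - potential (k / n)\<bar> \<le> \<epsilon> / B"
      show "\<forall>k<n. \<bar>discrete_potential n k * (z (k / n))\<^sup>2 - potential (k / n) * (z (k / n))\<^sup>2\<bar> \<le> \<epsilon>"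
      proof (intro allI impI)
        fix k assume k: "k < n"
        show "\<bar>discrete_potential n k * (z (k / n))\<^sup>2 - potential (k / n) * (z (k / n))\<^sup>2\<bar> \<le> \<epsilon>"
        \<comment> \<open>At \<open>k = 0\<close>, where the potentials are not close, both products
          vanish because \<open>z 0 = 0\<close>.\<close>
        proof (cases "k = 0")
          case False
          have "\<bar>discrete_potential n k * (z (k / n))\<^sup>2 - potential (k / n) * (z (k / n))\<^sup>2\<bar>
              = \<bar>discrete_potential n k - potential (k / n)\<bar> * (z (k / n))\<^sup>2"
            by (simp add: left_diff_distrib[symmetric] abs_mult)
          also have "\<dots> \<le> \<epsilon> / B * B"
            using n k False \<open>\<epsilon> / B > 0\<close> by (intro mult_mono B) auto
          finally show ?thesis using B by simp
        qed (use z \<open>\<epsilon> > 0\<close> in simp)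
      qed
    qed
  qed
  note * = this
  have "(\<lambda>n. discrete_slope n / 2 * (z 1)\<^sup>2 - (\<Sum>k<n. discrete_potential n k * (z (k / n))\<^sup>2) / n / 2)
      \<longlonglongrightarrow> f' 1 / f 1 / 2 * (z 1)\<^sup>2 - integral {0..1} (\<lambda>t. potential t * (z t)\<^sup>2) / 2"
    by (intro tendsto_intros discrete_slope_tendsto * ) auto
  then show ?thesis
  proof (rule Lim_transform_eventually)
    show "\<forall>\<^sub>F n in sequentially. discrete_slope n / 2 * (z 1)\<^sup>2 - (\<Sum>k<n. discrete_potential n k * (z (k / n))\<^sup>2) / n / 2
        = quad (\<lambda>k. f (k / n)) (1 / n) n (\<lambda>k. z (k / n))"
      using eventually_gt_at_top[of 0] by eventually_elim (simp add: quad_eq)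
  qed
qed

end

section \<open>Passage from the grid to continuous time\<close>

lemma (in prob_space) nn_integral_limit_le:
  fixes Y :: "nat \<Rightarrow> 'a \<Rightarrow> real"
  assumes meas: "\<And>n. Y n \<in> borel_measurable M"
    and lim: "AE \<omega> in M. (\<lambda>n. Y n \<omega>) \<longlonglongrightarrow> Y' \<omega>"
    and int: "\<And>n. (\<integral>\<^sup>+\<omega>. ennreal (Y n \<omega>) \<partial>M) = ennreal c"
  shows "(\<integral>\<^sup>+\<omega>. ennreal (Y' \<omega>) \<partial>M) \<le> ennreal c"
proof -
  \<comment> \<open>\<open>Y'\<close> is not assumed measurable, so Fatou's lemma is applied to the
    \<open>liminf\<close>, which agrees with it almost everywhere.\<close>
  have "(\<integral>\<^sup>+\<omega>. ennreal (Y' \<omega>) \<partial>M) = (\<integral>\<^sup>+\<omega>. liminf (\<lambda>n. ennreal (Y n \<omega>)) \<partial>M)"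
  proof (rule nn_integral_cong_AE)
    show "AE \<omega> in M. ennreal (Y' \<omega>) = liminf (\<lambda>n. ennreal (Y n \<omega>))"
      using lim
    proof eventually_elim
      fix \<omega> assume "(\<lambda>n. Y n \<omega>) \<longlonglongrightarrow> Y' \<omega>"
      hence "(\<lambda>n. ennreal (Y n \<omega>)) \<longlonglongrightarrow> ennreal (Y' \<omega>)" by (rule tendsto_ennrealI)
      then show "ennreal (Y' \<omega>) = liminf (\<lambda>n. ennreal (Y n \<omega>))"
        by (simp add: lim_imp_Liminf)
    qed
  qed
  also have "\<dots> \<le> liminf (\<lambda>n. \<integral>\<^sup>+\<omega>. ennreal (Y n \<omega>) \<partial>M)"
    by (rule nn_integral_liminf) (use meas in simp)
  also have "\<dots> = ennreal c" by (simp add: int Liminf_const)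
  finally show ?thesis .
qed

text \<open>Boundedness in \<open>L\<^sup>2\<close> replaces a dominating function.\<close>

lemma (in prob_space) nn_integral_limit_eq:
  fixes Y :: "nat \<Rightarrow> 'a \<Rightarrow> real"
  assumes meas: "\<And>n. Y n \<in> borel_measurable M" and nonneg: "\<And>n \<omega>. Y n \<omega> \<ge> 0"
    and lim: "AE \<omega> in M. (\<lambda>n. Y n \<omega>) \<longlonglongrightarrow> Y' \<omega>"
    and int: "\<And>n. (\<integral>\<^sup>+\<omega>. ennreal (Y n \<omega>) \<partial>M) = ennreal c"
    and c: "c \<ge> 0" and C: "C \<ge> 0"
    and sq: "\<forall>\<^sub>F n in sequentially. (\<integral>\<^sup>+\<omega>. ennreal ((Y n \<omega>)\<^sup>2) \<partial>M) \<le> ennreal C"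
  shows "(\<integral>\<^sup>+\<omega>. ennreal (Y' \<omega>) \<partial>M) = ennreal c"
proof (rule antisym)
  show "(\<integral>\<^sup>+\<omega>. ennreal (Y' \<omega>) \<partial>M) \<le> ennreal c"
    by (rule nn_integral_limit_le[OF meas lim int])
  \<comment> \<open>A measurable version of \<open>Y'\<close>, to which dominated convergence
    applies after truncation.\<close>
  define L where "L \<omega> = lim (\<lambda>n. Y n \<omega>)" for \<omega>
  have L_meas [measurable]: "L \<in> borel_measurable M"
    unfolding L_def[abs_def] using meas by (intro borel_measurable_lim_metric) auto
  have L_lim: "AE \<omega> in M. (\<lambda>n. Y n \<omega>) \<longlonglongrightarrow> L \<omega>" and L_eq: "AE \<omega> in M. Y' \<omega> = L \<omega>"
    using lim by (eventually_elim, simp add: L_def limI)+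
  have trunc: "ennreal c \<le> (\<integral>\<^sup>+\<omega>. ennreal (L \<omega>) \<partial>M) + ennreal (C / K)" if K: "K > 0" for K :: real
  proof -
    have "(\<lambda>n. \<integral>\<^sup>+\<omega>. ennreal (min (Y n \<omega>) K) \<partial>M) \<longlonglongrightarrow> (\<integral>\<^sup>+\<omega>. ennreal (min (L \<omega>) K) \<partial>M)"
    proof (rule nn_integral_dominated_convergence[where w = "\<lambda>_. ennreal K"])
      show "AE \<omega> in M. (\<lambda>n. ennreal (min (Y n \<omega>) K)) \<longlonglongrightarrow> ennreal (min (L \<omega>) K)"
        using L_lim by eventually_elim (intro tendsto_ennrealI tendsto_min tendsto_const)
    qed (use meas in \<open>auto intro!: ennreal_leI simp: emeasure_space_1\<close>)
    hence lim': "(\<lambda>n. (\<integral>\<^sup>+\<omega>. ennreal (min (Y n \<omega>) K) \<partial>M) + ennreal (C / K))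
        \<longlonglongrightarrow> (\<integral>\<^sup>+\<omega>. ennreal (min (L \<omega>) K) \<partial>M) + ennreal (C / K)"
      by (intro tendsto_add tendsto_const)
    have "ennreal c \<le> (\<integral>\<^sup>+\<omega>. ennreal (min (L \<omega>) K) \<partial>M) + ennreal (C / K)"
    proof (rule tendsto_lowerbound[OF lim'])
      show "\<forall>\<^sub>F n in sequentially. ennreal c \<le> (\<integral>\<^sup>+\<omega>. ennreal (min (Y n \<omega>) K) \<partial>M) + ennreal (C / K)"
        using sq
      proof eventually_elim
        fix n assume sq: "(\<integral>\<^sup>+\<omega>. ennreal ((Y n \<omega>)\<^sup>2) \<partial>M) \<le> ennreal C"
        \<comment> \<open>Truncation at \<open>K\<close> costs at most \<open>y\<^sup>2 / K\<close>,
          since \<open>y \<le> y\<^sup>2 / K\<close> beyond \<open>K\<close>. Second moments bounded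
          by \<open>C\<close> thus leave an error \<open>C / K\<close>, which is made small by a
          large \<open>K\<close>.\<close>
        have le: "y \<le> min y K + inverse K * y\<^sup>2" if "y \<ge> 0" for y
        proof (cases "y \<le> K")
          case False
          hence "y * K \<le> y * y" using that by (intro mult_left_mono) auto
          then show ?thesis using K False by (simp add: field_simps power2_eq_square add_increasing)
        qed (use K in simp)
        have "ennreal c = (\<integral>\<^sup>+\<omega>. ennreal (Y n \<omega>) \<partial>M)" by (simp add: int)
        also have "\<dots> \<le> (\<integral>\<^sup>+\<omega>. ennreal (min (Y n \<omega>) K) + ennreal (inverse K) * ennreal ((Y n \<omega>)\<^sup>2) \<partial>M)"
        proof (rule nn_integral_mono)
          fix \<omega>
          have "ennreal (Y n \<omega>) \<le> ennreal (min (Y n \<omega>) K + inverse K * (Y n \<omega>)\<^sup>2)"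
            by (intro ennreal_leI le nonneg)
          also have "\<dots> = ennreal (min (Y n \<omega>) K) + ennreal (inverse K) * ennreal ((Y n \<omega>)\<^sup>2)"
            using nonneg K by (subst ennreal_plus) (auto simp: ennreal_mult)
          finally show "ennreal (Y n \<omega>) \<le> ennreal (min (Y n \<omega>) K) + ennreal (inverse K) * ennreal ((Y n \<omega>)\<^sup>2)" .
        qed
        also have "\<dots> = (\<integral>\<^sup>+\<omega>. ennreal (min (Y n \<omega>) K) \<partial>M) + ennreal (inverse K) * (\<integral>\<^sup>+\<omega>. ennreal ((Y n \<omega>)\<^sup>2) \<partial>M)"
          using meas by (subst nn_integral_add) (auto simp: nn_integral_cmult)
        also have "\<dots> \<le> (\<integral>\<^sup>+\<omega>. ennreal (min (Y n \<omega>) K) \<partial>M) + ennreal (inverse K) * ennreal C"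
          by (intro add_left_mono mult_left_mono sq) simp
        also have "ennreal (inverse K) * ennreal C = ennreal (C / K)"
          using K C by (subst ennreal_mult[symmetric]) (auto simp: field_simps)
        finally show "ennreal c \<le> (\<integral>\<^sup>+\<omega>. ennreal (min (Y n \<omega>) K) \<partial>M) + ennreal (C / K)" .
      qed
    qed simp
    also have "\<dots> \<le> (\<integral>\<^sup>+\<omega>. ennreal (L \<omega>) \<partial>M) + ennreal (C / K)"
      by (intro add_right_mono nn_integral_mono ennreal_leI) simp
    finally show ?thesis .
  qed
  have "ennreal c \<le> (\<integral>\<^sup>+\<omega>. ennreal (L \<omega>) \<partial>M)"
  proof (rule ennreal_le_epsilon)
    fix e :: real assume e: "0 < e"
    have "ennreal c \<le> (\<integral>\<^sup>+\<omega>. ennreal (L \<omega>) \<partial>M) + ennreal (C / ((C + 1) / e))"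
      using C e by (intro trunc) auto
    also have "\<dots> \<le> (\<integral>\<^sup>+\<omega>. ennreal (L \<omega>) \<partial>M) + ennreal e"
      using C e by (intro add_left_mono ennreal_leI) (auto simp: field_simps)
    finally show "ennreal c \<le> (\<integral>\<^sup>+\<omega>. ennreal (L \<omega>) \<partial>M) + ennreal e" .
  qed
  also have "\<dots> = (\<integral>\<^sup>+\<omega>. ennreal (Y' \<omega>) \<partial>M)"
    using L_eq by (intro nn_integral_cong_AE) auto
  finally show "ennreal c \<le> (\<integral>\<^sup>+\<omega>. ennreal (Y' \<omega>) \<partial>M)" .
qed

lemma positive_C2_exp: "positive_C2 (\<lambda>t. exp (b * t)) (\<lambda>t. b * exp (b * t)) (\<lambda>t. b\<^sup>2 * exp (b * t))"
  by unfold_locales (auto intro!: derivative_eq_intros continuous_intros simp: power2_eq_square)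

locale brownian_potential = standard_brownian_motion M W + positive_C2 f f' f''
  for M :: "'a measure" and W and f f' f'' :: "real \<Rightarrow> real" +
  fixes u :: real
  assumes u: "u < 1"
begin

abbreviation "Z \<equiv> W_sub u W"
abbreviation "\<kappa> \<equiv> 1 / (1 - u)\<^sup>2 - 1"

definition gibbs :: "nat \<Rightarrow> 'a \<Rightarrow> real" where
  "gibbs n \<omega> = (1 - u) * exp (\<kappa> / 2 * (Z 1 \<omega>)\<^sup>2 + quad (\<lambda>k. f (k / n)) (1 / n) n (\<lambda>k. Z (k / n) \<omega>))"

definition gibbs_limit :: "'a \<Rightarrow> real" where
  "gibbs_limit \<omega> = (1 - u) * exp ((\<kappa> + f' 1 / f 1) / 2 * (Z 1 \<omega>)\<^sup>2
     - integral {0..1} (\<lambda>t. potential t * (Z t \<omega>)\<^sup>2) / 2)"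

lemma gibbs_nonneg: "gibbs n \<omega> \<ge> 0"
  using u by (simp add: gibbs_def)

lemma gibbs_measurable: "n > 0 \<Longrightarrow> gibbs n \<in> borel_measurable M"
proof -
  assume n: "n > 0"
  have [measurable]: "Z (k / n) \<in> borel_measurable M" if "k \<le> n" for k
    using that n by (intro W_sub_measurable) auto
  have [measurable]: "Z 1 \<in> borel_measurable M" by (rule W_sub_measurable) simp
  show "gibbs n \<in> borel_measurable M"
    unfolding gibbs_def[abs_def] quad_def by (intro borel_measurable_times borel_measurable_const
      borel_measurable_exp borel_measurable_add borel_measurable_diff borel_measurable_sum borel_measurable_power) auto
qed

lemma nn_integral_gibbs:
  assumes n: "n > 0"
  shows "(\<integral>\<^sup>+\<omega>. ennreal (gibbs n \<omega>) \<partial>M) = ennreal (sqrt (f 1 / f 0))"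
proof -
  \<comment> \<open>The telescoping formula asks for positivity at every index, but \<open>f\<close>
    is known to be positive on the unit interval only. The constant continuation beyond
    \<open>n\<close> is harmless, since \<open>quad\<close> reads no index above
    \<open>n\<close>.\<close>
  define g where "g k = f (min k n / n)" for k :: nat
  have g: "g k > 0" for k unfolding g_def using n by (intro f_pos) auto
  have "quad (\<lambda>k. f (k / n)) (1 / n) n z = quad g (1 / n) n z" for z
    unfolding quad_def g_def by (intro arg_cong2[where f="(-)"] sum.cong) (auto simp: min_def)
  hence "(\<integral>\<^sup>+\<omega>. ennreal (gibbs n \<omega>) \<partial>M) = ennreal (sqrt (g n / g 0))"
    unfolding gibbs_def using nn_integral_exp_quad_W_sub[OF u n g] by simp
  then show ?thesis using n by (simp add: g_def)
qed

lemma gibbs_tendsto: "AE \<omega> in M. (\<lambda>n. gibbs n \<omega>) \<longlonglongrightarrow> gibbs_limit \<omega>"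
  using start_zero continuous_paths
proof eventually_elim
  fix \<omega> assume W: "W 0 \<omega> = 0" "continuous_on {0..1} (\<lambda>t. W t \<omega>)"
  have z: "continuous_on {0..1} (\<lambda>t. Z t \<omega>)" "Z 0 \<omega> = 0"
    unfolding W_sub_def using W by (auto intro!: continuous_intros)
  have "(\<lambda>n. gibbs n \<omega>) \<longlonglongrightarrow> (1 - u) * exp (\<kappa> / 2 * (Z 1 \<omega>)\<^sup>2 +
      (f' 1 / f 1 / 2 * (Z 1 \<omega>)\<^sup>2 - integral {0..1} (\<lambda>t. potential t * (Z t \<omega>)\<^sup>2) / 2))"
    unfolding gibbs_def using quad_tendsto[OF z] by (intro tendsto_intros) auto
  also have "\<kappa> / 2 * (Z 1 \<omega>)\<^sup>2 + (f' 1 / f 1 / 2 * (Z 1 \<omega>)\<^sup>2 - integral {0..1} (\<lambda>t. potential t * (Z t \<omega>)\<^sup>2) / 2)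
      = (\<kappa> + f' 1 / f 1) / 2 * (Z 1 \<omega>)\<^sup>2 - integral {0..1} (\<lambda>t. potential t * (Z t \<omega>)\<^sup>2) / 2"
    by (simp add: distrib_right add_divide_distrib)
  finally show "(\<lambda>n. gibbs n \<omega>) \<longlonglongrightarrow> gibbs_limit \<omega>" unfolding gibbs_limit_def .
qed

text \<open>The limit lemmas want their hypotheses at every index, whereas \<open>gibbs n\<close> is
  treated for \<open>n > 0\<close> only.\<close>

lemma gibbs_tendsto_Suc: "AE \<omega> in M. (\<lambda>n. gibbs (Suc n) \<omega>) \<longlonglongrightarrow> gibbs_limit \<omega>"
  using gibbs_tendsto by eventually_elim (rule LIMSEQ_Suc)

lemma nn_integral_gibbs_limit_le: "(\<integral>\<^sup>+\<omega>. ennreal (gibbs_limit \<omega>) \<partial>M) \<le> ennreal (sqrt (f 1 / f 0))"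
  by (rule nn_integral_limit_le[OF _ gibbs_tendsto_Suc]) (auto intro: gibbs_measurable nn_integral_gibbs)

text \<open>The square of \<open>gibbs\<close> is compared with the exponential sequence \<open>exp (b t)\<close>, for
  which the discrete formula is available as well.\<close>

lemma nn_integral_gibbs_limit_eq:
  assumes b: "b > 2 * \<bar>f' 1 / f 1\<bar> + \<bar>\<kappa>\<bar>"
    and V: "\<And>t. t \<in> {0..1} \<Longrightarrow> potential t \<ge> b\<^sup>2"
  shows "(\<integral>\<^sup>+\<omega>. ennreal (gibbs_limit \<omega>) \<partial>M) = ennreal (sqrt (f 1 / f 0))"
proof -
  interpret E: brownian_potential M W "\<lambda>t. exp (b * t)" "\<lambda>t. b * exp (b * t)" "\<lambda>t. b\<^sup>2 * exp (b * t)" u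
    using positive_C2_exp[of b] u standard_brownian_motion_axioms
    by (simp add: brownian_potential_def brownian_potential_axioms_def)
  have b0: "b > 0" using b by linarith
  have E_pot: "E.potential t = b\<^sup>2" for t by (simp add: E.potential_def)
  have "(\<lambda>n. E.discrete_slope n / 2 - discrete_slope n) \<longlonglongrightarrow> b * exp (b * 1) / exp (b * 1) / 2 - f' 1 / f 1"
    by (intro tendsto_intros E.discrete_slope_tendsto discrete_slope_tendsto) auto
  \<comment> \<open>Squaring doubles the coefficient of \<open>Z(1)\<^sup>2\<close>. The comparison
    needs \<open>2 * (\<kappa> + f' 1 / f 1) < \<kappa> + b\<close>, which the lower bound on
    \<open>b\<close> provides.\<close>
  moreover have "\<kappa> / 2 < b * exp (b * 1) / exp (b * 1) / 2 - f' 1 / f 1"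
  proof -
    have "b * exp (b * 1) / exp (b * 1) / 2 = b / 2" by simp
    moreover have "k / 2 < b / 2 - y" if "b > 2 * \<bar>y\<bar> + \<bar>k\<bar>" for k y :: real
      using that by linarith
    ultimately show ?thesis using b by (simp only:)
  qed
  ultimately have ev1: "\<forall>\<^sub>F n in sequentially. \<kappa> / 2 < E.discrete_slope n / 2 - discrete_slope n"
    by (rule order_tendstoD(1))
  \<comment> \<open>With this tolerance the discretised potential is at least
    \<open>3 / 4 * b\<^sup>2\<close>, and half the discretised potential of the exponential is at
    most \<open>5 / 8 * b\<^sup>2\<close>, so the doubled sum in the squared density still
    dominates.\<close>
  have "b\<^sup>2 / 4 > 0" using b0 by simp
  note ev2 = discrete_potential_uniform[OF this] E.discrete_potential_uniform[OF this]
  have ev: "\<forall>\<^sub>F n in sequentially. (\<integral>\<^sup>+\<omega>. ennreal ((gibbs n \<omega>)\<^sup>2) \<partial>M) \<le> ennreal ((1 - u) * sqrt (exp b))"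
    using ev1 ev2 eventually_gt_at_top[of 0]
  proof eventually_elim
    fix n :: nat
    assume n: "0 < n" and slope: "\<kappa> / 2 < E.discrete_slope n / 2 - discrete_slope n"
      and p: "\<forall>k. 0 < k \<and> k < n \<longrightarrow> \<bar>discrete_potential n k - potential (k / n)\<bar> \<le> b\<^sup>2 / 4"
      and Ep: "\<forall>k. 0 < k \<and> k < n \<longrightarrow> \<bar>E.discrete_potential n k - E.potential (k / n)\<bar> \<le> b\<^sup>2 / 4"
    have "AE \<omega> in M. (gibbs n \<omega>)\<^sup>2 \<le> (1 - u) * E.gibbs n \<omega>"
      using start_zero
    proof eventually_elim
      fix \<omega> assume "W 0 \<omega> = 0"
      hence Z0: "Z 0 \<omega> = 0" by (simp add: W_sub_def)
      let ?S = "\<Sum>k<n. discrete_potential n k * (Z (k / n) \<omega>)\<^sup>2"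
      let ?ES = "\<Sum>k<n. E.discrete_potential n k * (Z (k / n) \<omega>)\<^sup>2"
      have "?ES / 2 = (\<Sum>k<n. E.discrete_potential n k / 2 * (Z (k / n) \<omega>)\<^sup>2)"
        by (simp add: sum_divide_distrib)
      also have "\<dots> \<le> ?S"
      proof (rule sum_mono)
        fix k assume k: "k \<in> {..<n}"
        show "E.discrete_potential n k / 2 * (Z (k / n) \<omega>)\<^sup>2 \<le> discrete_potential n k * (Z (k / n) \<omega>)\<^sup>2"
        proof (cases "k = 0")
          case False
          have "real k / n \<in> {0..1}" using k by auto
          from V[OF this] have "b\<^sup>2 \<le> potential (k / n)" .
          moreover have "\<bar>discrete_potential n k - potential (k / n)\<bar> \<le> b\<^sup>2 / 4"
            "\<bar>E.discrete_potential n k - b\<^sup>2\<bar> \<le> b\<^sup>2 / 4"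
            using p Ep False k unfolding E_pot by auto
          moreover have "e / 2 \<le> d" if "B \<le> v" "\<bar>d - v\<bar> \<le> B / 4" "\<bar>e - B\<bar> \<le> B / 4" "0 \<le> B" for d e v B :: real
            using that by linarith
          ultimately have "E.discrete_potential n k / 2 \<le> discrete_potential n k"
            by (meson zero_le_power2)
          then show ?thesis by (rule mult_right_mono) simp
        qed (use Z0 in simp)
      qed
      finally have "?ES / 2 / n \<le> ?S / n" by (rule divide_right_mono) simp
      moreover have "(\<kappa> + discrete_slope n) * (Z 1 \<omega>)\<^sup>2 \<le> (\<kappa> / 2 + E.discrete_slope n / 2) * (Z 1 \<omega>)\<^sup>2"
      proof (rule mult_right_mono)
        have "k + d \<le> k / 2 + e / 2" if "k / 2 < e / 2 - d" for k d e :: real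
          using that by linarith
        then show "\<kappa> + discrete_slope n \<le> \<kappa> / 2 + E.discrete_slope n / 2" using slope .
      qed simp
      moreover have "2 * (k / 2 * y + (d / 2 * y - S / N / 2)) \<le> k / 2 * y + (e / 2 * y - T / N / 2)"
        if "T / 2 / N \<le> S / N" "(k + d) * y \<le> (k / 2 + e / 2) * y" for k d e y S T N :: real
        using that by (simp add: algebra_simps)
      ultimately have "2 * (\<kappa> / 2 * (Z 1 \<omega>)\<^sup>2 + (discrete_slope n / 2 * (Z 1 \<omega>)\<^sup>2 - ?S / n / 2))
          \<le> \<kappa> / 2 * (Z 1 \<omega>)\<^sup>2 + (E.discrete_slope n / 2 * (Z 1 \<omega>)\<^sup>2 - ?ES / n / 2)"
        by blast
      hence "exp (\<kappa> / 2 * (Z 1 \<omega>)\<^sup>2 + (discrete_slope n / 2 * (Z 1 \<omega>)\<^sup>2 - ?S / n / 2)) ^ 2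
          \<le> exp (\<kappa> / 2 * (Z 1 \<omega>)\<^sup>2 + (E.discrete_slope n / 2 * (Z 1 \<omega>)\<^sup>2 - ?ES / n / 2))"
        unfolding exp_double[symmetric] by simp
      then show "(gibbs n \<omega>)\<^sup>2 \<le> (1 - u) * E.gibbs n \<omega>"
        unfolding gibbs_def E.gibbs_def quad_eq[OF n, of "\<lambda>t. Z t \<omega>"] E.quad_eq[OF n, of "\<lambda>t. Z t \<omega>"] power_mult_distrib
        using u by (simp add: power2_eq_square mult.assoc)
    qed
    hence "(\<integral>\<^sup>+\<omega>. ennreal ((gibbs n \<omega>)\<^sup>2) \<partial>M) \<le> (\<integral>\<^sup>+\<omega>. ennreal (1 - u) * ennreal (E.gibbs n \<omega>) \<partial>M)"
      using u E.gibbs_nonneg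
      by (intro nn_integral_mono_AE) (auto elim!: eventually_mono intro!: ennreal_leI simp: ennreal_mult[symmetric])
    also have "\<dots> = ennreal (1 - u) * ennreal (sqrt (exp (b * 1) / exp (b * 0)))"
      using E.gibbs_measurable[OF n] E.nn_integral_gibbs[OF n] by (subst nn_integral_cmult) auto
    also have "\<dots> = ennreal ((1 - u) * sqrt (exp b))"
      using u by (subst ennreal_mult[symmetric]) auto
    finally show "(\<integral>\<^sup>+\<omega>. ennreal ((gibbs n \<omega>)\<^sup>2) \<partial>M) \<le> ennreal ((1 - u) * sqrt (exp b))" .
  qed
  show ?thesis
  proof (rule nn_integral_limit_eq[OF _ _ gibbs_tendsto_Suc])
    show "\<forall>\<^sub>F n in sequentially. (\<integral>\<^sup>+\<omega>. ennreal ((gibbs (Suc n) \<omega>)\<^sup>2) \<partial>M) \<le> ennreal ((1 - u) * sqrt (exp b))"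
      using ev by (subst eventually_sequentially_Suc)
    show "0 \<le> sqrt (f 1 / f 0)" using f_pos[of 0] f_pos[of 1] by auto
  qed (use u in \<open>auto intro: gibbs_measurable nn_integral_gibbs gibbs_nonneg\<close>)
qed

end

section \<open>Liouville--Green functions and the small ball asymptotics\<close>

text \<open>The resulting potential is \<open>f'' / f + s\<^sup>2 / f ^ 4\<close>: a bounded term plus a multiple of the weight.\<close>

lemma (in positive_C2) liouville_green:
  assumes x: "\<And>t. t \<in> {0..1} \<Longrightarrow> (x has_real_derivative 1 / (f t)\<^sup>2) (at t within {0..1})"
  shows "positive_C2 (\<lambda>t. f t * cosh (s * x t + c))
    (\<lambda>t. f' t * cosh (s * x t + c) + s / f t * sinh (s * x t + c))
    (\<lambda>t. (f'' t + s\<^sup>2 / f t ^ 3) * cosh (s * x t + c))"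
proof
  fix t :: real assume t: "t \<in> {0..1}"
  have ft: "f t > 0" by (rule f_pos[OF t])
  show "((\<lambda>t. f t * cosh (s * x t + c)) has_real_derivative
      f' t * cosh (s * x t + c) + s / f t * sinh (s * x t + c)) (at t within {0..1})"
    using ft by (auto intro!: derivative_eq_intros deriv1[OF t] x[OF t] simp: field_simps power2_eq_square)
  \<comment> \<open>The terms \<open>s * f' t / (f t)\<^sup>2 * sinh (s * x t + c)\<close> cancel;
    this is what \<open>x' = 1 / f\<^sup>2\<close> is chosen for.\<close>
  show "((\<lambda>t. f' t * cosh (s * x t + c) + s / f t * sinh (s * x t + c)) has_real_derivative
      (f'' t + s\<^sup>2 / f t ^ 3) * cosh (s * x t + c)) (at t within {0..1})"
    using ft by (auto intro!: derivative_eq_intros deriv1[OF t] deriv2[OF t] x[OF t] simp: field_simps eval_nat_numeral)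
  show "f t * cosh (s * x t + c) > 0" using ft by (simp add: cosh_real_pos)
next
  have "continuous_on {0..1} x" by (rule DERIV_continuous_on[OF x])
  moreover have "f t ^ 3 \<noteq> 0" if "t \<in> {0..1}" for t using f_pos[OF that] by simp
  ultimately show "continuous_on {0..1} (\<lambda>t. (f'' t + s\<^sup>2 / f t ^ 3) * cosh (s * x t + c))"
    using cont0 cont2 by (intro continuous_intros) auto
qed

section \<open>Measurable versions and the small ball event\<close>

lemma (in standard_brownian_motion) integral_measurable_version:
  assumes h: "continuous_on {0..1} h"
  obtains X where "X \<in> borel_measurable M"
    "AE \<omega> in M. X \<omega> = integral {0..1} (\<lambda>t. h t * (W_sub u W t \<omega>)\<^sup>2)"
proof
  \<comment> \<open>Paths are continuous only almost surely, so the integral itself need not be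
    measurable in \<open>\<omega>\<close>. The limit of Riemann sums is, and it agrees with the
    integral on continuous paths.\<close>
  let ?R = "\<lambda>(n::nat) \<omega>. (\<Sum>k<n. h (real k / n) * (W_sub u W (real k / n) \<omega>)\<^sup>2) / n"
  have m: "W_sub u W (k / n) \<in> borel_measurable M" if "k < n" for k n :: nat
    using that by (intro W_sub_measurable) auto
  have R: "?R n \<in> borel_measurable M" for n
    by (intro borel_measurable_divide borel_measurable_sum borel_measurable_times borel_measurable_power m) auto
  show "(\<lambda>\<omega>. lim (\<lambda>n. ?R n \<omega>)) \<in> borel_measurable M"
    by (rule borel_measurable_lim_metric) (rule R)
  show "AE \<omega> in M. lim (\<lambda>n. ?R n \<omega>) = integral {0..1} (\<lambda>t. h t * (W_sub u W t \<omega>)\<^sup>2)"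
    using continuous_paths
  proof eventually_elim
    fix \<omega> assume W: "continuous_on {0..1} (\<lambda>t. W t \<omega>)"
    have z: "continuous_on {0..1} (\<lambda>t. W_sub u W t \<omega>)"
      unfolding W_sub_def using W by (auto intro!: continuous_intros)
    have "(\<lambda>n. ?R n \<omega>) \<longlonglongrightarrow> integral {0..1} (\<lambda>t. h t * (W_sub u W t \<omega>)\<^sup>2)"
      by (rule riemann_sum_array_tendsto) (auto intro!: continuous_intros h z)
    then show "lim (\<lambda>n. ?R n \<omega>) = integral {0..1} (\<lambda>t. h t * (W_sub u W t \<omega>)\<^sup>2)" by (rule limI)
  qed
qed

text \<open>The event agrees almost everywhere with a measurable one, hence belongs to the
  completion and has the same probability.\<close>

lemma (in standard_brownian_motion) small_ball_prob_eq:
  assumes \<psi>: "continuous_on {0..1} \<psi>" and \<epsilon>: "\<epsilon> > 0"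
    and X: "X \<in> borel_measurable M" "AE \<omega> in M. X \<omega> = integral {0..1} (\<lambda>t. \<psi> t * (W_sub u W t \<omega>)\<^sup>2)"
  shows "small_ball_prob M \<psi> (W_sub u W) \<epsilon> = prob {\<omega> \<in> space M. X \<omega> \<le> \<epsilon>\<^sup>2}"
proof -
  let ?A = "{\<omega> \<in> space M. weighted_norm \<psi> (\<lambda>t. W_sub u W t \<omega>) \<le> \<epsilon>}" and ?B = "{\<omega> \<in> space M. X \<omega> \<le> \<epsilon>\<^sup>2}"
  have B: "?B \<in> sets M" using X by measurable
  have "AE \<omega> in M. \<omega> \<in> ?B \<longleftrightarrow> \<omega> \<in> ?A"
    using X(2) continuous_paths
  proof eventually_elim
    fix \<omega> assume X: "X \<omega> = integral {0..1} (\<lambda>t. \<psi> t * (W_sub u W t \<omega>)\<^sup>2)" and W: "continuous_on {0..1} (\<lambda>t. W t \<omega>)"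
    have "continuous_on {0..1} (\<lambda>t. (W_sub u W t \<omega>)\<^sup>2 * \<psi> t)"
      unfolding W_sub_def using W \<psi> by (auto intro!: continuous_intros)
    hence "weighted_norm \<psi> (\<lambda>t. W_sub u W t \<omega>) = sqrt (X \<omega>)"
      unfolding weighted_norm_def X
      by (subst set_borel_integral_eq_integral) (auto intro!: borel_integrable_atLeastAtMost' simp: mult.commute)
    moreover have "sqrt (X \<omega>) \<le> \<epsilon> \<longleftrightarrow> X \<omega> \<le> \<epsilon>\<^sup>2"
      using \<epsilon> by (metis less_imp_le real_sqrt_le_iff real_sqrt_unique)
    ultimately show "\<omega> \<in> ?B \<longleftrightarrow> \<omega> \<in> ?A" by auto
  qed
  hence AE: "AE \<omega> in completion M. \<omega> \<in> ?B \<longleftrightarrow> \<omega> \<in> ?A" by (rule AE_completion)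
  have Bc: "?B \<in> sets (completion M)" using B by (rule sets_completionI_sets)
  have Ac: "?A \<in> sets (completion M)" by (rule completion.in_sets_AE[OF AE Bc]) auto
  have "measure (completion M) ?A = measure (completion M) ?B"
    using AE Ac Bc by (intro measure_eq_AE) auto
  also have "\<dots> = prob ?B" using B by simp
  finally show ?thesis unfolding small_ball_prob_def .
qed

lemma twice_differentiable_powr:
  assumes \<psi>: "\<And>t. t \<in> {0..1} \<Longrightarrow> \<psi> t > (0::real)"
    and "twice_continuously_differentiable_on \<psi> {0..1}"
  obtains a' a'' where "positive_C2 (\<lambda>t. \<psi> t powr (- 1 / 4)) a' a''"
proof -
  obtain p p' where p: "\<And>t. t \<in> {0..1} \<Longrightarrow> (\<psi> has_real_derivative p t) (at t within {0..1})"
    "\<And>t. t \<in> {0..1} \<Longrightarrow> (p has_real_derivative p' t) (at t within {0..1})" "continuous_on {0..1} p'"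
    using assms(2) unfolding twice_continuously_differentiable_on_def by blast
  have c1: "continuous_on {0..1} \<psi>" by (rule DERIV_continuous_on[OF p(1)])
  have c2: "continuous_on {0..1} p" by (rule DERIV_continuous_on[OF p(2)])
  have d: "((\<lambda>t. \<psi> t powr r) has_real_derivative r * \<psi> t powr (r - 1) * p t) (at t within {0..1})"
    if "t \<in> {0..1}" for t r
    using \<psi>[OF that] by (auto intro!: derivative_eq_intros p that)
  have "positive_C2 (\<lambda>t. \<psi> t powr (- 1 / 4)) (\<lambda>t. (- 1 / 4) * \<psi> t powr (- 1 / 4 - 1) * p t)
     (\<lambda>t. (- 1 / 4) * ((- 1 / 4 - 1) * \<psi> t powr (- 1 / 4 - 1 - 1) * p t) * p t + (- 1 / 4) * \<psi> t powr (- 1 / 4 - 1) * p' t)"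
  proof
    fix t :: real assume t: "t \<in> {0..1}"
    show "((\<lambda>t. \<psi> t powr (- 1 / 4)) has_real_derivative (- 1 / 4) * \<psi> t powr (- 1 / 4 - 1) * p t) (at t within {0..1})"
      by (rule d[OF t])
    show "((\<lambda>t. (- 1 / 4) * \<psi> t powr (- 1 / 4 - 1) * p t) has_real_derivative
      (- 1 / 4) * ((- 1 / 4 - 1) * \<psi> t powr (- 1 / 4 - 1 - 1) * p t) * p t + (- 1 / 4) * \<psi> t powr (- 1 / 4 - 1) * p' t) (at t within {0..1})"
      using DERIV_mult[OF DERIV_cmult[OF d[OF t, of "- 1 / 4 - 1"], of "- 1 / 4"] p(2)[OF t]] by (simp add: algebra_simps)
    show "\<psi> t powr (- 1 / 4) > 0" using \<psi>[OF t] by simp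
  next
    have "\<And>t. t \<in> {0..1} \<Longrightarrow> \<psi> t \<noteq> 0" using \<psi> by force
    then show "continuous_on {0..1} (\<lambda>t. (- 1 / 4) * ((- 1 / 4 - 1) * \<psi> t powr (- 1 / 4 - 1 - 1) * p t) * p t + (- 1 / 4) * \<psi> t powr (- 1 / 4 - 1) * p' t)"
      by (intro continuous_intros c1 c2 p) auto
  qed
  then show ?thesis by (rule that)
qed

section \<open>Assembly for a positive weight of class C2\<close>

theorem theorem3:
  fixes M :: "'a measure" and W :: "real \<Rightarrow> 'a \<Rightarrow> real"
    and \<psi> :: "real \<Rightarrow> real" and u \<theta> :: real
  assumes "u < 1"
    and "standard_brownian_motion M W"
    and "\<And>t. t \<in> {0..1} \<Longrightarrow> \<psi> t > 0"
    and "twice_continuously_differentiable_on \<psi> {0..1}"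
    and "\<theta> = (LBINT t:{0..1}. sqrt (\<psi> t))"
  shows "(\<lambda>\<epsilon>. small_ball_prob M \<psi> (W_sub u W) \<epsilon>) \<sim>[at_right 0]
         (\<lambda>\<epsilon>. 4 * \<psi> 0 powr (1 / 8) / ((1 - u) * sqrt pi * \<theta> * \<psi> 1 powr (1 / 8)) *
               \<epsilon> * exp (- (\<theta>\<^sup>2 / 8) * \<epsilon> powi (- 2)))"
proof -
  interpret BM: standard_brownian_motion M W by fact
  note \<psi>_pos = assms(3)
  define a where "a t = \<psi> t powr (- 1 / 4)" for t
  obtain a' a'' where "positive_C2 a a' a''"
    using twice_differentiable_powr[OF assms(3,4)] unfolding a_def[abs_def] by blast
  then interpret A: positive_C2 a a' a'' .
  have \<psi>_cont: "continuous_on {0..1} \<psi>"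
    using assms(4) DERIV_continuous_on unfolding twice_continuously_differentiable_on_def by metis
  have a4: "1 / a t ^ 4 = \<psi> t" "1 / (a t)\<^sup>2 = sqrt (\<psi> t)" if "t \<in> {0..1}" for t
  proof -
    have "a t ^ n = \<psi> t powr (- (n / 4))" for n :: nat
      using \<psi>_pos[OF that] unfolding a_def by (subst powr_realpow[symmetric]) (auto simp: powr_powr)
    note pow = this
    from pow[of 4] have "a t ^ 4 = 1 / \<psi> t"
      using \<psi>_pos[OF that] by (simp add: powr_minus_divide)
    then show "1 / a t ^ 4 = \<psi> t" by simp
    from pow[of 2] have "(a t)\<^sup>2 = 1 / sqrt (\<psi> t)"
      using \<psi>_pos[OF that] by (simp add: powr_minus_divide powr_half_sqrt)
    then show "1 / (a t)\<^sup>2 = sqrt (\<psi> t)" by simp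
  qed
  have sqrt_cont: "continuous_on {0..1} (\<lambda>t. sqrt (\<psi> t))"
    using \<psi>_cont by (intro continuous_intros)
  have \<theta>: "\<theta> = integral {0..1} (\<lambda>t. sqrt (\<psi> t))"
    unfolding assms(5) by (intro set_borel_integral_eq_integral borel_integrable_atLeastAtMost' sqrt_cont)
  \<comment> \<open>The shift by \<open>\<theta>\<close> puts the zero of \<open>x\<close> at time
    1, where the boundary slope is taken; the value \<open>- \<theta>\<close> at time 0 produces
    \<open>cosh (s * \<theta>)\<close> in the denominator of \<open>f 1 / f 0\<close>.\<close>
  define x where "x t = integral {0..t} (\<lambda>t. sqrt (\<psi> t)) - \<theta>" for t
  have x: "(x has_real_derivative 1 / (a t)\<^sup>2) (at t within {0..1})" if "t \<in> {0..1}" for t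
    unfolding a4(2)[OF that] x_def
    using integral_has_real_derivative[OF sqrt_cont that] by (auto intro!: derivative_eq_intros)
  have x01: "x 0 = - \<theta>" "x 1 = 0" by (simp_all add: x_def \<theta>)
  have "\<theta> > 0"
  proof -
    obtain t where t: "t \<in> {0..1}" "\<And>y. y \<in> {0..1} \<Longrightarrow> sqrt (\<psi> t) \<le> sqrt (\<psi> y)"
      using continuous_attains_inf[of "{0..1::real}" "\<lambda>t. sqrt (\<psi> t)"] sqrt_cont by auto
    have "integral {0..1::real} (\<lambda>_. sqrt (\<psi> t)) \<le> \<theta>"
      unfolding \<theta> by (intro Henstock_Kurzweil_Integration.integral_le integrable_continuous_interval sqrt_cont t) auto
    hence "sqrt (\<psi> t) \<le> \<theta>" by simp
    moreover have "sqrt (\<psi> t) > 0" using \<psi>_pos[OF t(1)] by simp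
    ultimately show ?thesis by linarith
  qed
  let ?Z = "W_sub u W" and ?\<kappa> = "1 / (1 - u)\<^sup>2 - 1"
  define q where "q = A.potential"
  have q_cont: "continuous_on {0..1} q" unfolding q_def by (rule A.cont_potential)
  \<comment> \<open>Since \<open>\<psi>\<close> is bounded away from 0, the bounded function
    \<open>q\<close> is at most a multiple of \<open>\<psi>\<close>. This bounds \<open>Q\<close> by
    a multiple of \<open>X\<close>, which is small on the ball.\<close>
  obtain C where C: "C \<ge> 0" "\<And>t. t \<in> {0..1} \<Longrightarrow> \<bar>q t\<bar> \<le> C * \<psi> t"
  proof -
    have "compact ((\<lambda>t. q t / \<psi> t) ` {0..1})"
      using \<psi>_pos by (intro compact_continuous_image continuous_on_divide q_cont \<psi>_cont) force+
    hence "bounded ((\<lambda>t. q t / \<psi> t) ` {0..1})" by (rule compact_imp_bounded)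
    then obtain C where "C > 0" "\<forall>y\<in>(\<lambda>t. q t / \<psi> t) ` {0..1}. norm y \<le> C"
      unfolding bounded_pos by blast
    note C = this
    show ?thesis
    proof (rule that[of C])
      fix t :: real assume t: "t \<in> {0..1}"
      have "norm (q t / \<psi> t) \<le> C" using C(2) t by blast
      then show "\<bar>q t\<bar> \<le> C * \<psi> t" using \<psi>_pos[OF t] by (simp add: pos_divide_le_eq)
    qed (use C in simp)
  qed
  obtain m where m: "m > 0" "\<And>t. t \<in> {0..1} \<Longrightarrow> m \<le> \<psi> t"
  proof -
    obtain t where "t \<in> {0..1}" "\<And>y. y \<in> {0..1} \<Longrightarrow> \<psi> t \<le> \<psi> y"
      using continuous_attains_inf[of "{0..1::real}" \<psi>] \<psi>_cont by auto
    then show ?thesis using \<psi>_pos that by blast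
  qed
  obtain X0 where X0 [measurable]: "X0 \<in> borel_measurable M"
    and X0_eq: "AE \<omega> in M. X0 \<omega> = integral {0..1} (\<lambda>t. \<psi> t * (?Z t \<omega>)\<^sup>2)"
    using BM.integral_measurable_version[OF \<psi>_cont] by blast
  obtain Q where Q [measurable]: "Q \<in> borel_measurable M"
    and Q_eq: "AE \<omega> in M. Q \<omega> = integral {0..1} (\<lambda>t. q t * (?Z t \<omega>)\<^sup>2)"
    using BM.integral_measurable_version[OF q_cont] by blast
  \<comment> \<open>The absolute value gives nonnegativity at every point; almost everywhere it
    changes nothing.\<close>
  define X where "X \<omega> = \<bar>X0 \<omega>\<bar>" for \<omega>
  have X [measurable]: "X \<in> borel_measurable M" unfolding X_def by measurable
  have Z_cont: "AE \<omega> in M. continuous_on {0..1} (\<lambda>t. ?Z t \<omega>)"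
    using BM.continuous_paths by eventually_elim (auto simp: W_sub_def intro!: continuous_intros)
  have X_eq: "AE \<omega> in M. X \<omega> = integral {0..1} (\<lambda>t. \<psi> t * (?Z t \<omega>)\<^sup>2)"
    using X0_eq Z_cont
  proof eventually_elim
    fix \<omega> assume X0: "X0 \<omega> = integral {0..1} (\<lambda>t. \<psi> t * (?Z t \<omega>)\<^sup>2)" and z: "continuous_on {0..1} (\<lambda>t. ?Z t \<omega>)"
    have "0 \<le> integral {0..1} (\<lambda>t. \<psi> t * (?Z t \<omega>)\<^sup>2)"
      using \<psi>_pos by (intro Henstock_Kurzweil_Integration.integral_nonneg integrable_continuous_interval continuous_intros \<psi>_cont z) (auto intro!: mult_nonneg_nonneg less_imp_le[OF \<psi>_pos])
    then show "X \<omega> = integral {0..1} (\<lambda>t. \<psi> t * (?Z t \<omega>)\<^sup>2)" by (simp add: X_def X0)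
  qed
  define f where "f s c t = a t * cosh (s * x t + c)" for s c t
  define f' where "f' s c t = a' t * cosh (s * x t + c) + s / a t * sinh (s * x t + c)" for s c t
  define f'' where "f'' s c t = (a'' t + s\<^sup>2 / a t ^ 3) * cosh (s * x t + c)" for s c t
  have BP: "brownian_potential M W (f s c) (f' s c) (f'' s c) u" for s c
    using A.liouville_green[OF x, of s c] assms(1,2)
    by (simp add: brownian_potential_def brownian_potential_axioms_def f_def[abs_def] f'_def[abs_def] f''_def[abs_def])
  have P2: "positive_C2 (f s c) (f' s c) (f'' s c)" for s c
    using BP by (simp add: brownian_potential_def)
  have pot: "positive_C2.potential (f s c) (f'' s c) t = q t + s\<^sup>2 * \<psi> t" if "t \<in> {0..1}" for s c t
  proof -
    have "cosh (s * x t + c) > 0" by (rule cosh_real_pos)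
    hence "f'' s c t / f s c t = a'' t / a t + s\<^sup>2 * (1 / a t ^ 4)"
      using A.f_pos[OF that] by (simp add: f_def f''_def field_simps eval_nat_numeral)
    then show ?thesis
      unfolding positive_C2.potential_def[OF P2] q_def A.potential_def a4(1)[OF that] .
  qed
  define \<alpha> where "\<alpha> = a' 1 / a 1"
  \<comment> \<open>For \<open>c = 0\<close> the slope is the same for all \<open>s\<close>, which
    gives a fixed weight; for \<open>c = 1\<close> it grows linearly in \<open>s\<close>, which
    gives the tilted transform.\<close>
  have slope: "f' s c 1 / f s c 1 = \<alpha> + s * (sqrt (\<psi> 1) * tanh c)" for s c
  proof -
    have "cosh c > 0" by (rule cosh_real_pos)
    hence "f' s c 1 / f s c 1 = \<alpha> + s * (1 / (a 1)\<^sup>2 * tanh c)"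
      using A.f_pos[of 1] by (simp add: f_def f'_def x01 \<alpha>_def tanh_def field_simps power2_eq_square)
    then show ?thesis by (simp add: a4)
  qed
  have limit: "AE \<omega> in M. brownian_potential.gibbs_limit W (f s c) (f' s c) (f'' s c) u \<omega>
      = (1 - u) * exp ((?\<kappa> + \<alpha> + sqrt (\<psi> 1) * tanh c * s) / 2 * (?Z 1 \<omega>)\<^sup>2 - Q \<omega> / 2 - s\<^sup>2 / 2 * X \<omega>)" for s c
    using X_eq Q_eq Z_cont
  proof eventually_elim
    fix \<omega> assume X: "X \<omega> = integral {0..1} (\<lambda>t. \<psi> t * (?Z t \<omega>)\<^sup>2)" and Q: "Q \<omega> = integral {0..1} (\<lambda>t. q t * (?Z t \<omega>)\<^sup>2)"
      and z: "continuous_on {0..1} (\<lambda>t. ?Z t \<omega>)"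
    have "integral {0..1} (\<lambda>t. positive_C2.potential (f s c) (f'' s c) t * (?Z t \<omega>)\<^sup>2)
        = integral {0..1} (\<lambda>t. q t * (?Z t \<omega>)\<^sup>2 + s\<^sup>2 * (\<psi> t * (?Z t \<omega>)\<^sup>2))"
      by (intro Henstock_Kurzweil_Integration.integral_cong) (auto simp: pot algebra_simps)
    also have "\<dots> = Q \<omega> + s\<^sup>2 * X \<omega>"
      unfolding X Q by (subst Henstock_Kurzweil_Integration.integral_add) (auto intro!: integrable_continuous_interval continuous_intros q_cont \<psi>_cont z)
    finally show "brownian_potential.gibbs_limit W (f s c) (f' s c) (f'' s c) u \<omega>
      = (1 - u) * exp ((?\<kappa> + \<alpha> + sqrt (\<psi> 1) * tanh c * s) / 2 * (?Z 1 \<omega>)\<^sup>2 - Q \<omega> / 2 - s\<^sup>2 / 2 * X \<omega>)"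
      unfolding brownian_potential.gibbs_limit_def[OF BP] slope by (simp add: add_divide_distrib algebra_simps)
  qed
  let ?E = "\<lambda>s c \<omega>. exp ((?\<kappa> + \<alpha> + sqrt (\<psi> 1) * tanh c * s) / 2 * (?Z 1 \<omega>)\<^sup>2 - Q \<omega> / 2 - s\<^sup>2 / 2 * X \<omega>)"
  have Z1 [measurable]: "?Z 1 \<in> borel_measurable M" by (rule BM.W_sub_measurable) simp
  have nn: "(\<integral>\<^sup>+\<omega>. ennreal (?E s c \<omega>) \<partial>M)
      = ennreal (1 / (1 - u)) * (\<integral>\<^sup>+\<omega>. ennreal (brownian_potential.gibbs_limit W (f s c) (f' s c) (f'' s c) u \<omega>) \<partial>M)" for s c
  proof -
    have "(\<integral>\<^sup>+\<omega>. ennreal (brownian_potential.gibbs_limit W (f s c) (f' s c) (f'' s c) u \<omega>) \<partial>M)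
        = (\<integral>\<^sup>+\<omega>. ennreal (1 - u) * ennreal (?E s c \<omega>) \<partial>M)"
      using limit[of s c] assms(1) by (intro nn_integral_cong_AE) (auto elim!: eventually_mono simp: ennreal_mult)
    also have "\<dots> = ennreal (1 - u) * (\<integral>\<^sup>+\<omega>. ennreal (?E s c \<omega>) \<partial>M)"
      by (rule nn_integral_cmult) measurable
    finally show ?thesis
      using assms(1) by (simp add: mult.assoc[symmetric] ennreal_mult[symmetric])
  qed
  \<comment> \<open>\<open>b\<close> is what the comparison with \<open>exp (b * t)\<close> demands.
    For \<open>s \<ge> s0\<close> one has \<open>s\<^sup>2 \<ge> b\<^sup>2 / m + C\<close>, hence
    \<open>q + s\<^sup>2 \<psi> \<ge> (s\<^sup>2 - C) \<psi> \<ge> b\<^sup>2\<close>.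
    \<open>B\<close> is the part of \<open>sqrt (f 1 / f 0) / (1 - u)\<close> free of
    \<open>s\<close>, and \<open>D\<close> absorbs the constants lost through the shift by
    1.\<close>
  define b where "b = 2 * \<bar>\<alpha>\<bar> + \<bar>?\<kappa>\<bar> + 1"
  define s0 where "s0 = sqrt (b\<^sup>2 / m + C) + 1"
  define B where "B = sqrt (a 1 / a 0) / (1 - u)"
  define D where "D = B * sqrt (2 * exp 1 * cosh 1)"
  have a01: "a 0 > 0" "a 1 > 0" by (auto intro!: A.f_pos)
  have B: "B > 0" using a01 assms(1) by (simp add: B_def)
  interpret S: small_ball_laplace M X "?Z 1" Q \<theta> "?\<kappa> + \<alpha>" "sqrt (\<psi> 1) * tanh 1" B C D s0
  proof
    show "X \<omega> \<ge> 0" for \<omega> by (simp add: X_def)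
    show "AE \<omega> in M. \<bar>Q \<omega>\<bar> \<le> C * X \<omega>"
      using X_eq Q_eq Z_cont
    proof eventually_elim
      fix \<omega> assume X: "X \<omega> = integral {0..1} (\<lambda>t. \<psi> t * (?Z t \<omega>)\<^sup>2)" and Q: "Q \<omega> = integral {0..1} (\<lambda>t. q t * (?Z t \<omega>)\<^sup>2)"
        and z: "continuous_on {0..1} (\<lambda>t. ?Z t \<omega>)"
      have "norm (integral {0..1} (\<lambda>t. q t * (?Z t \<omega>)\<^sup>2)) \<le> integral {0..1} (\<lambda>t. C * (\<psi> t * (?Z t \<omega>)\<^sup>2))"
      proof (rule Henstock_Kurzweil_Integration.integral_norm_bound_integral)
        fix t :: real assume "t \<in> {0..1}"
        from mult_right_mono[OF C(2)[OF this], of "(?Z t \<omega>)\<^sup>2"]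
        show "norm (q t * (?Z t \<omega>)\<^sup>2) \<le> C * (\<psi> t * (?Z t \<omega>)\<^sup>2)" by (simp add: abs_mult mult.assoc)
      qed (intro integrable_continuous_interval continuous_intros q_cont \<psi>_cont z)+
      then show "\<bar>Q \<omega>\<bar> \<le> C * X \<omega>" by (simp add: X Q)
    qed
    show "C \<ge> 0" "\<theta> > 0" "B > 0" by fact+
    show "sqrt (\<psi> 1) * tanh 1 > 0" using \<psi>_pos[of 1] by simp
    show "D \<ge> 0" using B by (simp add: D_def)
    show "s0 > 0" using C m by (simp add: s0_def add_nonneg_pos)
    fix s assume s: "s \<ge> s0"
    have "b\<^sup>2 / m + C \<le> s\<^sup>2"
    proof -
      have "sqrt (b\<^sup>2 / m + C) \<le> s" using s by (simp add: s0_def)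
      then show ?thesis by (rule sqrt_le_D)
    qed
    have "b\<^sup>2 \<le> q t + s\<^sup>2 * \<psi> t" if t: "t \<in> {0..1}" for t
    proof -
      have le: "b\<^sup>2 / m \<le> s\<^sup>2 - C" using \<open>b\<^sup>2 / m + C \<le> s\<^sup>2\<close> by (simp only: le_diff_eq)
      have "0 \<le> b\<^sup>2 / m" using m by simp
      from order_trans[OF this le] have "b\<^sup>2 / m * m \<le> (s\<^sup>2 - C) * \<psi> t"
        using le m t by (intro mult_mono) auto
      moreover have "b\<^sup>2 = b\<^sup>2 / m * m" using m by simp
      ultimately have "b\<^sup>2 \<le> (s\<^sup>2 - C) * \<psi> t" by simp
      also have "\<dots> \<le> q t + s\<^sup>2 * \<psi> t" using C(2)[OF t] by (simp add: left_diff_distrib)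
      finally show ?thesis .
    qed
    hence "(\<integral>\<^sup>+\<omega>. ennreal (brownian_potential.gibbs_limit W (f s 0) (f' s 0) (f'' s 0) u \<omega>) \<partial>M)
        = ennreal (sqrt (f s 0 1 / f s 0 0))"
      by (intro brownian_potential.nn_integral_gibbs_limit_eq[OF BP, of s 0 b]) (auto simp: slope b_def pot)
    hence "(\<integral>\<^sup>+\<omega>. ennreal (?E s 0 \<omega>) \<partial>M) = ennreal (1 / (1 - u) * sqrt (f s 0 1 / f s 0 0))"
      unfolding nn using assms(1) by (subst ennreal_mult') auto
    also have "1 / (1 - u) * sqrt (f s 0 1 / f s 0 0) = B * cosh (s * \<theta>) powr (- 1 / 2)"
      using cosh_real_pos[of "s * \<theta>"]
      by (simp add: f_def x01 B_def real_sqrt_divide real_sqrt_mult powr_minus_divide powr_half_sqrt)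
    finally show "(\<integral>\<^sup>+\<omega>. ennreal (exp ((?\<kappa> + \<alpha>) / 2 * (?Z 1 \<omega>)\<^sup>2 - Q \<omega> / 2 - s\<^sup>2 / 2 * X \<omega>)) \<partial>M)
        = ennreal (B * cosh (s * \<theta>) powr (- 1 / 2))" by simp
    \<comment> \<open>At time 0 the shifted argument is \<open>1 - s * \<theta>\<close>, whose
      hyperbolic cosine still has order \<open>exp (s * \<theta>)\<close>; the shift costs a
      constant only.\<close>
    have "exp (s * \<theta> - 1) / 2 \<le> cosh (- (s * \<theta>) + 1)"
      by (simp add: cosh_def)
    hence "1 / cosh (- (s * \<theta>) + 1) \<le> 1 / (exp (s * \<theta> - 1) / 2)"
      by (intro frac_le) auto
    also have "\<dots> = 2 * exp 1 * exp (- (s * \<theta>))" by (simp add: exp_diff exp_minus field_simps)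
    finally have "a 1 / a 0 * cosh 1 * (1 / cosh (- (s * \<theta>) + 1)) \<le> a 1 / a 0 * cosh 1 * (2 * exp 1 * exp (- (s * \<theta>)))"
      using a01 by (intro mult_left_mono) auto
    hence "sqrt (f s 1 1 / f s 1 0) \<le> sqrt (a 1 / a 0 * cosh 1 * (2 * exp 1 * exp (- (s * \<theta>))))"
      by (simp add: f_def x01)
    also have "\<dots> = sqrt (a 1 / a 0) * sqrt (2 * exp 1 * cosh 1) * sqrt (exp (- (s * \<theta>)))"
      by (simp add: real_sqrt_mult[symmetric] mult_ac)
    also have "sqrt (exp (- (s * \<theta>))) = exp (- s * \<theta> / 2)"
      by (rule real_sqrt_unique) (auto simp: exp_double[symmetric])
    finally have "1 / (1 - u) * sqrt (f s 1 1 / f s 1 0) \<le> D * exp (- s * \<theta> / 2)"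
      using assms(1) by (simp add: D_def B_def divide_right_mono)
    \<comment> \<open>An upper bound is all that is required of the tilted transform, so Fatou's
      inequality suffices.\<close>
    have "(\<integral>\<^sup>+\<omega>. ennreal (?E s 1 \<omega>) \<partial>M) \<le> ennreal (1 / (1 - u)) * ennreal (sqrt (f s 1 1 / f s 1 0))"
      unfolding nn by (intro mult_left_mono brownian_potential.nn_integral_gibbs_limit_le[OF BP]) auto
    also have "\<dots> = ennreal (1 / (1 - u) * sqrt (f s 1 1 / f s 1 0))"
      using assms(1) by (subst ennreal_mult') auto
    also have "\<dots> \<le> ennreal (D * exp (- s * \<theta> / 2))" by (rule ennreal_leI) fact
    finally show "(\<integral>\<^sup>+\<omega>. ennreal (exp ((?\<kappa> + \<alpha> + sqrt (\<psi> 1) * tanh 1 * s) / 2 * (?Z 1 \<omega>)\<^sup>2 - Q \<omega> / 2 - s\<^sup>2 / 2 * X \<omega>)) \<partial>M)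
        \<le> ennreal (D * exp (- s * \<theta> / 2))" .
  qed (use X Q Z1 in auto)
  \<comment> \<open>The exponents \<open>1 / 8\<close> arise from the square root of
    \<open>a = \<psi> powr (- 1 / 4)\<close>; the negative exponent moves \<open>\<psi> 0\<close> to
    the numerator.\<close>
  have B_eq: "B = \<psi> 0 powr (1 / 8) / ((1 - u) * \<psi> 1 powr (1 / 8))"
  proof -
    have "sqrt (a t) = 1 / \<psi> t powr (1 / 8)" if "t \<in> {0..1}" for t
    proof -
      have "sqrt (a t) = (\<psi> t powr (- 1 / 4)) powr (1 / 2)"
        unfolding a_def by (rule powr_half_sqrt[symmetric]) simp
      also have "\<dots> = \<psi> t powr - (1 / 8)" by (subst powr_powr) simp
      finally show ?thesis by (simp only: powr_minus_divide)
    qed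
    then show ?thesis by (simp add: B_def real_sqrt_divide)
  qed
  \<comment> \<open>The ball of radius \<open>\<epsilon>\<close> is the event
    \<open>X \<le> \<epsilon>\<^sup>2\<close>, and the factor \<open>sqrt r\<close> of
    \<open>rate\<close> becomes \<open>\<epsilon>\<close>.\<close>
  have "filterlim (\<lambda>\<epsilon>::real. \<epsilon>\<^sup>2) (at_right 0) (at_right 0)" by real_asymp
  from filterlim_compose[OF S.small_ball_asymp this]
  have "((\<lambda>\<epsilon>. BM.prob {\<omega> \<in> space M. X \<omega> \<le> \<epsilon>\<^sup>2} / S.rate (\<epsilon>\<^sup>2)) \<longlongrightarrow> 1) (at_right 0)" .
  moreover have "\<forall>\<^sub>F \<epsilon> in at_right 0. BM.prob {\<omega> \<in> space M. X \<omega> \<le> \<epsilon>\<^sup>2} / S.rate (\<epsilon>\<^sup>2)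
    = small_ball_prob M \<psi> ?Z \<epsilon> / (4 * \<psi> 0 powr (1 / 8) / ((1 - u) * sqrt pi * \<theta> * \<psi> 1 powr (1 / 8)) *
               \<epsilon> * exp (- (\<theta>\<^sup>2 / 8) * \<epsilon> powi (- 2)))"
    using eventually_at_right_less[of 0]
  proof eventually_elim
    fix \<epsilon> :: real assume \<epsilon>: "0 < \<epsilon>"
    have "S.rate (\<epsilon>\<^sup>2) = 4 * \<psi> 0 powr (1 / 8) / ((1 - u) * sqrt pi * \<theta> * \<psi> 1 powr (1 / 8)) *
               \<epsilon> * exp (- (\<theta>\<^sup>2 / 8) * \<epsilon> powi (- 2))"
      unfolding S.rate_def unfolding B_eq using \<epsilon> by (simp add: power_int_minus field_simps)
    then show "BM.prob {\<omega> \<in> space M. X \<omega> \<le> \<epsilon>\<^sup>2} / S.rate (\<epsilon>\<^sup>2)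
    = small_ball_prob M \<psi> ?Z \<epsilon> / (4 * \<psi> 0 powr (1 / 8) / ((1 - u) * sqrt pi * \<theta> * \<psi> 1 powr (1 / 8)) *
               \<epsilon> * exp (- (\<theta>\<^sup>2 / 8) * \<epsilon> powi (- 2)))"
      using BM.small_ball_prob_eq[OF \<psi>_cont \<epsilon> X X_eq] by simp
  qed
  ultimately have "((\<lambda>\<epsilon>. small_ball_prob M \<psi> ?Z \<epsilon> / (4 * \<psi> 0 powr (1 / 8) / ((1 - u) * sqrt pi * \<theta> * \<psi> 1 powr (1 / 8)) *
               \<epsilon> * exp (- (\<theta>\<^sup>2 / 8) * \<epsilon> powi (- 2)))) \<longlongrightarrow> 1) (at_right 0)"
    by (rule Lim_transform_eventually)
  then show ?thesis by (rule asymp_equivI')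
qed

end
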